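(* Let $\Omega\subset\mathbb{R}^d$ be an open neighbourhood of $\mathbf{0}$, $k\ge1$, $K\in\mathcal{C}^{(k+1,k+1)}(\Omega\times\Omega)$, $\mathbf{x}_1,\ldots,\mathbf{x}_n\in\mathbb{R}^d$ with $\#\mathbb{P}_{k-1}<n\le\#\mathbb{P}_k$, $\ell=\#\mathbb{P}_k-n$, and $\mathbf{K}_\varepsilon=[K(\varepsilon\mathbf{x}_i,\varepsilon\mathbf{x}_j)]_{i,j=1}^n$. Assume that for some $\varepsilon_0>0$, $\mathbf{K}_\varepsilon$ is symmetric positive semidefinite on $[0,\varepsilon_0]$ and analytic in $\varepsilon$ near $0$. List its eigenvalues (for small $\varepsilon>0$) in nonincreasing order and split them consecutively into groups $s=0,1,\ldots,k$ of sizes $N_s=\#\mathbb{H}_s$ for $s<k$ and $N_k=\#\mathbb{H}_k-\ell$, denoting them $\lambda_{s,j}(\varepsilon)$, $1\le j\le N_s$, with limiting eigenvectors $\mathbf{p}_{s,j}$. Then $\lambda_{s,j}(\varepsilon)=\varepsilon^{2s}(\widetilde\lambda_{s,j}+\mathcal{O}(\varepsilon))$ for real numbers $\widetilde\lambda_{s,j}$, where $\widetilde\lambda_{0,1}=nK(\mathbf{0},\mathbf{0})$, and: 1. For $1\le s<k$, if $\det\mathbf{W}_{s-1}\neq0$ and $\mathbf{V}_{\le s-1}$ has full column rank, then \[\prod_{j=1}^{\#\mathbb{H}_s}\widetilde\lambda_{s,j}=\frac{\det(\mathbf{V}_{\le s}^\top\mathbf{V}_{\le s})\det(\mathbf{W}_s)}{\det(\mathbf{V}_{\le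 s-1}^\top\mathbf{V}_{\le s-1})\det(\mathbf{W}_{s-1})}.\] 2. For $1\le s\le k$, if $\det\mathbf{W}_{s-1}\neq0$ and $\mathbf{V}_{\le s-1}$ has full column rank, then $\widetilde\lambda_{s,1},\ldots,\widetilde\lambda_{s,N_s}$ are the eigenvalues of $\mathbf{Q}_s^\top\mathbf{V}_s\widetilde{\mathbf{W}}\mathbf{V}_s^\top\mathbf{Q}_s$, where $\widetilde{\mathbf{W}}=\mathbf{W}_{\lrcorner}-\mathbf{W}_{\llcorner}\mathbf{W}_{s-1}^{-1}\mathbf{W}_{\urcorner}$ comes from the partition $\mathbf{W}_s=\begin{bmatrix}\mathbf{W}_{s-1}&\mathbf{W}_{\urcorner}\\\mathbf{W}_{\llcorner}&\mathbf{W}_{\lrcorner}\end{bmatrix}$ (with $\mathbf{W}_{\lrcorner}$ indexed by $\mathbb{H}_s\times\mathbb{H}_s$). 3. For $0\le s<k$, if $\det\mathbf{W}_s\neq0$ and $\mathbf{V}_{\le s}$ has full column rank, then $\mathbf{p}_{s,1},\ldots,\mathbf{p}_{s,\#\mathbb{H}_s}$ span the column space of $\mathbf{Q}_s$. Moreover, if $\det\mathbf{W}_{k-1}\neq0$ and $\mathbf{V}_{\le k-1}$ has full column rank, the remaining limiting eigenvectors $\mathbf{p}_{k,1},\ldots,\mathbf{p}_{k,N_k}$ span the column space of $\mathbf{Q}_k$. Here $\mathbf{Q}_{\rm full}=[\mathbf{Q}_0\ \mathbf{Q}_1\cdots\mathbf{Q}_k]$ is the orthogonal factor of a full QR factorization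 of $\mathbf{V}_{\le k-1}$, partitioned so that $\mathbf{Q}_s\in\mathbb{R}^{n\times\#\mathbb{H}_s}$ for $s<k$ and $\mathbf{Q}_k\in\mathbb{R}^{n\times(\#\mathbb{H}_k-\ell)}$.
   Context: Multi-indices $\boldsymbol\alpha\in\mathbb{Z}_+^d$: $|\boldsymbol\alpha|=\sum_i\alpha_i$, $\boldsymbol\alpha!=\prod_i\alpha_i!$, $\mathbf{x}^{\boldsymbol\alpha}=\prod_ix_i^{\alpha_i}$; $\mathbb{P}_k=\{|\boldsymbol\alpha|\le k\}$, $\mathbb{H}_k=\{|\boldsymbol\alpha|=k\}$, $\#\mathbb{P}_k=\binom{k+d}{d}$, $\#\mathbb{H}_k=\binom{k+d-1}{d-1}$ (so $\#\mathbb{H}_0=1$, $\#\mathbb{H}_1=d$). A fixed graded total order on multi-indices is used. $\mathbf{V}_{\mathcal{A}}=[\mathbf{x}_i^{\boldsymbol\alpha}]_{i\le n,\boldsymbol\alpha\in\mathcal{A}}$ (columns in the chosen order), $\mathbf{V}_{\le k}=\mathbf{V}_{\mathbb{P}_k}$, $\mathbf{V}_k=\mathbf{V}_{\mathbb{H}_k}$. $K\in\mathcal{C}^{(k,k)}(\Omega\times\Omega)$ means all $K^{(\boldsymbol\alpha,\boldsymbol\beta)}=\partial^{\boldsymbol\alpha}_{\mathbf{x}}\partial^{\boldsymbol\beta}_{\mathbf{y}}K$, $\boldsymbol\alpha,\boldsymbol\beta\in\mathbb{P}_k$, exist and are continuous. Wronskian $\mathbf{W}_s=\Big[\frac{K^{(\boldsymbol\alpha,\boldsymbol\beta)}(\mathbf{0},\mathbf{0})}{\boldsymbol\alpha!\boldsymbol\beta!}\Big]_{\boldsymbol\alpha,\boldsymbol\beta\in\mathbb{P}_s}$.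 Full QR: $\mathbf{V}=\mathbf{Q}_{\rm full}\begin{bmatrix}\mathbf{R}\\\mathbf{0}\end{bmatrix}$, $\mathbf{Q}_{\rm full}$ orthogonal, $\mathbf{R}$ upper triangular. Limiting eigenvectors: for a matrix analytic in $\varepsilon$ and symmetric for real $\varepsilon$, eigenvalues and orthogonal rank-one eigenprojectors $\mathbf{P}(\varepsilon)$ can be chosen analytic near $0$; the limiting eigenvector $\mathbf{p}$ is a unit vector with $\mathbf{P}(0)=\mathbf{p}\mathbf{p}^\top$. *)

theory Defs
  imports "HOL-Analysis.Analysis" "HOL-Library.Landau_Symbols"
    "Jordan_Normal_Form.DL_Rank" "Jordan_Normal_Form.Char_Poly"
begin

type_synonym 'd pt = "(real, 'd) Finite_Cartesian_Product.vec"

definition mdeg :: "('d::finite \<Rightarrow> nat) \<Rightarrow> nat" where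
  "mdeg \<alpha> = (\<Sum>i\<in>UNIV. \<alpha> i)"

definition mfact :: "('d::finite \<Rightarrow> nat) \<Rightarrow> real" where
  "mfact \<alpha> = (\<Prod>i\<in>UNIV. fact (\<alpha> i))"

definition mpow :: "'d pt \<Rightarrow> ('d::finite \<Rightarrow> nat) \<Rightarrow> real" where
  "mpow x \<alpha> = (\<Prod>i\<in>UNIV. (x $ i) ^ (\<alpha> i))"

definition cardP :: "'d::finite itself \<Rightarrow> nat \<Rightarrow> nat" where
  "cardP _ k = card {\<alpha>::'d \<Rightarrow> nat. mdeg \<alpha> \<le> k}"

definition cardH :: "'d::finite itself \<Rightarrow> nat \<Rightarrow> nat" where
  "cardH _ k = card {\<alpha>::'d \<Rightarrow> nat. mdeg \<alpha> = k}"

text \<open>Position of the first multi-index of degree s in the graded order (= #P_{s-1}).\<close>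
definition offs :: "'d::finite itself \<Rightarrow> nat \<Rightarrow> nat" where
  "offs T s = (if s = 0 then 0 else cardP T (s - 1))"

text \<open>A graded total order on multi-indices, given as its enumeration e 0, e 1, ...\<close>
definition graded_enum :: "(nat \<Rightarrow> ('d::finite \<Rightarrow> nat)) \<Rightarrow> bool" where
  "graded_enum e \<longleftrightarrow> bij e \<and> (\<forall>a b. a \<le> b \<longrightarrow> mdeg (e a) \<le> mdeg (e b))"

definition Vle :: "(nat \<Rightarrow> ('d::finite \<Rightarrow> nat)) \<Rightarrow> (nat \<Rightarrow> 'd pt) \<Rightarrow> nat \<Rightarrow> nat \<Rightarrow> real mat" where
  "Vle e xs n s = mat n (cardP TYPE('d) s) (\<lambda>(i, a). mpow (xs i) (e a))"

definition Vh :: "(nat \<Rightarrow> ('d::finite \<Rightarrow> nat)) \<Rightarrow> (nat \<Rightarrow> 'd pt) \<Rightarrow> nat \<Rightarrow> nat \<Rightarrow> real mat" where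
  "Vh e xs n s = mat n (cardH TYPE('d) s) (\<lambda>(i, a). mpow (xs i) (e (offs TYPE('d) s + a)))"

definition dX :: "'d::finite \<Rightarrow> ('d pt \<Rightarrow> 'd pt \<Rightarrow> real) \<Rightarrow> 'd pt \<Rightarrow> 'd pt \<Rightarrow> real" where
  "dX i F x y = deriv (\<lambda>t. F (x + t *\<^sub>R axis i 1) y) 0"

definition dY :: "'d::finite \<Rightarrow> ('d pt \<Rightarrow> 'd pt \<Rightarrow> real) \<Rightarrow> 'd pt \<Rightarrow> 'd pt \<Rightarrow> real" where
  "dY i F x y = deriv (\<lambda>t. F x (y + t *\<^sub>R axis i 1)) 0"

fun iterX :: "'d::finite list \<Rightarrow> ('d pt \<Rightarrow> 'd pt \<Rightarrow> real) \<Rightarrow> 'd pt \<Rightarrow> 'd pt \<Rightarrow> real" where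
  "iterX [] F = F"
| "iterX (i # is) F = dX i (iterX is F)"

fun iterY :: "'d::finite list \<Rightarrow> ('d pt \<Rightarrow> 'd pt \<Rightarrow> real) \<Rightarrow> 'd pt \<Rightarrow> 'd pt \<Rightarrow> real" where
  "iterY [] F = F"
| "iterY (i # is) F = dY i (iterY is F)"

fun exX :: "('d pt) set \<Rightarrow> 'd::finite list \<Rightarrow> ('d pt \<Rightarrow> 'd pt \<Rightarrow> real) \<Rightarrow> bool" where
  "exX \<Omega> [] F = True"
| "exX \<Omega> (i # is) F \<longleftrightarrow> exX \<Omega> is F \<and>
     (\<forall>x\<in>\<Omega>. \<forall>y\<in>\<Omega>. (\<lambda>t. iterX is F (x + t *\<^sub>R axis i 1) y) differentiable (at 0))"

fun exY :: "('d pt) set \<Rightarrow> 'd::finite list \<Rightarrow> ('d pt \<Rightarrow> 'd pt \<Rightarrow> real) \<Rightarrow> bool" where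
  "exY \<Omega> [] F = True"
| "exY \<Omega> (i # is) F \<longleftrightarrow> exY \<Omega> is F \<and>
     (\<forall>x\<in>\<Omega>. \<forall>y\<in>\<Omega>. (\<lambda>t. iterY is F x (y + t *\<^sub>R axis i 1)) differentiable (at 0))"

text \<open>\<partial>^\<alpha> = \<partial>_1^{\<alpha>_1} ... \<partial>_d^{\<alpha>_d} (coordinates in the order of the linorder on 'd).\<close>
definition canon :: "('d::{finite,linorder} \<Rightarrow> nat) \<Rightarrow> 'd list" where
  "canon \<alpha> = concat (map (\<lambda>i. replicate (\<alpha> i) i) (sorted_list_of_set UNIV))"

definition Kder :: "('d::{finite,linorder} \<Rightarrow> nat) \<Rightarrow> ('d \<Rightarrow> nat) \<Rightarrow> ('d pt \<Rightarrow> 'd pt \<Rightarrow> real)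
    \<Rightarrow> 'd pt \<Rightarrow> 'd pt \<Rightarrow> real" where
  "Kder \<alpha> \<beta> K = iterX (canon \<alpha>) (iterY (canon \<beta>) K)"

definition Kder_exists :: "('d::{finite,linorder} pt) set \<Rightarrow> ('d \<Rightarrow> nat) \<Rightarrow> ('d \<Rightarrow> nat)
    \<Rightarrow> ('d pt \<Rightarrow> 'd pt \<Rightarrow> real) \<Rightarrow> bool" where
  "Kder_exists \<Omega> \<alpha> \<beta> K \<longleftrightarrow> exY \<Omega> (canon \<beta>) K \<and> exX \<Omega> (canon \<alpha>) (iterY (canon \<beta>) K)"

definition Ckk :: "nat \<Rightarrow> ('d::{finite,linorder} pt) set \<Rightarrow> ('d pt \<Rightarrow> 'd pt \<Rightarrow> real) \<Rightarrow> bool" where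
  "Ckk k \<Omega> K \<longleftrightarrow> (\<forall>\<alpha> \<beta>. mdeg \<alpha> \<le> k \<longrightarrow> mdeg \<beta> \<le> k \<longrightarrow>
      Kder_exists \<Omega> \<alpha> \<beta> K \<and> continuous_on (\<Omega> \<times> \<Omega>) (\<lambda>z. Kder \<alpha> \<beta> K (fst z) (snd z)))"

definition Wr :: "(nat \<Rightarrow> ('d::{finite,linorder} \<Rightarrow> nat)) \<Rightarrow> ('d pt \<Rightarrow> 'd pt \<Rightarrow> real) \<Rightarrow> nat \<Rightarrow> real mat" where
  "Wr e K s = mat (cardP TYPE('d) s) (cardP TYPE('d) s)
     (\<lambda>(a, b). Kder (e a) (e b) K 0 0 / (mfact (e a) * mfact (e b)))"

definition minv :: "real mat \<Rightarrow> real mat" where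
  "minv A = (SOME B. B \<in> carrier_mat (dim_row A) (dim_row A) \<and>
                     A * B = 1\<^sub>m (dim_row A) \<and> B * A = 1\<^sub>m (dim_row A))"

definition Wtil :: "(nat \<Rightarrow> ('d::{finite,linorder} \<Rightarrow> nat)) \<Rightarrow> ('d pt \<Rightarrow> 'd pt \<Rightarrow> real) \<Rightarrow> nat \<Rightarrow> real mat" where
  "Wtil e K s = (case split_block (Wr e K s) (cardP TYPE('d) (s - 1)) (cardP TYPE('d) (s - 1)) of
      (W1, Wur, Wll, Wlr) \<Rightarrow> Wlr - Wll * minv (Wr e K (s - 1)) * Wur)"

definition Kmat :: "('d::finite pt \<Rightarrow> 'd pt \<Rightarrow> real) \<Rightarrow> (nat \<Rightarrow> 'd pt) \<Rightarrow> nat \<Rightarrow> real \<Rightarrow> real mat" where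
  "Kmat K xs n \<epsilon> = mat n n (\<lambda>(i, j). K (\<epsilon> *\<^sub>R xs i) (\<epsilon> *\<^sub>R xs j))"

definition analytic_near0 :: "(real \<Rightarrow> real) \<Rightarrow> bool" where
  "analytic_near0 f \<longleftrightarrow> (\<exists>r>0. \<exists>c. \<forall>t. \<bar>t\<bar> < r \<longrightarrow> (\<lambda>m. c m * t ^ m) sums f t)"

definition sym_mat :: "real mat \<Rightarrow> bool" where
  "sym_mat A \<longleftrightarrow> transpose_mat A = A"

definition psd_mat :: "real mat \<Rightarrow> bool" where
  "psd_mat A \<longleftrightarrow> (\<forall>v\<in>carrier_vec (dim_row A). 0 \<le> v \<bullet> (A *\<^sub>v v))"

definition analytic_eig :: "('d::finite pt \<Rightarrow> 'd pt \<Rightarrow> real) \<Rightarrow> (nat \<Rightarrow> 'd pt) \<Rightarrow> nat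
    \<Rightarrow> (nat \<Rightarrow> real \<Rightarrow> real) \<Rightarrow> (nat \<Rightarrow> real \<Rightarrow> real mat) \<Rightarrow> bool" where
  "analytic_eig K xs n lam P \<longleftrightarrow> (\<exists>\<delta>>0.
     (\<forall>i<n. analytic_near0 (lam i)) \<and>
     (\<forall>i<n. \<forall>a<n. \<forall>b<n. analytic_near0 (\<lambda>\<epsilon>. P i \<epsilon> $$ (a, b))) \<and>
     (\<forall>\<epsilon>. \<bar>\<epsilon>\<bar> < \<delta> \<longrightarrow>
        (\<forall>i<n. P i \<epsilon> \<in> carrier_mat n n \<and> P i \<epsilon> * P i \<epsilon> = P i \<epsilon> \<and>
               transpose_mat (P i \<epsilon>) = P i \<epsilon> \<and> vec_space.rank n (P i \<epsilon>) = 1) \<and>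
        (\<forall>i<n. \<forall>j<n. i \<noteq> j \<longrightarrow> P i \<epsilon> * P j \<epsilon> = 0\<^sub>m n n) \<and>
        (\<forall>a<n. \<forall>b<n. Kmat K xs n \<epsilon> $$ (a, b) = (\<Sum>i<n. lam i \<epsilon> * P i \<epsilon> $$ (a, b)))) \<and>
     (\<forall>\<epsilon>. 0 < \<epsilon> \<and> \<epsilon> < \<delta> \<longrightarrow> (\<forall>i j. i \<le> j \<and> j < n \<longrightarrow> lam j \<epsilon> \<le> lam i \<epsilon>)))"

definition limiting_eigvec :: "nat \<Rightarrow> (real \<Rightarrow> real mat) \<Rightarrow> real vec \<Rightarrow> bool" where
  "limiting_eigvec n P p \<longleftrightarrow> p \<in> carrier_vec n \<and> p \<bullet> p = 1 \<and>
     P 0 = mat n n (\<lambda>(a, b). p $ a * p $ b)"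

definition full_QR :: "real mat \<Rightarrow> real mat \<Rightarrow> real mat \<Rightarrow> bool" where
  "full_QR V Qf R \<longleftrightarrow> Qf \<in> carrier_mat (dim_row V) (dim_row V) \<and>
     transpose_mat Qf * Qf = 1\<^sub>m (dim_row V) \<and> Qf * transpose_mat Qf = 1\<^sub>m (dim_row V) \<and>
     R \<in> carrier_mat (dim_col V) (dim_col V) \<and> upper_triangular R \<and>
     V = Qf * (R @\<^sub>r 0\<^sub>m (dim_row V - dim_col V) (dim_col V))"

definition col_block :: "real mat \<Rightarrow> nat \<Rightarrow> nat \<Rightarrow> real mat" where
  "col_block Q c m = mat (dim_row Q) m (\<lambda>(i, j). Q $$ (i, c + j))"

definition vspan :: "nat \<Rightarrow> real vec set \<Rightarrow> real vec set" where
  "vspan n S = LinearCombinations.module.span class_ring (module_vec TYPE(real) n) S"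

end

theory Submission
  imports Defs
begin

text \<open>
  Let \<open>Q\<close> be the orthogonal QR factor and give its \<open>j\<close>-th column the degree \<open>g j\<close> of the \<open>j\<close>-th
  multi-index. The \<open>j\<close>-th column annihilates all monomials of degree below \<open>g j\<close>, so Taylor expansion
  of \<open>K\<close> in both variables shows that the entries of \<open>M = Q\<^sup>T K\<^sub>\<epsilon> Q\<close>, divided by
  \<open>\<epsilon> ^ (g i + g j)\<close>, converge to a matrix \<open>G\<close> built from the Wronskian. A Ky Fan type trace inequality
  for the trailing diagonal entries of \<open>M\<close> gives \<open>lam i = O(\<epsilon>\<^sup>2\<^sup>g\<^sup>i)\<close>, and analyticity of the eigenvalues
  turns this into an expansion with a leading coefficient. Scaling the rows and columns of
  \<open>\<epsilon>\<^sup>2\<^sup>s x I - M\<close> and letting \<open>\<epsilon>\<close> tend to 0 in its determinant expresses the leading coefficients of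
  block \<open>s\<close> by a block determinant of \<open>G\<close>, which a Schur complement reduces to \<open>Wtil\<close>. Finally, if the
  leading coefficients up to block \<open>s\<close> do not vanish, then \<open>lam i (Q\<^sub>j \<bullet> p\<^sub>i)\<^sup>2 \<le> M\<^sub>j\<^sub>j\<close> forces the limiting
  eigenvectors to be block triangular with respect to \<open>Q\<close>, and an orthogonal block triangular matrix
  is block diagonal.
\<close>

text \<open>The hypotheses of the three items concern a single degree, yet no induction over the
  blocks is needed. In the limit determinant for block \<open>s\<close> the lower blocks enter only
  through the product of their leading coefficients, and this product equals the determinant of
  \<open>- D W D^T\<close>, with \<open>D\<close> the block diagonal part of the triangular factor
  and \<open>W\<close> the Wronskian of order \<open>s - 1\<close>. So one condition makes all lower
  coefficients nonzero at once, as the eigenvector argument requires. Blocks above \<open>s\<close>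
  contribute a common power of \<open>x\<close>, so the determinants are compared for nonzero
  \<open>x\<close> only. Item 1 follows from item 2 by evaluation at \<open>x = 0\<close>.

  Two obstacles shape the analysis. The trace bound makes \<open>lam i\<close> divided by its power
  of \<open>\<epsilon>\<close> bounded but would allow it to oscillate; the convergent power series
  excludes that. And eigenvectors at different \<open>\<epsilon>\<close> are chosen independently,
  with arbitrary signs, so inner products with them need not converge. Their squares do, being
  quadratic forms of the analytic projectors, and only squares are passed to the limit.\<close>

section \<open>Linear algebra\<close>

text \<open>The rank counts a maximal independent subset of the set of columns, and a set forgets
  repetitions: a repeated column would keep the rank below \<open>nc\<close>. Distinctness therefore
  comes first; then a kernel vector is a linear dependence of the columns.\<close>

lemma full_column_rank_inj:
  fixes A :: "real mat"
  assumes A: "A \<in> carrier_mat n nc" and r: "vec_space.rank n A = nc"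
    and v: "v \<in> carrier_vec nc" and Av: "A *\<^sub>v v = 0\<^sub>v n"
  shows "v = 0\<^sub>v nc"
proof (rule ccontr)
  assume v0: "v \<noteq> 0\<^sub>v nc"
  interpret vec_space "TYPE(real)" n .
  have "distinct (cols A)"
  proof (rule ccontr)
    assume nd: "\<not> distinct (cols A)"
    obtain S where S: "maximal S (\<lambda>T. T \<subseteq> set (cols A) \<and> lin_indpt T)"
      using maximal_exists[of "(\<lambda>T. T \<subseteq> set (cols A) \<and> lin_indpt T)" "card (set (cols A))" "{}"]
      by (meson List.finite_set card_mono empty_iff empty_subsetI finite_lin_indpt2 rev_finite_subset)
    then have "card S \<le> card (set (cols A))" by (simp add: card_mono maximal_def)
    also have "\<dots> < length (cols A)" using nd card_distinct card_length le_neq_implies_less by blast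
    finally show False using rank_card_indpt[OF A S] r A by simp
  qed
  then show False
    using full_rank_lin_indpt[OF A r] lin_depI[OF A v v0 Av] by blast
qed

lemma minv_inverse:
  assumes A: "A \<in> carrier_mat m m" and d: "det A \<noteq> 0"
  shows "minv A \<in> carrier_mat m m" "A * minv A = 1\<^sub>m m" "minv A * A = 1\<^sub>m m"
proof -
  have "\<exists>B\<in>carrier_mat m m. B * A = 1\<^sub>m m \<and> A * B = 1\<^sub>m m"
    using det_non_zero_imp_unit[OF A d, of undefined] by (auto simp: Units_def ring_mat_simps)
  then have "\<exists>B. B \<in> carrier_mat (dim_row A) (dim_row A) \<and> A * B = 1\<^sub>m (dim_row A) \<and> B * A = 1\<^sub>m (dim_row A)"
    using A by auto
  from someI_ex[OF this] A
  show "minv A \<in> carrier_mat m m" "A * minv A = 1\<^sub>m m" "minv A * A = 1\<^sub>m m"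
    unfolding minv_def by auto
qed

text \<open>Right multiplication by the unitriangular \<open>?T\<close> clears the upper right block
  and leaves the Schur complement in the lower right corner.\<close>

lemma det_schur_complement:
  fixes A :: "real mat"
  assumes A: "A \<in> carrier_mat m m" and B: "B \<in> carrier_mat m q" and C: "C \<in> carrier_mat q m"
    and D: "D \<in> carrier_mat q q" and Ai: "Ai \<in> carrier_mat m m" and inv: "A * Ai = 1\<^sub>m m"
  shows "det (four_block_mat A B C D) = det A * det (D - C * Ai * B)"
proof -
  have AiB: "Ai * B \<in> carrier_mat m q" using Ai B by simp
  have mAiB: "- (Ai * B) \<in> carrier_mat m q" using AiB by simp
  let ?T = "four_block_mat (1\<^sub>m m) (- (Ai * B)) (0\<^sub>m q m) (1\<^sub>m q)"
  have T: "?T \<in> carrier_mat (m + q) (m + q)" by (rule four_block_carrier_mat) auto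
  have M: "four_block_mat A B C D \<in> carrier_mat (m + q) (m + q)" by (rule four_block_carrier_mat[OF A D])
  have "A * - (Ai * B) + B * 1\<^sub>m q = 0\<^sub>m m q"
  proof -
    have "A * (Ai * B) = B" using A Ai B inv by (metis assoc_mult_mat left_mult_one_mat)
    then have "A * - (Ai * B) = - B" using carrier_matD[OF A] carrier_matD[OF AiB] carrier_matD[OF Ai] by simp
    then show ?thesis using B by (simp add: uminus_l_inv_mat)
  qed
  moreover have "C * - (Ai * B) + D * 1\<^sub>m q = D - C * Ai * B"
  proof -
    have "C * - (Ai * B) = - (C * Ai * B)" using C Ai B AiB by simp
    moreover have "C * Ai * B \<in> carrier_mat q q" using C Ai B by simp
    moreover have "- Y + D = D - Y" if "Y \<in> carrier_mat q q" for Y using that D by (intro eq_matI) auto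
    ultimately show ?thesis using D by simp
  qed
  ultimately have "four_block_mat A B C D * ?T = four_block_mat A (0\<^sub>m m q) C (D - C * Ai * B)"
    using A B C D by (subst mult_four_block_mat[OF A B C D one_carrier_mat mAiB zero_carrier_mat one_carrier_mat]) simp
  moreover have "det (four_block_mat A (0\<^sub>m m q) C (D - C * Ai * B)) = det A * det (D - C * Ai * B)"
    using A B C D Ai by (intro det_four_block_mat_upper_right_zero[of _ m _ q]) auto
  moreover have "det ?T = 1"
    using mAiB by (subst det_four_block_mat_lower_left_zero[of _ m _ q]) auto
  ultimately show ?thesis using det_mult[OF M T] by simp
qed

lemma orthogonal_matD:
  fixes U :: "real mat"
  assumes U: "U \<in> carrier_mat n n"
  shows "transpose_mat U * U = 1\<^sub>m n \<Longrightarrow> i < n \<Longrightarrow> j < n \<Longrightarrow>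
      (\<Sum>a<n. U $$ (a, i) * U $$ (a, j)) = (if i = j then 1 else 0)"
    and "U * transpose_mat U = 1\<^sub>m n \<Longrightarrow> i < n \<Longrightarrow> j < n \<Longrightarrow>
      (\<Sum>a<n. U $$ (i, a) * U $$ (j, a)) = (if i = j then 1 else 0)"
proof -
  assume "transpose_mat U * U = 1\<^sub>m n" and ij: "i < n" "j < n"
  then have "(transpose_mat U * U) $$ (i, j) = 1\<^sub>m n $$ (i, j)" by simp
  then show "(\<Sum>a<n. U $$ (a, i) * U $$ (a, j)) = (if i = j then 1 else 0)"
    using U ij by (simp add: scalar_prod_def atLeast0LessThan)
next
  assume "U * transpose_mat U = 1\<^sub>m n" and ij: "i < n" "j < n"
  then have "(U * transpose_mat U) $$ (i, j) = 1\<^sub>m n $$ (i, j)" by simp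
  then show "(\<Sum>a<n. U $$ (i, a) * U $$ (j, a)) = (if i = j then 1 else 0)"
    using U ij by (simp add: scalar_prod_def atLeast0LessThan)
qed

text \<open>Symmetry moves \<open>P i\<close> across the inner product, and \<open>P i\<close> kills
  \<open>q j\<close>, which is fixed by \<open>P j\<close>. Used twice: for vectors chosen at small
  \<open>\<epsilon>\<close>, and at 0 for the limiting eigenvectors.\<close>

lemma projector_range_vectors_orthogonal:
  fixes P :: "nat \<Rightarrow> real mat" and q :: "nat \<Rightarrow> real vec"
  assumes P: "\<And>i. i < n \<Longrightarrow> P i \<in> carrier_mat n n" "\<And>i. i < n \<Longrightarrow> transpose_mat (P i) = P i"
    and PP: "\<And>i j. i < n \<Longrightarrow> j < n \<Longrightarrow> i \<noteq> j \<Longrightarrow> P i * P j = 0\<^sub>m n n"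
    and q: "\<And>i. i < n \<Longrightarrow> q i \<in> carrier_vec n" "\<And>i. i < n \<Longrightarrow> P i *\<^sub>v q i = q i"
      "\<And>i. i < n \<Longrightarrow> q i \<bullet> q i = 1"
  defines "U \<equiv> mat n n (\<lambda>(a, i). q i $ a)"
  shows "transpose_mat U * U = 1\<^sub>m n" "U * transpose_mat U = 1\<^sub>m n"
proof -
  have U: "U \<in> carrier_mat n n" by (simp add: U_def)
  have q0: "P i *\<^sub>v q j = 0\<^sub>v n" if "i < n" "j < n" "i \<noteq> j" for i j
  proof -
    have "P i *\<^sub>v q j = (P i * P j) *\<^sub>v q j" using that P q by (metis assoc_mult_mat_vec)
    then show ?thesis using that PP q by auto
  qed
  have "q i \<bullet> q j = 0" if "i < n" "j < n" "i \<noteq> j" for i j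
  proof -
    have "q i \<bullet> q j = (transpose_mat (P i) *\<^sub>v q i) \<bullet> q j" using P q that by simp
    also have "\<dots> = q i \<bullet> (P i *\<^sub>v q j)" using P q that by (intro transpose_vec_mult_scalar) auto
    finally show ?thesis using q0 q that by simp
  qed
  then show UU: "transpose_mat U * U = 1\<^sub>m n"
    using q carrier_vecD[OF q(1)] by (intro eq_matI) (auto simp: U_def scalar_prod_def)
  show "U * transpose_mat U = 1\<^sub>m n"
    using mat_mult_left_right_inverse[OF _ U UU] U by simp
qed

text \<open>A nonzero column of \<open>P i\<close> is fixed by \<open>P i\<close> because of
  idempotence; normalised, these columns give \<open>n\<close> orthonormal vectors in dimension
  \<open>n\<close>. Each \<open>P i\<close> is then known on a whole basis, which leaves only the
  rank one projector on its own vector.\<close>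

lemma orthogonal_projectors_eigenbasis:
  fixes P :: "nat \<Rightarrow> real mat"
  assumes P: "\<And>i. i < n \<Longrightarrow> P i \<in> carrier_mat n n" "\<And>i. i < n \<Longrightarrow> transpose_mat (P i) = P i"
    and idem: "\<And>i. i < n \<Longrightarrow> P i * P i = P i" and nz: "\<And>i. i < n \<Longrightarrow> P i \<noteq> 0\<^sub>m n n"
    and PP: "\<And>i j. i < n \<Longrightarrow> j < n \<Longrightarrow> i \<noteq> j \<Longrightarrow> P i * P j = 0\<^sub>m n n"
  shows "\<exists>U\<in>carrier_mat n n. transpose_mat U * U = 1\<^sub>m n \<and> U * transpose_mat U = 1\<^sub>m n \<and>
    (\<forall>i<n. \<forall>a<n. \<forall>b<n. P i $$ (a, b) = U $$ (a, i) * U $$ (b, i))"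
proof -
  have "\<exists>q. q \<in> carrier_vec n \<and> P i *\<^sub>v q = q \<and> q \<bullet> q = 1" if i: "i < n" for i
  proof -
    have "\<exists>b<n. col (P i) b \<noteq> 0\<^sub>v n"
    proof (rule ccontr)
      assume *: "\<not> ?thesis"
      have "P i = 0\<^sub>m n n"
      proof (rule eq_matI)
        fix a b assume ab: "a < dim_row (0\<^sub>m n n :: real mat)" "b < dim_col (0\<^sub>m n n :: real mat)"
        then have "col (P i) b $ a = 0" using * by simp
        then show "P i $$ (a, b) = 0\<^sub>m n n $$ (a, b)" using ab P(1)[OF i] by simp
      qed (use P(1)[OF i] in auto)
      then show False using nz[OF i] by simp
    qed
    then obtain b where b: "b < n" "col (P i) b \<noteq> 0\<^sub>v n" by auto
    define w where "w = col (P i) b"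
    have w: "w \<in> carrier_vec n" "w \<noteq> 0\<^sub>v n" using b P(1)[OF i] by (auto simp: w_def)
    have Pw: "P i *\<^sub>v w = w"
      using idem[OF i] P(1)[OF i] b col_mult2[of "P i" n n "P i" n b] by (simp add: w_def)
    have ww: "w \<bullet> w > 0"
    proof -
      obtain a where a: "a < n" "w $ a \<noteq> 0"
        using w by (metis carrier_vecD eq_vecI index_zero_vec)
      have "0 < w $ a * w $ a" using a(2) by (auto simp: zero_less_mult_iff linorder_neq_iff)
      also have "\<dots> \<le> (\<Sum>i\<in>{0..<n}. w $ i * w $ i)" using a by (intro member_le_sum) auto
      finally show ?thesis using w by (simp add: scalar_prod_def)
    qed
    let ?q = "(1 / sqrt (w \<bullet> w)) \<cdot>\<^sub>v w"
    have "?q \<in> carrier_vec n" "P i *\<^sub>v ?q = ?q" "?q \<bullet> ?q = 1"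
      using w P(1)[OF i] Pw ww by (auto simp: mult_mat_vec field_simps)
    then show ?thesis by blast
  qed
  then obtain q where q: "\<And>i. i < n \<Longrightarrow> q i \<in> carrier_vec n" "\<And>i. i < n \<Longrightarrow> P i *\<^sub>v q i = q i"
      "\<And>i. i < n \<Longrightarrow> scalar_prod (q i) (q i) = 1" by metis
  define U where "U = mat n n (\<lambda>(a, i). q i $ a)"
  have U: "U \<in> carrier_mat n n" by (simp add: U_def)
  have orth: "transpose_mat U * U = 1\<^sub>m n" "U * transpose_mat U = 1\<^sub>m n"
    using projector_range_vectors_orthogonal[of n P q] P PP q by (auto simp: U_def)
  have "P i $$ (a, b) = U $$ (a, i) * U $$ (b, i)" if i: "i < n" and ab: "a < n" "b < n" for i a b
  proof -
    have q0: "P i *\<^sub>v q j = (if i = j then q i else 0\<^sub>v n)" if "j < n" for j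
    proof (cases "i = j")
      case False
      have "P i *\<^sub>v q j = (P i * P j) *\<^sub>v q j" using that P(1) q i by (metis assoc_mult_mat_vec)
      then show ?thesis using that PP q i False by auto
    qed (use q i in auto)
    have PU: "(P i * U) $$ (a, j) = (if i = j then q i $ a else 0)" if j: "j < n" for j
    proof -
      have "col U j = q j" using q(1)[OF j] j by (intro eq_vecI) (auto simp: U_def)
      then have "(P i * U) $$ (a, j) = (P i *\<^sub>v q j) $ a" using ab j P(1)[OF i] U by simp
      then show ?thesis using q0[OF j] ab by simp
    qed
    have mulT: "(X * transpose_mat U) $$ (a, b) = (\<Sum>j<n. X $$ (a, j) * U $$ (b, j))" if "X \<in> carrier_mat n n" for X
      using that U ab by (simp add: scalar_prod_def atLeast0LessThan)
    have "P i = P i * (U * transpose_mat U)" using P(1)[OF i] orth by simp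
    also have "\<dots> = P i * U * transpose_mat U" using P(1)[OF i] U by simp
    finally have "P i $$ (a, b) = (P i * U * transpose_mat U) $$ (a, b)" by simp
    also have "\<dots> = (\<Sum>j<n. (P i * U) $$ (a, j) * U $$ (b, j))"
      using mulT[of "P i * U"] ab P(1)[OF i] U by simp
    also have "\<dots> = (\<Sum>j<n. if j = i then q i $ a * U $$ (b, i) else 0)"
      using PU by (intro sum.cong) auto
    also have "\<dots> = U $$ (a, i) * U $$ (b, i)" using i ab by (simp add: U_def)
    finally show ?thesis .
  qed
  then show ?thesis using U orth by blast
qed

text \<open>The determinants are compared after cancelling a power of \<open>x\<close>, so nothing
  is known at 0; the difference still has infinitely many roots.\<close>

lemma poly_eqI_nonzero:
  fixes p q :: "real poly"
  assumes "\<And>x. x \<noteq> 0 \<Longrightarrow> poly p x = poly q x"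
  shows "p = q"
proof (rule ccontr)
  assume "p \<noteq> q"
  then have "finite {x. poly (p - q) x = 0}" by (intro poly_roots_finite) simp
  moreover have "- {0} \<subseteq> {x. poly (p - q) x = 0}" using assms by auto
  ultimately have "finite (- {0::real})" by (rule finite_subset[rotated])
  then show False using infinite_UNIV_char_0[where 'a = real] finite_compl[of "{0::real}"] by simp
qed

text \<open>Leading coefficients of monic polynomials compare the constants, which then cancel.
  Later the polynomial describes block \<open>s\<close> and the constant the blocks below
  it.\<close>

lemma monic_const_mult_eq:
  fixes p q :: "real poly"
  assumes "monic p" "monic q" "c \<noteq> 0" "\<And>x. x \<noteq> 0 \<Longrightarrow> c * poly p x = d * poly q x"
  shows "p = q" "c = d"
proof -
  have eq: "Polynomial.smult c p = Polynomial.smult d q" using assms(4) by (intro poly_eqI_nonzero) simp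
  then have "lead_coeff (Polynomial.smult c p) = lead_coeff (Polynomial.smult d q)" by simp
  then show "c = d" using assms(1,2) by (simp only: lead_coeff_smult mult_1_right)
  then have "Polynomial.smult c (p - q) = 0" using eq by (simp add: smult_diff_right)
  then show "p = q" using assms(3) by simp
qed

text \<open>The Schur complement of the upper left corner meets \<open>D\<close> only in the
  products \<open>D^T D^-T\<close> and \<open>D^-1 D\<close>, so \<open>D\<close> cancels and
  \<open>W1\<close> alone is inverted. \<open>E\<close> stays outside because it need not be square.
  The right-hand side of \<open>eq\<close> will come from the eigenvalues, with \<open>l\<close>
  their leading coefficients.\<close>

lemma char_poly_of_block_det:
  fixes D W1 Wur Wll Wlr E :: "real mat"
  assumes D: "D \<in> carrier_mat m m" and W1: "W1 \<in> carrier_mat m m" and Wur: "Wur \<in> carrier_mat m h"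
    and Wll: "Wll \<in> carrier_mat h m" and Wlr: "Wlr \<in> carrier_mat h h" and E: "E \<in> carrier_mat q h"
    and dD: "det D \<noteq> 0" and dW: "det W1 \<noteq> 0"
    and eq: "\<And>x. x \<noteq> 0 \<Longrightarrow> det (four_block_mat (- (D * W1 * transpose_mat D)) (- (D * Wur * transpose_mat E))
        (- (E * Wll * transpose_mat D)) (x \<cdot>\<^sub>m 1\<^sub>m q - E * Wlr * transpose_mat E)) = c * (\<Prod>j<q. x - l j)"
  shows "char_poly (E * (Wlr - Wll * minv W1 * Wur) * transpose_mat E) = (\<Prod>j<q. [:- l j, 1:])"
    and "c = det (- (D * W1 * transpose_mat D))"
proof -
  note Wi = minv_inverse[OF W1 dW] and Di = minv_inverse[OF D dD]
  define Di Wi where "Di = minv D" and "Wi = minv W1"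
  have [simp]: "Di \<in> carrier_mat m m" "Wi \<in> carrier_mat m m" "D \<in> carrier_mat m m" "W1 \<in> carrier_mat m m"
    "Wur \<in> carrier_mat m h" "Wll \<in> carrier_mat h m" "Wlr \<in> carrier_mat h h" "E \<in> carrier_mat q h"
    using Wi Di assms by (auto simp: Di_def Wi_def)
  let ?DT = "transpose_mat D" and ?ET = "transpose_mat E" and ?DiT = "transpose_mat Di"
  let ?A = "D * W1 * ?DT" and ?Ai = "?DiT * Wi * Di"
  have carT[simp]: "?DT \<in> carrier_mat m m" "?DiT \<in> carrier_mat m m" "?ET \<in> carrier_mat h q" by auto
  have c3[simp]: "X * Y \<in> carrier_mat a b" if "X \<in> carrier_mat a d" "Y \<in> carrier_mat d b" for X Y :: "real mat" and a b d
    using that by auto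
  have DDi: "D * Di = 1\<^sub>m m" "Di * D = 1\<^sub>m m" and WWi: "W1 * Wi = 1\<^sub>m m" using Di Wi by (auto simp: Di_def Wi_def)
  have "?DT * ?DiT = transpose_mat (Di * D)" by (rule transpose_mult[symmetric, of Di m m D m]) auto
  then have DT: "?DT * ?DiT = 1\<^sub>m m" by (simp add: DDi)
  have cWi: "Wi \<in> carrier_mat m m" and cDi: "Di \<in> carrier_mat m m" by simp_all
  note mm = mult_carrier_mat[OF mult_carrier_mat]
  have A: "?A \<in> carrier_mat m m" by (rule mm[OF D W1 carT(1)])
  have Ai: "?Ai \<in> carrier_mat m m" by (rule mm[OF carT(2) cWi cDi])
  have cancel: "(X * Y) * (Y' * Z') = X * Z'"
    if "X \<in> carrier_mat a m" "Y \<in> carrier_mat m m" "Y' \<in> carrier_mat m m" "Z' \<in> carrier_mat m b" "Y * Y' = 1\<^sub>m m"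
    for X Y Y' Z' :: "real mat" and a b
  proof -
    have "(X * Y) * (Y' * Z') = X * (Y * (Y' * Z'))" using that by (intro assoc_mult_mat) auto
    also have "Y * (Y' * Z') = (Y * Y') * Z'" using that by (intro assoc_mult_mat[symmetric]) auto
    finally show ?thesis using that by simp
  qed
  note M = mult_carrier_mat
  have Ai_eq: "?Ai = ?DiT * (Wi * Di)" by (rule assoc_mult_mat[OF carT(2) cWi cDi])
  have "?A * ?Ai = (D * W1) * (Wi * Di)" unfolding Ai_eq by (rule cancel[OF M[OF D W1] carT(1,2) M[OF cWi cDi] DT])
  also have "\<dots> = D * Di" by (rule cancel[OF D W1 cWi cDi WWi])
  finally have AAi: "?A * ?Ai = 1\<^sub>m m" unfolding DDi .
  have neg: "- X * - Y = X * Y" "- X * Y = - (X * Y)"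
    if "X \<in> carrier_mat a b" "Y \<in> carrier_mat b d" for X Y :: "real mat" and a b d
    using carrier_matD[OF that(1)] carrier_matD[OF that(2)] by simp_all
  have nA: "- ?A * - ?Ai = 1\<^sub>m m" unfolding neg(1)[OF A Ai] by (rule AAi)
  let ?B = "D * Wur * ?ET" and ?C = "E * Wll * ?DT" and ?F = "E * Wlr * ?ET"
  have B: "?B \<in> carrier_mat m q" and C: "?C \<in> carrier_mat q m" and F: "?F \<in> carrier_mat q q"
    using mm[OF D Wur carT(3)] mm[OF E Wll carT(1)] mm[OF E Wlr carT(3)] by auto
  let ?S = "E * (Wlr - Wll * Wi * Wur) * ?ET"
  have X: "Wll * Wi * Wur \<in> carrier_mat h h" by (rule mm[OF Wll cWi Wur])
  then have S: "?S \<in> carrier_mat q q" by (intro mm[OF E _ carT(3)] minus_carrier_mat)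
  have CAB: "?C * ?Ai * ?B = E * (Wll * Wi * Wur) * ?ET"
  proof -
    have "?C * ?Ai = (E * Wll) * (Wi * Di)"
      unfolding Ai_eq by (rule cancel[OF M[OF E Wll] carT(1,2) M[OF cWi cDi] DT])
    also have "\<dots> = ((E * Wll) * Wi) * Di" by (rule assoc_mult_mat[symmetric, OF M[OF E Wll] cWi cDi])
    finally have "?C * ?Ai * ?B = (((E * Wll) * Wi) * Di) * (D * (Wur * ?ET))"
      unfolding assoc_mult_mat[OF D Wur carT(3)] by (rule arg_cong)
    also have "\<dots> = ((E * Wll) * Wi) * (Wur * ?ET)" by (rule cancel[OF M[OF M[OF E Wll] cWi] cDi D M[OF Wur carT(3)] DDi(2)])
    also have "\<dots> = (((E * Wll) * Wi) * Wur) * ?ET"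
      by (rule assoc_mult_mat[symmetric, OF M[OF M[OF E Wll] cWi] Wur carT(3)])
    also have "(E * Wll) * Wi = E * (Wll * Wi)" by (rule assoc_mult_mat[OF E Wll cWi])
    also have "\<dots> * Wur = E * (Wll * Wi * Wur)" by (rule assoc_mult_mat[OF E M[OF Wll cWi] Wur])
    finally show ?thesis .
  qed
  have "det (four_block_mat (- ?A) (- ?B) (- ?C) (x \<cdot>\<^sub>m 1\<^sub>m q - ?F)) = det (- ?A) * poly (char_poly ?S) x" for x
  proof -
    let ?Y = "?C * ?Ai * ?B"
    have Y: "?Y \<in> carrier_mat q q" by (rule mm[OF C Ai B])
    have "?S = E * Wlr * ?ET - E * (Wll * Wi * Wur) * ?ET"
      unfolding mult_minus_distrib_mat[OF E Wlr X]
      by (rule minus_mult_distrib_mat[OF mult_carrier_mat[OF E Wlr] mult_carrier_mat[OF E X] carT(3)])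
    then have SF: "?S = ?F - ?Y" unfolding CAB .
    have "(- ?C) * (- ?Ai) * (- ?B) = - ?Y"
      unfolding neg(1)[OF C Ai] using neg(1)[of "- (?C * ?Ai)" q m ?B q] neg(2)[OF M[OF C Ai] B] M[OF C Ai] B
      by simp
    then have "(x \<cdot>\<^sub>m 1\<^sub>m q - ?F) - (- ?C) * (- ?Ai) * (- ?B) = (x \<cdot>\<^sub>m 1\<^sub>m q - ?F) - (- ?Y)" by (simp only:)
    also have "\<dots> = x \<cdot>\<^sub>m 1\<^sub>m q - (?F - ?Y)"
      using F Y by (intro eq_matI) (auto simp del: index_mult_mat(1))
    also have "\<dots> = x \<cdot>\<^sub>m 1\<^sub>m q - ?S" unfolding SF ..
    also have "\<dots> = - (char_matrix ?S x)"
      using S by (intro eq_matI) (auto simp: char_matrix_def)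
    finally have *: "(x \<cdot>\<^sub>m 1\<^sub>m q - ?F) - (- ?C) * (- ?Ai) * (- ?B) = - (char_matrix ?S x)" .
    have xF: "x \<cdot>\<^sub>m 1\<^sub>m q - ?F \<in> carrier_mat q q" by (rule minus_carrier_mat[OF F])
    show ?thesis
      unfolding char_poly_matrix[OF S] *[symmetric]
      using A B C Ai by (intro det_schur_complement[OF _ _ _ xF _ nA]) simp_all
  qed
  then have eq': "det (- ?A) * poly (char_poly ?S) x = c * poly (\<Prod>j<q. [:- l j, 1:]) x" if "x \<noteq> 0" for x
    using eq[OF that] by (simp add: poly_prod)
  have "det ?A \<noteq> 0" using det_mult[OF A Ai] AAi by auto
  then have "det (- ?A) \<noteq> 0" using det_0_negate[OF A] by simp
  moreover have "monic (char_poly ?S)" using degree_monic_char_poly[OF S] by auto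
  moreover have "monic (\<Prod>j<q. [:- l j, 1:])" by (intro monic_prod) auto
  ultimately show "char_poly (E * (Wlr - Wll * minv W1 * Wur) * transpose_mat E) = (\<Prod>j<q. [:- l j, 1:])"
    and "c = det (- (D * W1 * transpose_mat D))"
    using monic_const_mult_eq[OF _ _ _ eq'] by (auto simp: Wi_def)
qed

lemma det_upper:
  assumes "A \<in> carrier_mat m m" "\<And>i j. i < m \<Longrightarrow> j < i \<Longrightarrow> A $$ (i, j) = (0::real)"
  shows "det A = (\<Prod>i<m. A $$ (i, i))"
proof -
  have "det A = prod_list (diag_mat A)"
    using assms by (intro det_upper_triangular) (auto simp: upper_triangular_def)
  also have "\<dots> = (\<Prod>i<m. A $$ (i, i))"
    using assms(1) by (simp add: diag_mat_def prod.list_conv_set_nth atLeast0LessThan prod.distinct_set_conv_list[symmetric])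
  finally show ?thesis .
qed

section \<open>Spectra of graded matrices\<close>

text \<open>Shifting the power series divides \<open>f - f 0\<close> by \<open>t\<close>; iterated,
  this extracts the leading term of an eigenvalue.\<close>

lemma analytic_near0_step:
  assumes "analytic_near0 f"
  obtains g where "analytic_near0 g" "eventually (\<lambda>t. f t = f 0 + t * g t) (nhds 0)"
proof -
  obtain r c where r: "r > 0" and c: "\<And>t. \<bar>t\<bar> < r \<Longrightarrow> (\<lambda>m. c m * t ^ m) sums f t"
    using assms unfolding analytic_near0_def by blast
  define g where "g = (\<lambda>t. \<Sum>m. c (Suc m) * t ^ m)"
  have f0: "f 0 = c 0" using c[of 0] r powser_sums_zero_iff[of c "f 0"] by simp
  have *: "(\<lambda>m. c (Suc m) * t ^ m) sums g t \<and> f t = f 0 + t * g t" if t: "\<bar>t\<bar> < r" for t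
  proof -
    have "summable (\<lambda>m. c m * t ^ m)" using c[OF t] by (rule sums_summable)
    then have "summable (\<lambda>m. c (Suc m) * t ^ m)" by (simp add: summable_powser_split_head)
    moreover from this have "f t = c 0 + g t * t"
      using powser_split_head(1)[of c t] c[OF t] \<open>summable (\<lambda>m. c m * t ^ m)\<close>
      by (simp add: g_def sums_iff)
    ultimately show ?thesis by (simp add: f0 g_def summable_sums mult.commute)
  qed
  show thesis
  proof
    have "\<forall>t. \<bar>t\<bar> < r \<longrightarrow> (\<lambda>m. c (Suc m) * t ^ m) sums g t" using * by blast
    then have "\<exists>c. \<forall>t. \<bar>t\<bar> < r \<longrightarrow> (\<lambda>m. c m * t ^ m) sums g t"
      by (rule exI[of _ "\<lambda>m. c (Suc m)"])
    then show "analytic_near0 g" unfolding analytic_near0_def using r by blast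
    have "\<forall>t. dist t 0 < r \<longrightarrow> f t = f 0 + t * g t" using * by (simp only: dist_real_def diff_0_right) blast
    then show "eventually (\<lambda>t. f t = f 0 + t * g t) (nhds 0)"
      unfolding eventually_nhds_metric using r by blast
  qed
qed

lemma analytic_near0_isCont:
  assumes "analytic_near0 f" shows "isCont f 0"
proof -
  obtain r c where r: "r > 0" and c: "\<And>t. \<bar>t\<bar> < r \<Longrightarrow> (\<lambda>m. c m * t ^ m) sums f t"
    using assms unfolding analytic_near0_def by blast
  have "isCont (\<lambda>t. \<Sum>m. c m * t ^ m) 0"
    using c[of "r / 2"] r by (intro isCont_powser[of c "r / 2"]) (auto simp: sums_iff)
  moreover have "eventually (\<lambda>t. (\<Sum>m. c m * t ^ m) = f t) (nhds 0)"
    unfolding eventually_nhds_metric using r sums_unique[OF c] by (intro exI[of _ r]) (auto simp: dist_real_def)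
  ultimately show ?thesis using isCont_cong[of "\<lambda>t. \<Sum>m. c m * t ^ m" f 0] by blast
qed

lemma analytic_near0_tendsto: "analytic_near0 f \<Longrightarrow> (f \<longlongrightarrow> f 0) (at_right 0)"
  using analytic_near0_isCont[of f] by (auto simp: isCont_def filterlim_at_split)

text \<open>For positive \<open>N\<close> the bound forces \<open>f 0 = 0\<close>, so a factor
  \<open>t\<close> splits off and the quotient inherits a bound of order \<open>N - 1\<close>. At
  order 0 the coefficient is \<open>f 0\<close> and the remainder has one more factor
  \<open>t\<close>.\<close>

lemma analytic_near0_leading_term:
  assumes "analytic_near0 f" "f \<in> O[at_right 0](\<lambda>t. t ^ N)"
  shows "\<exists>c. (\<lambda>t. f t - t ^ N * c) \<in> O[at_right 0](\<lambda>t. t ^ (N + 1))"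
  using assms
proof (induction N arbitrary: f)
  case 0
  obtain g where g: "analytic_near0 g" "eventually (\<lambda>t. f t = f 0 + t * g t) (nhds 0)"
    using analytic_near0_step[OF 0(1)] .
  have ev: "eventually (\<lambda>t. f t - t ^ 0 * f 0 = t * g t) (at_right 0)"
    using g(2) by (auto simp: eventually_at_filter elim: eventually_mono)
  have "g \<in> O[at_right 0](\<lambda>_. 1)"
    using analytic_near0_tendsto[OF g(1)] by (intro bigoI_tendsto[where c = "g 0"]) auto
  then have "(\<lambda>t. t * g t) \<in> O[at_right 0](\<lambda>t. t * 1)" by (intro landau_o.big.mult_left)
  then show ?case using landau_o.big.in_cong[OF ev, of "\<lambda>t. t ^ (0 + 1)"] by auto
next
  case (Suc N)
  obtain g where g: "analytic_near0 g" "eventually (\<lambda>t. f t = f 0 + t * g t) (nhds 0)"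
    using analytic_near0_step[OF Suc(2)] .
  obtain C where "eventually (\<lambda>t. norm (f t) \<le> C * norm (t ^ Suc N)) (at_right 0)"
    using Suc.prems(2) by (elim landau_o.bigE)
  moreover have "((\<lambda>t::real. C * norm (t ^ Suc N)) \<longlongrightarrow> C * norm ((0::real) ^ Suc N)) (at_right 0)"
    by (intro tendsto_intros)
  then have "((\<lambda>t::real. C * norm (t ^ Suc N)) \<longlongrightarrow> 0) (at_right 0)" by simp
  ultimately have "(f \<longlongrightarrow> 0) (at_right 0)" by (rule Lim_null_comparison)
  then have f0: "f 0 = 0"
    using tendsto_unique[OF trivial_limit_at_right_real analytic_near0_tendsto[OF Suc(2)]] by blast
  have ev: "eventually (\<lambda>t. f t = t * g t) (at_right 0)"
    using g(2) f0 by (auto simp: eventually_at_filter elim: eventually_mono)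
  have nz: "eventually (\<lambda>t::real. t \<noteq> 0) (at_right 0)" by (simp add: eventually_at_filter)
  have "(\<lambda>t. t * g t) \<in> O[at_right 0](\<lambda>t. t * t ^ N)"
    using Suc.prems(2) landau_o.big.in_cong[OF ev, of "\<lambda>t. t * t ^ N"] by simp
  then have "g \<in> O[at_right 0](\<lambda>t. t ^ N)" using landau_o.big.mult_cancel_left[OF bigtheta_refl nz] by blast
  from Suc.IH[OF g(1) this] obtain c where c: "(\<lambda>t. g t - t ^ N * c) \<in> O[at_right 0](\<lambda>t. t ^ (N + 1))" by blast
  have ev2: "eventually (\<lambda>t. f t - t ^ Suc N * c = t * (g t - t ^ N * c)) (at_right 0)"
    using ev by eventually_elim (simp add: algebra_simps)
  have "(\<lambda>t. t * (g t - t ^ N * c)) \<in> O[at_right 0](\<lambda>t. t * t ^ (N + 1))"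
    using c by (intro landau_o.big.mult_left)
  then show ?case using landau_o.big.in_cong[OF ev2, of "\<lambda>t. t ^ (Suc N + 1)"] by auto
qed

lemma leading_term_tendsto:
  fixes f :: "real \<Rightarrow> real"
  assumes "(\<lambda>t. f t - t ^ N * c) \<in> O[at_right 0](\<lambda>t. t ^ (N + 1))"
  shows "((\<lambda>t. f t / t ^ N) \<longlongrightarrow> c) (at_right 0)"
proof -
  obtain C where C: "eventually (\<lambda>t. norm (f t - t ^ N * c) \<le> C * norm (t ^ (N + 1))) (at_right 0)"
    using assms by (elim landau_o.bigE) 
  have "((\<lambda>t. f t / t ^ N - c) \<longlongrightarrow> 0) (at_right 0)"
  proof (rule Lim_null_comparison)
    show "eventually (\<lambda>t. norm (f t / t ^ N - c) \<le> C * t) (at_right 0)"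
      using C eventually_at_right_less[of 0]
    proof eventually_elim
      fix t :: real assume *: "norm (f t - t ^ N * c) \<le> C * norm (t ^ (N + 1))" "0 < t"
      have "f t / t ^ N - c = (f t - t ^ N * c) / t ^ N" using *(2) by (simp add: field_simps)
      then show "norm (f t / t ^ N - c) \<le> C * t" using * by (simp add: abs_mult divide_le_eq mult.assoc)
    qed
    have "((\<lambda>t. C * t) \<longlongrightarrow> C * 0) (at_right 0)" by (intro tendsto_intros)
    then show "((\<lambda>t. C * t) \<longlongrightarrow> 0) (at_right 0)" by simp
  qed
  then show ?thesis by (rule LIM_zero_cancel)
qed

lemma tendsto_det:
  fixes A :: "'b \<Rightarrow> real mat"
  assumes "\<And>i j. i < n \<Longrightarrow> j < n \<Longrightarrow> ((\<lambda>t. A t $$ (i, j)) \<longlongrightarrow> B $$ (i, j)) F"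
    and "\<And>t. A t \<in> carrier_mat n n" "B \<in> carrier_mat n n"
  shows "((\<lambda>t. det (A t)) \<longlongrightarrow> det B) F"
  unfolding det_def'[OF assms(2)] det_def'[OF assms(3)]
  by (intro tendsto_intros assms(1)) (auto simp: permutes_in_image)

lemma det_mat_diag: "det (mat_diag n f) = (\<Prod>i<n. f i)"
  by (subst det_upper_triangular[of _ n])
    (auto simp: mat_diag_def diag_mat_def prod.list_conv_set_nth atLeast0LessThan
      prod.distinct_set_conv_list[symmetric])

text \<open>A count of squared entries. The first \<open>t\<close> rows carry mass \<open>t\<close>;
  so do the first \<open>t\<close> columns, whose mass lies entirely in the first \<open>t\<close>
  rows by \<open>up\<close>. The upper left block thus exhausts the first rows and nothing is left
  to its right.\<close>

lemma orthogonal_upper_block_imp_diagonal: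
  fixes X :: "nat \<Rightarrow> nat \<Rightarrow> real"
  assumes col: "\<And>i. i < n \<Longrightarrow> (\<Sum>j<n. X j i * X j i) = 1"
    and row: "\<And>j. j < n \<Longrightarrow> (\<Sum>i<n. X j i * X j i) = 1"
    and t: "t \<le> n" and up: "\<And>i j. i < t \<Longrightarrow> t \<le> j \<Longrightarrow> j < n \<Longrightarrow> X j i = 0"
    and ij: "j < t" "t \<le> i" "i < n"
  shows "X j i = 0"
proof -
  have split: "{..<n} = {..<t} \<union> {t..<n}" using t by auto
  have "(\<Sum>j<t. \<Sum>i<n. X j i * X j i) = real t" using row t by simp
  moreover have "(\<Sum>j<t. \<Sum>i<n. X j i * X j i) =
      (\<Sum>j<t. \<Sum>i<t. X j i * X j i) + (\<Sum>j<t. \<Sum>i\<in>{t..<n}. X j i * X j i)"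
    unfolding split by (subst sum.union_disjoint) (auto simp: sum.distrib)
  moreover have "(\<Sum>j<t. \<Sum>i<t. X j i * X j i) = (\<Sum>i<t. \<Sum>j<n. X j i * X j i)"
  proof (subst sum.swap, rule sum.cong)
    fix i assume "i \<in> {..<t}"
    then show "(\<Sum>j<t. X j i * X j i) = (\<Sum>j<n. X j i * X j i)"
      using t up by (intro sum.mono_neutral_left) auto
  qed simp
  moreover have "\<dots> = real t" using col t by simp
  ultimately have 0: "(\<Sum>j<t. \<Sum>i\<in>{t..<n}. X j i * X j i) = 0" by simp
  then have "(\<Sum>i\<in>{t..<n}. X j i * X j i) = 0"
    using ij(1) by (subst (asm) sum_nonneg_eq_0_iff) (auto intro: sum_nonneg)
  then have "X j i * X j i = 0"
    using ij by (subst (asm) sum_nonneg_eq_0_iff) auto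
  then show ?thesis by simp
qed

text \<open>\<open>w i\<close> is the part of column \<open>i\<close> lying in the last
  \<open>n - m\<close> rows. These weights are at most 1 and sum to \<open>n - m\<close>, while only
  \<open>n - m - 1\<close> indices lie beyond \<open>m\<close>; so weight at least 1 falls on
  indices up to \<open>m\<close>, where \<open>l\<close> is at least \<open>l m\<close>.\<close>

lemma ky_fan_bound:
  fixes X :: "nat \<Rightarrow> nat \<Rightarrow> real" and l :: "nat \<Rightarrow> real"
  assumes col: "\<And>i. i < n \<Longrightarrow> (\<Sum>j<n. X j i * X j i) = 1"
    and row: "\<And>j. j < n \<Longrightarrow> (\<Sum>i<n. X j i * X j i) = 1"
    and nonneg: "\<And>i. i < n \<Longrightarrow> 0 \<le> l i" and sorted: "\<And>i j. i \<le> j \<Longrightarrow> j < n \<Longrightarrow> l j \<le> l i"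
    and m: "m < n"
  shows "l m \<le> (\<Sum>j\<in>{m..<n}. \<Sum>i<n. l i * X j i * X j i)"
proof -
  define w where "w i = (\<Sum>j\<in>{m..<n}. X j i * X j i)" for i
  have w0: "0 \<le> w i" for i by (auto simp: w_def intro: sum_nonneg)
  have w1: "w i \<le> 1" if "i < n" for i
    unfolding w_def col[OF that, symmetric] by (rule sum_mono2) auto
  have split: "{..<n} = {..m} \<union> {Suc m..<n}" using m by auto
  have "(\<Sum>i<n. w i) = (\<Sum>j\<in>{m..<n}. \<Sum>i<n. X j i * X j i)" unfolding w_def by (rule sum.swap)
  also have "\<dots> = real (n - m)" using row by simp
  finally have "(\<Sum>i\<le>m. w i) + (\<Sum>i\<in>{Suc m..<n}. w i) = real (n - m)"
    unfolding split by (subst (asm) sum.union_disjoint) auto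
  moreover have "(\<Sum>i\<in>{Suc m..<n}. w i) \<le> (\<Sum>i\<in>{Suc m..<n}. 1)" using w1 by (intro sum_mono) auto
  ultimately have "1 \<le> (\<Sum>i\<le>m. w i)" using m by (simp add: of_nat_diff)
  then have "l m * 1 \<le> l m * (\<Sum>i\<le>m. w i)" using nonneg[OF m] by (rule mult_left_mono)
  also have "\<dots> = (\<Sum>i\<le>m. l m * w i)" by (rule sum_distrib_left)
  also have "\<dots> \<le> (\<Sum>i\<le>m. l i * w i)"
    using sorted m w0 by (intro sum_mono mult_right_mono) auto
  also have "\<dots> \<le> (\<Sum>i<n. l i * w i)"
    using m nonneg w0 by (intro sum_mono2) auto
  also have "\<dots> = (\<Sum>j\<in>{m..<n}. \<Sum>i<n. l i * X j i * X j i)"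
    unfolding w_def sum_distrib_left by (subst sum.swap) (simp add: mult.assoc)
  finally show ?thesis by simp
qed

text \<open>\<open>M\<close> stands for the kernel matrix in the basis of the QR factorization, \<open>g j\<close> for the degree of
  the block containing the \<open>j\<close>-th basis vector, and the columns of \<open>Z\<close> for the eigenvectors of \<open>M\<close>.\<close>

locale flat_limit =
  fixes n :: nat and g :: "nat \<Rightarrow> nat" and lam :: "nat \<Rightarrow> real \<Rightarrow> real"
    and Z M :: "real \<Rightarrow> nat \<Rightarrow> nat \<Rightarrow> real" and G :: "nat \<Rightarrow> nat \<Rightarrow> real"
  assumes g_mono: "\<And>i j. i \<le> j \<Longrightarrow> j < n \<Longrightarrow> g i \<le> g j"
    and col_orth: "eventually (\<lambda>\<epsilon>. \<forall>i<n. (\<Sum>j<n. Z \<epsilon> j i * Z \<epsilon> j i) = 1) (at_right 0)"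
    and row_orth: "eventually (\<lambda>\<epsilon>. \<forall>j<n. \<forall>l<n. (\<Sum>i<n. Z \<epsilon> j i * Z \<epsilon> l i) = (if j = l then 1 else 0)) (at_right 0)"
    and M_eq: "eventually (\<lambda>\<epsilon>. \<forall>j<n. \<forall>l<n. M \<epsilon> j l = (\<Sum>i<n. lam i \<epsilon> * Z \<epsilon> j i * Z \<epsilon> l i)) (at_right 0)"
    and lam_nonneg: "eventually (\<lambda>\<epsilon>. \<forall>i<n. 0 \<le> lam i \<epsilon>) (at_right 0)"
    and lam_sorted: "eventually (\<lambda>\<epsilon>. \<forall>i j. i \<le> j \<and> j < n \<longrightarrow> lam j \<epsilon> \<le> lam i \<epsilon>) (at_right 0)"
    and M_lim: "\<And>j l. j < n \<Longrightarrow> l < n \<Longrightarrow> ((\<lambda>\<epsilon>. M \<epsilon> j l / \<epsilon> ^ (g j + g l)) \<longlongrightarrow> G j l) (at_right 0)"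
begin

text \<open>The trace bound needs the whole tail of the diagonal from \<open>i\<close> on, but this
  costs nothing: later positions have degree at least \<open>g i\<close>, so their entries are of no
  larger order.\<close>

lemma lam_bigo:
  assumes i: "i < n"
  shows "lam i \<in> O[at_right 0](\<lambda>\<epsilon>. \<epsilon> ^ (2 * g i))"
proof -
  have "lam i \<in> O[at_right 0](\<lambda>\<epsilon>. \<Sum>j\<in>{i..<n}. M \<epsilon> j j)"
  proof (rule landau_o.bigI[of 1])
    show "eventually (\<lambda>\<epsilon>. norm (lam i \<epsilon>) \<le> 1 * norm (\<Sum>j\<in>{i..<n}. M \<epsilon> j j)) (at_right 0)"
      using col_orth row_orth M_eq lam_nonneg lam_sorted
    proof eventually_elim
      case (elim \<epsilon>)
      have "lam i \<epsilon> \<le> (\<Sum>j\<in>{i..<n}. \<Sum>i<n. lam i \<epsilon> * Z \<epsilon> j i * Z \<epsilon> j i)"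
        using elim i by (intro ky_fan_bound) auto
      also have "\<dots> = (\<Sum>j\<in>{i..<n}. M \<epsilon> j j)" using elim by (intro sum.cong) auto
      finally show ?case using elim i by auto
    qed
  qed simp
  also have "(\<lambda>\<epsilon>. \<Sum>j\<in>{i..<n}. M \<epsilon> j j) \<in> O[at_right 0](\<lambda>\<epsilon>. \<epsilon> ^ (2 * g i))"
  proof (rule big_sum_in_bigo)
    fix j assume j: "j \<in> {i..<n}"
    have "(\<lambda>\<epsilon>. M \<epsilon> j j) \<in> O[at_right 0](\<lambda>\<epsilon>. \<epsilon> ^ (g j + g j))"
    proof (rule bigoI_tendsto)
      show "((\<lambda>\<epsilon>. M \<epsilon> j j / \<epsilon> ^ (g j + g j)) \<longlongrightarrow> G j j) (at_right 0)" using j M_lim by simp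
      show "eventually (\<lambda>\<epsilon>::real. \<epsilon> ^ (g j + g j) \<noteq> 0) (at_right 0)"
        using eventually_at_right_less[of 0] by eventually_elim simp
    qed
    also have "(\<lambda>\<epsilon>::real. \<epsilon> ^ (g j + g j)) \<in> O[at_right 0](\<lambda>\<epsilon>. \<epsilon> ^ (2 * g i))"
    proof (rule landau_o.bigI[of 1])
      have "eventually (\<lambda>\<epsilon>::real. \<epsilon> < 1) (at_right 0)"
        by (rule eventually_at_right_real[of 0 1, THEN eventually_mono]) auto
      with eventually_at_right_less[of 0]
      show "eventually (\<lambda>\<epsilon>::real. norm (\<epsilon> ^ (g j + g j)) \<le> 1 * norm (\<epsilon> ^ (2 * g i))) (at_right 0)"
        by eventually_elim (use g_mono[of i j] j in \<open>auto simp: abs_mult intro!: power_decreasing\<close>)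
    qed simp
    finally show "(\<lambda>\<epsilon>. M \<epsilon> j j) \<in> O[at_right 0](\<lambda>\<epsilon>. \<epsilon> ^ (2 * g i))" .
  qed
  finally show ?thesis .
qed

text \<open>Reason: \<open>lam i * (Z j i)\<^sup>2 \<le> M j j\<close>, and \<open>M j j\<close> is of smaller order than \<open>lam i\<close>.\<close>

lemma Z_tendsto_0:
  assumes ij: "i < n" "j < n" "g i < g j"
    and lt: "((\<lambda>\<epsilon>. lam i \<epsilon> / \<epsilon> ^ (2 * g i)) \<longlongrightarrow> c) (at_right 0)" "c \<noteq> 0"
  shows "((\<lambda>\<epsilon>. (Z \<epsilon> j i)\<^sup>2) \<longlongrightarrow> 0) (at_right 0)"
proof (rule tendsto_sandwich[OF _ _ tendsto_const])
  \<comment> \<open>The bound \<open>M j j / lam i\<close>, rewritten through the two quotients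
    whose limits are known. The surplus exponent is positive because \<open>g i < g j\<close>, so
    the numerator tends to 0 while the denominator tends to \<open>c\<close>.\<close>
  let ?f = "\<lambda>\<epsilon>. (M \<epsilon> j j / \<epsilon> ^ (g j + g j)) * \<epsilon> ^ (2 * (g j - g i)) / (lam i \<epsilon> / \<epsilon> ^ (2 * g i))"
  show "eventually (\<lambda>\<epsilon>. 0 \<le> (Z \<epsilon> j i)\<^sup>2) (at_right 0)" by simp
  have "(?f \<longlongrightarrow> G j j * 0 ^ (2 * (g j - g i)) / c) (at_right 0)"
    using ij lt by (intro tendsto_intros M_lim)
  then show "(?f \<longlongrightarrow> 0) (at_right 0)" using ij(3) by (simp add: zero_power)
  have nz: "eventually (\<lambda>\<epsilon>. lam i \<epsilon> / \<epsilon> ^ (2 * g i) \<noteq> 0) (at_right 0)"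
    using lt by (rule tendsto_imp_eventually_ne)
  show "eventually (\<lambda>\<epsilon>. (Z \<epsilon> j i)\<^sup>2 \<le> ?f \<epsilon>) (at_right 0)"
    using nz M_eq lam_nonneg eventually_at_right_less[of 0]
  proof eventually_elim
    case (elim \<epsilon>)
    have "lam i \<epsilon> \<noteq> 0" "lam i \<epsilon> \<ge> 0" using elim ij(1) by auto
    then have pos: "lam i \<epsilon> > 0" by simp
    have "lam i \<epsilon> * Z \<epsilon> j i * Z \<epsilon> j i \<le> (\<Sum>i<n. lam i \<epsilon> * Z \<epsilon> j i * Z \<epsilon> j i)"
      using elim ij by (intro member_le_sum) (auto simp: mult.assoc)
    then have "lam i \<epsilon> * (Z \<epsilon> j i)\<^sup>2 \<le> M \<epsilon> j j" using elim ij by (simp add: power2_eq_square mult.assoc)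
    then have "(Z \<epsilon> j i)\<^sup>2 \<le> M \<epsilon> j j / lam i \<epsilon>" using pos by (simp add: pos_le_divide_eq mult.commute)
    also have "\<epsilon> ^ (g j + g j) = \<epsilon> ^ (2 * (g j - g i)) * \<epsilon> ^ (2 * g i)"
      unfolding power_add[symmetric] using ij(3) by (intro arg_cong[where f = "(^) \<epsilon>"]) auto
    then have "M \<epsilon> j j / lam i \<epsilon> = ?f \<epsilon>" using elim by simp
    finally show ?case .
  qed
qed

text \<open>Multiplying the rows and columns of \<open>\<epsilon>\<^sup>2\<^sup>s x I - M\<close> by \<open>\<epsilon> ^ - min (g i) s\<close> makes both the entries and
  the product of the \<open>\<epsilon>\<^sup>2\<^sup>s x - lam i\<close>, scaled alike, converge.\<close>

lemma limit_det:
  assumes lt: "\<And>i. i < n \<Longrightarrow> ((\<lambda>\<epsilon>. lam i \<epsilon> / \<epsilon> ^ (2 * g i)) \<longlongrightarrow> lt i) (at_right 0)"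
  shows "det (mat n n (\<lambda>(i, j). (if i = j \<and> s \<le> g i then x else 0) - (if g i \<le> s \<and> g j \<le> s then G i j else 0))) =
    (\<Prod>i<n. if g i < s then - lt i else if g i = s then x - lt i else x)" (is "det ?N = ?R")
proof -
  \<comment> \<open>The cap at \<open>s\<close> matters: above block \<open>s\<close> the scale
    \<open>\<epsilon> ^ g i\<close> would let the diagonal term blow up. With the cap that term
    stays equal to \<open>x\<close>, and the entries of \<open>M\<close> there vanish in the
    limit.\<close>
  define d where "d \<epsilon> i = \<epsilon> ^ min (g i) s" for \<epsilon> :: real and i
  define N where "N \<epsilon> = mat n n (\<lambda>(i, j). (if i = j then \<epsilon> ^ (2 * s) * x else 0) / (d \<epsilon> i * d \<epsilon> j) - M \<epsilon> i j / (d \<epsilon> i * d \<epsilon> j))" for \<epsilon>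
  have pos: "eventually (\<lambda>\<epsilon>::real. \<epsilon> > 0) (at_right 0)" by (rule eventually_at_right_less)
  have pw: "((\<lambda>\<epsilon>::real. \<epsilon> ^ k) \<longlongrightarrow> 0 ^ k) (at_right 0)" for k by (intro tendsto_intros)
  have diag: "((\<lambda>\<epsilon>. \<epsilon> ^ (2 * s) * x / (d \<epsilon> i * d \<epsilon> i)) \<longlongrightarrow> (if s \<le> g i then x else 0)) (at_right 0)" for i
  proof -
    have h1: "((\<lambda>\<epsilon>. \<epsilon> ^ (2 * (s - min (g i) s)) * x) \<longlongrightarrow> 0 ^ (2 * (s - min (g i) s)) * x) (at_right 0)"
      by (intro tendsto_intros pw)
    have h2: "eventually (\<lambda>\<epsilon>. \<epsilon> ^ (2 * (s - min (g i) s)) * x = \<epsilon> ^ (2 * s) * x / (d \<epsilon> i * d \<epsilon> i)) (at_right 0)"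
      using pos
    proof eventually_elim
      case (elim \<epsilon>)
      have "\<epsilon> ^ (2 * s) = \<epsilon> ^ (2 * (s - min (g i) s)) * (d \<epsilon> i * d \<epsilon> i)"
        unfolding d_def power_add[symmetric] by (rule arg_cong[where f = "(^) \<epsilon>"]) auto
      then show ?case using elim by (simp add: d_def)
    qed
    \<comment> \<open>Truncated subtraction makes the exponent 0 exactly when
      \<open>s \<le> g i\<close>, and \<open>0 ^ 0 = 1\<close>; the power acts as an indicator. The
      next two limits use the same device.\<close>
    have h3: "0 ^ (2 * (s - min (g i) s)) * x = (if s \<le> g i then x else 0)" by auto
    show ?thesis using Lim_transform_eventually[OF h1 h2] unfolding h3 .
  qed
  have Mdiv: "((\<lambda>\<epsilon>. M \<epsilon> i j / (d \<epsilon> i * d \<epsilon> j)) \<longlongrightarrow> (if g i \<le> s \<and> g j \<le> s then G i j else 0)) (at_right 0)"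
    if ij: "i < n" "j < n" for i j
  proof -
    let ?k = "(g i - s) + (g j - s)"
    have h1: "((\<lambda>\<epsilon>. (M \<epsilon> i j / \<epsilon> ^ (g i + g j)) * \<epsilon> ^ ?k) \<longlongrightarrow> G i j * 0 ^ ?k) (at_right 0)"
      by (intro tendsto_intros pw M_lim ij)
    have h2: "eventually (\<lambda>\<epsilon>. (M \<epsilon> i j / \<epsilon> ^ (g i + g j)) * \<epsilon> ^ ?k = M \<epsilon> i j / (d \<epsilon> i * d \<epsilon> j)) (at_right 0)"
      using pos
    proof eventually_elim
      case (elim \<epsilon>)
      have "\<epsilon> ^ (g i + g j) = \<epsilon> ^ ?k * (d \<epsilon> i * d \<epsilon> j)"
        unfolding d_def power_add[symmetric] by (rule arg_cong[where f = "(^) \<epsilon>"]) auto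
      then show ?case using elim by (simp add: d_def)
    qed
    have h3: "G i j * 0 ^ ?k = (if g i \<le> s \<and> g j \<le> s then G i j else 0)" by auto
    show ?thesis using Lim_transform_eventually[OF h1 h2] unfolding h3 .
  qed
  have lamdiv: "((\<lambda>\<epsilon>. lam i \<epsilon> / (d \<epsilon> i * d \<epsilon> i)) \<longlongrightarrow> (if g i \<le> s then lt i else 0)) (at_right 0)"
    if i: "i < n" for i
  proof -
    have h1: "((\<lambda>\<epsilon>. (lam i \<epsilon> / \<epsilon> ^ (2 * g i)) * \<epsilon> ^ (2 * (g i - s))) \<longlongrightarrow> lt i * 0 ^ (2 * (g i - s))) (at_right 0)"
      by (intro tendsto_intros pw lt i)
    have h2: "eventually (\<lambda>\<epsilon>. (lam i \<epsilon> / \<epsilon> ^ (2 * g i)) * \<epsilon> ^ (2 * (g i - s)) = lam i \<epsilon> / (d \<epsilon> i * d \<epsilon> i)) (at_right 0)"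
      using pos
    proof eventually_elim
      case (elim \<epsilon>)
      have "\<epsilon> ^ (2 * g i) = \<epsilon> ^ (2 * (g i - s)) * (d \<epsilon> i * d \<epsilon> i)"
        unfolding d_def power_add[symmetric] by (rule arg_cong[where f = "(^) \<epsilon>"]) auto
      then show ?case using elim by (simp add: d_def)
    qed
    have h3: "lt i * 0 ^ (2 * (g i - s)) = (if g i \<le> s then lt i else 0)" by auto
    show ?thesis using Lim_transform_eventually[OF h1 h2] unfolding h3 .
  qed
  have "((\<lambda>\<epsilon>. det (N \<epsilon>)) \<longlongrightarrow> det ?N) (at_right 0)"
  proof (rule tendsto_det)
    fix i j assume ij: "i < n" "j < n"
    have "((\<lambda>\<epsilon>. (if i = j then \<epsilon> ^ (2 * s) * x else 0) / (d \<epsilon> i * d \<epsilon> j)) \<longlongrightarrow>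
        (if i = j \<and> s \<le> g i then x else 0)) (at_right 0)"
      using diag[of i] by (cases "i = j") auto
    from tendsto_diff[OF this Mdiv[OF ij]]
    show "((\<lambda>\<epsilon>. N \<epsilon> $$ (i, j)) \<longlongrightarrow> ?N $$ (i, j)) (at_right 0)" using ij by (simp add: N_def)
  qed (auto simp: N_def)
  moreover have "((\<lambda>\<epsilon>. det (N \<epsilon>)) \<longlongrightarrow> ?R) (at_right 0)"
  proof -
    have "((\<lambda>\<epsilon>. \<Prod>i<n. \<epsilon> ^ (2 * s) * x / (d \<epsilon> i * d \<epsilon> i) - lam i \<epsilon> / (d \<epsilon> i * d \<epsilon> i)) \<longlongrightarrow>
       (\<Prod>i<n. (if s \<le> g i then x else 0) - (if g i \<le> s then lt i else 0))) (at_right 0)"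
      by (intro tendsto_prod tendsto_diff diag lamdiv) auto
    also have "(\<Prod>i<n. (if s \<le> g i then x else 0) - (if g i \<le> s then lt i else 0)) = ?R"
      by (intro prod.cong) auto
    finally have lim: "((\<lambda>\<epsilon>. \<Prod>i<n. \<epsilon> ^ (2 * s) * x / (d \<epsilon> i * d \<epsilon> i) - lam i \<epsilon> / (d \<epsilon> i * d \<epsilon> i)) \<longlongrightarrow> ?R) (at_right 0)" .
    have "eventually (\<lambda>\<epsilon>. (\<Prod>i<n. \<epsilon> ^ (2 * s) * x / (d \<epsilon> i * d \<epsilon> i) - lam i \<epsilon> / (d \<epsilon> i * d \<epsilon> i)) = det (N \<epsilon>)) (at_right 0)"
      using row_orth M_eq pos
    proof eventually_elim
      case (elim \<epsilon>)
      define Zm where "Zm = mat n n (\<lambda>(j, i). Z \<epsilon> j i)"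
      define Dm where "Dm = mat_diag n (\<lambda>i. 1 / d \<epsilon> i)"
      define L where "L = mat_diag n (\<lambda>i. \<epsilon> ^ (2 * s) * x - lam i \<epsilon>)"
      have car[simp]: "Zm \<in> carrier_mat n n" "Dm \<in> carrier_mat n n" "L \<in> carrier_mat n n"
        "transpose_mat Zm \<in> carrier_mat n n"
        by (auto simp: Zm_def Dm_def L_def)
      have ZZ: "Zm * transpose_mat Zm = 1\<^sub>m n"
        using elim(1) by (intro eq_matI) (auto simp: Zm_def scalar_prod_def atLeast0LessThan)
      have ZLZ: "(Zm * L * transpose_mat Zm) $$ (i, j) = (if i = j then \<epsilon> ^ (2 * s) * x else 0) - M \<epsilon> i j"
        if "i < n" "j < n" for i j
      proof -
        have "(Zm * L * transpose_mat Zm) $$ (i, j) = (\<Sum>l<n. Z \<epsilon> i l * (\<epsilon> ^ (2 * s) * x - lam l \<epsilon>) * Z \<epsilon> j l)"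
          using that unfolding L_def by (subst mat_diag_mult_right[OF car(1)])
            (auto simp: Zm_def scalar_prod_def atLeast0LessThan)
        also have "\<dots> = \<epsilon> ^ (2 * s) * x * (\<Sum>l<n. Z \<epsilon> i l * Z \<epsilon> j l) - (\<Sum>l<n. lam l \<epsilon> * Z \<epsilon> i l * Z \<epsilon> j l)"
          unfolding sum_distrib_left sum_subtractf[symmetric] by (intro sum.cong) (auto simp: algebra_simps)
        finally show ?thesis using elim that by simp
      qed
      \<comment> \<open>The unscaled matrix is diagonalised by the orthogonal \<open>Zm\<close>, so
        its determinant is that of \<open>L\<close>: the determinants of \<open>Zm\<close> and its
        transpose multiply to 1.\<close>
      have "N \<epsilon> = Dm * (Zm * L * transpose_mat Zm) * Dm"
        unfolding Dm_def mat_diag_mult_left[OF mult_carrier_mat[OF mult_carrier_mat[OF car(1) car(3)] car(4)]]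
        by (subst mat_diag_mult_right[of _ n n])
          (auto simp: N_def ZLZ diff_divide_distrib simp del: index_mult_mat(1) intro!: eq_matI)
      then have "det (N \<epsilon>) = det Dm * (det Zm * det L * det (transpose_mat Zm)) * det Dm"
        by (simp add: det_mult[of _ n] mult_carrier_mat[of _ n n])
      also have "\<dots> = det Dm * det L * det Dm * det (Zm * transpose_mat Zm)"
        by (simp add: det_mult[of _ n] mult_carrier_mat[of _ n n])
      also have "\<dots> = (\<Prod>i<n. 1 / d \<epsilon> i * (\<epsilon> ^ (2 * s) * x - lam i \<epsilon>) * (1 / d \<epsilon> i))"
        unfolding ZZ by (simp only: Dm_def L_def det_mat_diag prod.distrib det_one)
      also have "\<dots> = (\<Prod>i<n. \<epsilon> ^ (2 * s) * x / (d \<epsilon> i * d \<epsilon> i) - lam i \<epsilon> / (d \<epsilon> i * d \<epsilon> i))"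
        by (intro prod.cong) (auto simp: diff_divide_distrib)
      finally show ?case by simp
    qed
    with lim show ?thesis by (rule Lim_transform_eventually)
  qed
  ultimately show ?thesis by (rule tendsto_unique[OF trivial_limit_at_right_real])
qed

end

section \<open>Taylor expansion of kernels\<close>

no_notation Matrix.vec_index (infixl "$" 100)

section \<open>Multi-indices supported on a list of coordinates\<close>

lemma finite_mdeg_le: "finite {\<alpha>::'d::finite \<Rightarrow> nat. mdeg \<alpha> \<le> s}"
proof (rule finite_subset)
  show "{\<alpha>::'d \<Rightarrow> nat. mdeg \<alpha> \<le> s} \<subseteq> Pi\<^sub>E UNIV (\<lambda>_. {..s})"
    by (auto simp: mdeg_def intro: order_trans[OF member_le_sum[of _ UNIV]])
qed (simp add: finite_PiE)

text \<open>The dimension is fixed by a type and cannot be lowered in an induction. Instead the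
  induction on coordinates runs over lists \<open>L\<close> and multi-indices supported on
  \<open>L\<close>.\<close>

definition supp_in :: "'d list \<Rightarrow> ('d \<Rightarrow> nat) \<Rightarrow> bool" where
  "supp_in L \<alpha> \<longleftrightarrow> (\<forall>i. i \<notin> set L \<longrightarrow> \<alpha> i = 0)"

definition dirs :: "'d list \<Rightarrow> ('d \<Rightarrow> nat) \<Rightarrow> 'd list" where
  "dirs L \<alpha> = concat (map (\<lambda>i. replicate (\<alpha> i) i) L)"

lemma canon_dirs: "canon \<alpha> = dirs (sorted_list_of_set UNIV) \<alpha>"
  by (simp add: canon_def dirs_def)

lemma dirs_snoc: "dirs (L @ [i]) \<alpha> = dirs L \<alpha> @ replicate (\<alpha> i) i"
  by (simp add: dirs_def)

lemma dirs_upd: "i \<notin> set L \<Longrightarrow> dirs L (\<alpha>(i := m)) = dirs L \<alpha>"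
  unfolding dirs_def by (rule arg_cong[where f = concat]) auto

lemma mdeg_upd: "\<alpha> i = 0 \<Longrightarrow> mdeg (\<alpha>(i := m)) = mdeg \<alpha> + m"
  for \<alpha> :: "'d::finite \<Rightarrow> nat"
  unfolding mdeg_def by (simp add: sum.remove[of UNIV i])

lemma mfact_upd: "\<alpha> i = 0 \<Longrightarrow> mfact (\<alpha>(i := m)) = mfact \<alpha> * fact m"
  for \<alpha> :: "'d::finite \<Rightarrow> nat"
  unfolding mfact_def by (simp add: prod.remove[of UNIV i])

lemma mpow_upd:
  assumes "\<alpha> i = 0" "\<And>l. l \<noteq> i \<Longrightarrow> x $ l = y $ l"
  shows "mpow x (\<alpha>(i := m)) = mpow y \<alpha> * (x $ i) ^ m"
proof -
  have "(\<Prod>l\<in>UNIV - {i}. (x $ l) ^ (\<alpha>(i := m)) l) = (\<Prod>l\<in>UNIV - {i}. (y $ l) ^ \<alpha> l)"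
    using assms by (intro prod.cong) auto
  then show ?thesis using assms unfolding mpow_def by (simp add: prod.remove[of UNIV i])
qed

lemma mfact_pos: "mfact \<alpha> > 0" by (simp add: mfact_def prod_pos)

lemma mpow_scale: "mpow (t *\<^sub>R x) \<alpha> = t ^ mdeg \<alpha> * mpow x \<alpha>"
  by (simp add: mpow_def mdeg_def power_mult_distrib prod.distrib power_sum)

lemma mdeg_supp_Nil: "{\<alpha>. supp_in [] \<alpha> \<and> Q (mdeg \<alpha>)} = (if Q 0 then {\<lambda>_. 0} else {})"
  by (auto simp: supp_in_def mdeg_def fun_eq_iff)

text \<open>Separates the exponent \<open>m\<close> of the last coordinate. The abstract
  \<open>Q\<close> serves both index sets of the Taylor estimate, degree at most \<open>s\<close>
  and degree exactly \<open>s\<close>.\<close>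

lemma sum_supp_snoc:
  fixes F :: "('d::finite \<Rightarrow> nat) \<Rightarrow> real"
  assumes i: "i \<notin> set L"
    and fin: "finite {\<alpha>::'d \<Rightarrow> nat. Q (mdeg \<alpha>)}" "\<And>t. Q t \<Longrightarrow> t \<le> s"
  shows "(\<Sum>\<alpha> | supp_in (L @ [i]) \<alpha> \<and> Q (mdeg \<alpha>). F \<alpha>) =
         (\<Sum>m\<le>s. \<Sum>\<alpha> | supp_in L \<alpha> \<and> Q (mdeg \<alpha> + m). F (\<alpha>(i := m)))"
proof -
  have fin': "finite {\<alpha>. supp_in L \<alpha> \<and> Q (mdeg \<alpha> + m)}" for m
    by (rule finite_subset[OF _ finite_mdeg_le[of s]]) (use fin(2) in fastforce)
  have "(\<Sum>m\<le>s. \<Sum>\<alpha> | supp_in L \<alpha> \<and> Q (mdeg \<alpha> + m). F (\<alpha>(i := m))) =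
        (\<Sum>(m, \<alpha>)\<in>(SIGMA m:{..s}. {\<alpha>. supp_in L \<alpha> \<and> Q (mdeg \<alpha> + m)}). F (\<alpha>(i := m)))"
    using fin' by (intro sum.Sigma) auto
  also have "\<dots> = (\<Sum>\<alpha> | supp_in (L @ [i]) \<alpha> \<and> Q (mdeg \<alpha>). F \<alpha>)"
  proof (rule sum.reindex_bij_witness[where i = "\<lambda>\<alpha>. (\<alpha> i, \<alpha>(i := 0))" and j = "\<lambda>(m, \<alpha>). \<alpha>(i := m)"])
    fix a assume "a \<in> {\<alpha>. supp_in (L @ [i]) \<alpha> \<and> Q (mdeg \<alpha>)}"
    then have a: "supp_in (L @ [i]) a" "Q (mdeg a)" by auto
    have "mdeg a = mdeg (a(i := 0)) + a i"
      using mdeg_upd[of "a(i := 0)" i "a i"] by simp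
    then show "(a i, a(i := 0)) \<in> (SIGMA m:{..s}. {\<alpha>. supp_in L \<alpha> \<and> Q (mdeg \<alpha> + m)})"
      using a fin(2)[OF a(2)] by (auto simp: supp_in_def)
  next
    fix a assume "a \<in> (SIGMA m:{..s}. {\<alpha>. supp_in L \<alpha> \<and> Q (mdeg \<alpha> + m)})"
    then obtain m \<alpha> where a: "a = (m, \<alpha>)" "supp_in L \<alpha>" "Q (mdeg \<alpha> + m)" by auto
    moreover have "\<alpha> i = 0" using a i by (auto simp: supp_in_def)
    ultimately show "(\<lambda>(m, \<alpha>). \<alpha>(i := m)) a \<in> {\<alpha>. supp_in (L @ [i]) \<alpha> \<and> Q (mdeg \<alpha>)}"
      and "((\<lambda>(m, \<alpha>). \<alpha>(i := m)) a i, ((\<lambda>(m, \<alpha>). \<alpha>(i := m)) a)(i := 0)) = a"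
      by (auto simp: supp_in_def mdeg_upd)
  qed auto
  finally show ?thesis by simp
qed

text \<open>Only the derivatives taken in the order fixed by \<^const>\<open>canon\<close> are known to exist, so the
  expansion treats one coordinate at a time, beginning with the last one, and never permutes
  derivatives. The family \<open>D\<close> of iterated derivatives is indexed by lists of directions and need not
  consist of iterated \<open>deriv\<close>s: this lets the lemma apply to linear combinations without any
  linearity argument.\<close>

lemma taylor_coordinatewise:
  fixes D :: "'d::{finite,linorder} list \<Rightarrow> 'd pt \<Rightarrow> real"
  assumes "sorted L" "distinct L"
    and "\<And>i is x. sorted (i # is) \<Longrightarrow> set (i # is) \<subseteq> set L \<Longrightarrow> length (i # is) \<le> s \<Longrightarrow>
           (\<And>l. \<bar>x $ l\<bar> \<le> \<rho>) \<Longrightarrow>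
           ((\<lambda>t. D is (x + t *\<^sub>R axis i 1)) has_real_derivative D (i # is) x) (at 0)"
    and "\<And>\<alpha> x. supp_in L \<alpha> \<Longrightarrow> mdeg \<alpha> = s \<Longrightarrow> (\<And>l. \<bar>x $ l\<bar> \<le> \<rho>) \<Longrightarrow>
           \<bar>D (dirs L \<alpha>) x - c \<alpha>\<bar> \<le> \<eta>"
    and "\<And>l. \<bar>x $ l\<bar> \<le> \<rho>" and "\<And>l. l \<notin> set L \<Longrightarrow> x $ l = 0"
  shows "\<bar>D [] x - (\<Sum>\<alpha> | supp_in L \<alpha> \<and> mdeg \<alpha> \<le> s.
              (if mdeg \<alpha> < s then D (dirs L \<alpha>) 0 else c \<alpha>) * (mpow x \<alpha> / mfact \<alpha>))\<bar>
         \<le> \<eta> * (\<Sum>\<alpha> | supp_in L \<alpha> \<and> mdeg \<alpha> = s. \<bar>mpow x \<alpha>\<bar> / mfact \<alpha>)"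
  using assms
proof (induction L arbitrary: D s c x rule: rev_induct)
  case Nil
  have x: "x = 0" using Nil.prems(6) by (simp add: Finite_Cartesian_Product.vec_eq_iff)
  have 0: "mdeg (\<lambda>_. 0) = 0" "mpow y (\<lambda>_. 0) = 1" "mfact (\<lambda>_. 0) = 1" "dirs [] (\<lambda>_. 0) = []" 
    for y :: "'d pt"
    by (simp_all add: mdeg_def mpow_def mfact_def dirs_def)
  show ?case
  proof (cases "s = 0")
    case True
    have "\<bar>D (dirs [] (\<lambda>_. 0)) x - c (\<lambda>_. 0)\<bar> \<le> \<eta>"
      using Nil.prems(5) True by (intro Nil.prems(4)) (auto simp: supp_in_def mdeg_def)
    then show ?thesis using True
      unfolding mdeg_supp_Nil[of "\<lambda>t. t \<le> s"] mdeg_supp_Nil[of "\<lambda>t. t = s"] by (simp add: 0)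
  next
    case False
    then show ?thesis
      unfolding mdeg_supp_Nil[of "\<lambda>t. t \<le> s"] mdeg_supp_Nil[of "\<lambda>t. t = s"] by (simp add: 0 x)
  qed
next
  case (snoc i L)
  have i: "i \<notin> set L" and L: "sorted L" "distinct L" and Li: "\<And>l. l \<in> set L \<Longrightarrow> l \<le> i"
    using snoc.prems(1,2) by (auto simp: sorted_append)
  define x0 where "x0 = (\<chi> l. if l = i then 0 else x $ l)"
  have x0: "x0 $ i = 0" "\<And>l. l \<noteq> i \<Longrightarrow> x0 $ l = x $ l" by (auto simp: x0_def)
  have x0t: "(x0 + t *\<^sub>R axis i 1) $ l = (if l = i then t else x $ l)" for t l
    by (auto simp: x0_def axis_def)
  have xeq: "x0 + (x $ i) *\<^sub>R axis i 1 = x"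
    by (simp add: Finite_Cartesian_Product.vec_eq_iff x0t del: vector_add_component)
  \<comment> \<open>The restriction to the line through \<open>x0\<close> in direction
    \<open>i\<close>. Since \<open>i\<close> is the last coordinate of the list, its derivatives are
    innermost and are taken before any other.\<close>
  define dif where "dif = (\<lambda>m t. D (replicate m i) (x0 + t *\<^sub>R axis i 1))"
  have "DERIV (dif m) t :> dif (Suc m) t" if "m < s" "\<bar>t\<bar> \<le> \<bar>x $ i\<bar>" for m t
  proof -
    have "((\<lambda>h. D (replicate m i) ((x0 + t *\<^sub>R axis i 1) + h *\<^sub>R axis i 1)) has_real_derivative
        D (i # replicate m i) (x0 + t *\<^sub>R axis i 1)) (at 0)"
      using that snoc.prems(5) order_trans[OF that(2) snoc.prems(5)]
      by (intro snoc.prems(3)) (auto simp: x0t simp del: vector_add_component)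
    then have "((\<lambda>h. dif m (h + t)) has_real_derivative dif (Suc m) t) (at 0)"
      by (simp add: dif_def scaleR_add_left add_ac)
    then show ?thesis using DERIV_shift[of "dif m" _ 0 t] by simp
  qed
  then obtain t where t: "\<bar>t\<bar> \<le> \<bar>x $ i\<bar>" and
    tay: "dif 0 (x $ i) = (\<Sum>m<s. dif m 0 / fact m * (x $ i) ^ m) + dif s t / fact s * (x $ i) ^ s"
    using Maclaurin_bi_le[of dif "dif 0" s "x $ i"] by blast
  define C where "C = (\<lambda>\<alpha>. if mdeg \<alpha> < s then D (dirs (L @ [i]) \<alpha>) 0 else c \<alpha>)"
  define S where "S = (\<lambda>m. \<Sum>\<alpha> | supp_in L \<alpha> \<and> mdeg \<alpha> + m \<le> s. C (\<alpha>(i := m)) * (mpow x0 \<alpha> / mfact \<alpha>))"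
  define T where "T = (\<lambda>m. \<Sum>\<alpha> | supp_in L \<alpha> \<and> mdeg \<alpha> + m = s. \<bar>mpow x0 \<alpha>\<bar> / mfact \<alpha>)"
  \<comment> \<open>Coefficients of the one-variable Maclaurin formula: the last one, from the
    Lagrange remainder, is taken at the intermediate point \<open>t\<close>, all others at
    0.\<close>
  define w where "w = (\<lambda>m. if m = s then dif s t else dif m 0)"
  have main: "\<bar>w m - S m\<bar> \<le> \<eta> * T m" if m: "m \<le> s" for m
  proof (cases "m = s")
    case True
    \<comment> \<open>No order is left for the other coordinates: only the zero multi-index
      contributes, and the assumed closeness to \<open>c\<close> is used directly.\<close>
    have sets: "{\<alpha>. supp_in L \<alpha> \<and> mdeg \<alpha> + m \<le> s} = {\<lambda>_. 0}" 
      "{\<alpha>. supp_in L \<alpha> \<and> mdeg \<alpha> + m = s} = {\<lambda>_. 0}"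
      using True by (auto simp: supp_in_def mdeg_def fun_eq_iff)
    have 0: "mpow x0 (\<lambda>_. 0) = 1" "mfact (\<lambda>_::'d. 0) = 1" by (auto simp: mpow_def mfact_def)
    have a0: "mdeg ((\<lambda>_. 0)(i := s)) = s" "supp_in (L @ [i]) ((\<lambda>_. 0)(i := s))"
      by (subst mdeg_upd) (auto simp: mdeg_def supp_in_def)
    moreover have "dirs (L @ [i]) ((\<lambda>_. 0)(i := s)) = replicate s i"
      using i by (simp add: dirs_snoc dirs_upd del: fun_upd_apply) (simp add: dirs_def)
    moreover have "\<bar>D (dirs (L @ [i]) ((\<lambda>_. 0)(i := s))) (x0 + t *\<^sub>R axis i 1) - c ((\<lambda>_. 0)(i := s))\<bar> \<le> \<eta>"
      using a0 snoc.prems(5) order_trans[OF t snoc.prems(5)]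
      by (intro snoc.prems(4)) (auto simp: x0t simp del: vector_add_component fun_upd_apply)
    ultimately show ?thesis
      unfolding S_def T_def sets using True a0 
      by (simp add: w_def 0 C_def dif_def del: fun_upd_apply)
  next
    case False
    then have ms: "m < s" using m by simp
    \<comment> \<open>The coefficient \<open>D (replicate m i)\<close> is itself a function of the
      remaining coordinates. Appending \<open>replicate m i\<close> to every list makes the family
      of its derivatives an instance of the induction hypothesis at order
      \<open>s - m\<close>.\<close>
    have "\<bar>D ([] @ replicate m i) x0 - (\<Sum>\<alpha> | supp_in L \<alpha> \<and> mdeg \<alpha> \<le> s - m.
              (if mdeg \<alpha> < s - m then D (dirs L \<alpha> @ replicate m i) 0 else c (\<alpha>(i := m))) * (mpow x0 \<alpha> / mfact \<alpha>))\<bar>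
         \<le> \<eta> * (\<Sum>\<alpha> | supp_in L \<alpha> \<and> mdeg \<alpha> = s - m. \<bar>mpow x0 \<alpha>\<bar> / mfact \<alpha>)"
    proof (rule snoc.IH[where D = "\<lambda>is. D (is @ replicate m i)" and s = "s - m" and c = "\<lambda>\<alpha>. c (\<alpha>(i := m))" and x = x0])
      fix j "is" and y :: "'d pt" assume *: "sorted (j # is)" "set (j # is) \<subseteq> set L" "length (j # is) \<le> s - m"
        "\<And>l. \<bar>y $ l\<bar> \<le> \<rho>"
      have "((\<lambda>t. D (is @ replicate m i) (y + t *\<^sub>R axis j 1)) has_real_derivative 
          D (j # (is @ replicate m i)) y) (at 0)"
        using * ms Li by (intro snoc.prems(3)) (auto simp: sorted_append)
      then show "((\<lambda>t. D (is @ replicate m i) (y + t *\<^sub>R axis j 1)) has_real_derivative 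
          D ((j # is) @ replicate m i) y) (at 0)" by simp
    next
      fix \<alpha> and y :: "'d pt" assume *: "supp_in L \<alpha>" "mdeg \<alpha> = s - m" "\<And>l. \<bar>y $ l\<bar> \<le> \<rho>"
      then have "\<alpha> i = 0" using i by (auto simp: supp_in_def)
      moreover have "mdeg (\<alpha>(i := m)) = s" "supp_in (L @ [i]) (\<alpha>(i := m))"
        using * ms calculation by (simp_all add: mdeg_upd supp_in_def del: fun_upd_apply) simp
      ultimately have "\<bar>D (dirs (L @ [i]) (\<alpha>(i := m))) y - c (\<alpha>(i := m))\<bar> \<le> \<eta>"
        using * by (intro snoc.prems(4)) (auto simp del: fun_upd_apply)
      then show "\<bar>D (dirs L \<alpha> @ replicate m i) y - c (\<alpha>(i := m))\<bar> \<le> \<eta>"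
        using i by (simp add: dirs_snoc dirs_upd)
    next
      show "\<bar>x0 $ l\<bar> \<le> \<rho>" for l
        using snoc.prems(5)[of l] abs_ge_zero order_trans by (fastforce simp: x0_def)
      show "x0 $ l = 0" if "l \<notin> set L" for l
        using snoc.prems(6)[of l] that by (auto simp: x0_def)
    qed (use L in auto)
    moreover have "(\<Sum>\<alpha> | supp_in L \<alpha> \<and> mdeg \<alpha> \<le> s - m.
              (if mdeg \<alpha> < s - m then D (dirs L \<alpha> @ replicate m i) 0 else c (\<alpha>(i := m))) * (mpow x0 \<alpha> / mfact \<alpha>)) = S m"
      unfolding S_def
    proof (rule sum.cong)
      fix \<alpha> assume "\<alpha> \<in> {\<alpha>. supp_in L \<alpha> \<and> mdeg \<alpha> + m \<le> s}"
      then have "\<alpha> i = 0" using i by (auto simp: supp_in_def)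
      then show "(if mdeg \<alpha> < s - m then D (dirs L \<alpha> @ replicate m i) 0 else c (\<alpha>(i := m))) * (mpow x0 \<alpha> / mfact \<alpha>)
        = C (\<alpha>(i := m)) * (mpow x0 \<alpha> / mfact \<alpha>)"
        using i by (simp add: C_def mdeg_upd dirs_snoc dirs_upd less_diff_conv)
    qed (use ms in auto)
    moreover have "{\<alpha>. supp_in L \<alpha> \<and> mdeg \<alpha> = s - m} = {\<alpha>. supp_in L \<alpha> \<and> mdeg \<alpha> + m = s}"
      using ms by auto
    ultimately show ?thesis using False by (simp add: w_def T_def dif_def)
  qed
  have sumS: "(\<Sum>\<alpha> | supp_in (L @ [i]) \<alpha> \<and> mdeg \<alpha> \<le> s. C \<alpha> * (mpow x \<alpha> / mfact \<alpha>)) =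
     (\<Sum>m\<le>s. S m * ((x $ i) ^ m / fact m))"
    unfolding S_def sum_distrib_right
    by (subst sum_supp_snoc[OF i, of "\<lambda>t. t \<le> s" s])
       (use i x0 in \<open>auto simp: finite_mdeg_le supp_in_def mpow_upd[where y = x0] mfact_upd intro!: sum.cong\<close>)
  have sumT: "(\<Sum>\<alpha> | supp_in (L @ [i]) \<alpha> \<and> mdeg \<alpha> = s. \<bar>mpow x \<alpha>\<bar> / mfact \<alpha>) =
     (\<Sum>m\<le>s. T m * (\<bar>x $ i\<bar> ^ m / fact m))"
    unfolding T_def sum_distrib_right
    by (subst sum_supp_snoc[OF i, of "\<lambda>t. t = s" s])
       (use i x0 finite_subset[OF _ finite_mdeg_le[of s], of "{\<alpha>. mdeg \<alpha> = s}"] in 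
         \<open>auto simp: supp_in_def mpow_upd[where y = x0] mfact_upd abs_mult power_abs intro!: sum.cong\<close>)
  have "D [] x = (\<Sum>m\<le>s. w m * ((x $ i) ^ m / fact m))"
    using tay by (simp add: dif_def xeq w_def sum.lessThan_Suc[symmetric] lessThan_Suc_atMost[symmetric])
  then have "D [] x - (\<Sum>m\<le>s. S m * ((x $ i) ^ m / fact m)) = (\<Sum>m\<le>s. (w m - S m) * ((x $ i) ^ m / fact m))"
    by (simp add: sum_subtractf[symmetric] left_diff_distrib diff_divide_distrib)
  also have "\<bar>\<dots>\<bar> \<le> (\<Sum>m\<le>s. \<bar>(w m - S m) * ((x $ i) ^ m / fact m)\<bar>)" by (rule sum_abs)
  also have "\<dots> \<le> (\<Sum>m\<le>s. \<eta> * T m * (\<bar>x $ i\<bar> ^ m / fact m))"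
    using main by (intro sum_mono) (auto simp: abs_mult power_abs intro!: divide_right_mono mult_right_mono)
  also have "\<dots> = \<eta> * (\<Sum>m\<le>s. T m * (\<bar>x $ i\<bar> ^ m / fact m))"
    by (simp add: sum_distrib_left mult.assoc)
  finally show ?case
    unfolding sumS[unfolded C_def] sumT .
qed


section \<open>Sorted direction lists as multi-indices\<close>

lemma length_canon: "length (canon \<alpha>) = mdeg \<alpha>"
  by (simp add: canon_def length_concat comp_def mdeg_def sum_list_distinct_conv_sum_set)

lemma count_dirs: "distinct L \<Longrightarrow> count (mset (dirs L \<alpha>)) i = (if i \<in> set L then \<alpha> i else 0)"
  by (induction L) (auto simp: dirs_def)

lemma sorted_dirs: "sorted L \<Longrightarrow> sorted (dirs L \<alpha>)"
  by (induction L) (auto simp: dirs_def sorted_append)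

text \<open>Differentiability is assumed for the lists \<open>canon \<alpha>\<close>, while the
  expansion meets arbitrary sorted lists; multiplicities serve as exponents.\<close>

lemma sorted_eq_canon:
  fixes "is" :: "'d::{finite,linorder} list"
  assumes "sorted is"
  obtains \<alpha> where "canon \<alpha> = is" "mdeg \<alpha> = length is"
proof
  have "mset (canon (count (mset is))) = mset is"
    by (rule multiset_eqI) (simp add: canon_dirs count_dirs)
  then show "canon (count (mset is)) = is"
    using assms sorted_dirs[of "sorted_list_of_set UNIV"]
    by (metis canon_dirs properties_for_sort sorted_sort_id sorted_sorted_list_of_set)
  then show "mdeg (count (mset is)) = length is" by (metis length_canon)
qed

lemma exX_has_derivative:
  "exX \<Omega> (i # is) F \<Longrightarrow> x \<in> \<Omega> \<Longrightarrow> y \<in> \<Omega> \<Longrightarrow>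
    ((\<lambda>t. iterX is F (x + t *\<^sub>R axis i 1) y) has_real_derivative iterX (i # is) F x y) (at 0)"
  by (simp add: dX_def DERIV_deriv_iff_real_differentiable)

lemma exY_has_derivative:
  "exY \<Omega> (i # is) F \<Longrightarrow> x \<in> \<Omega> \<Longrightarrow> y \<in> \<Omega> \<Longrightarrow>
    ((\<lambda>t. iterY is F x (y + t *\<^sub>R axis i 1)) has_real_derivative iterY (i # is) F x y) (at 0)"
  by (simp add: dY_def DERIV_deriv_iff_real_differentiable)

text \<open>The weights \<open>u\<close> annihilate monomials of degree below \<open>s\<close>, so
  the lower Taylor coefficients drop out whatever their values; what remains scales like
  \<open>\<epsilon> ^ s\<close>. The targets \<open>c \<alpha>\<close> may be any numbers close to
  the top derivatives, which lets one expansion be nested in another.\<close>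

lemma taylor_moments:
  fixes D :: "'d::{finite,linorder} list \<Rightarrow> 'd pt \<Rightarrow> real" and u :: "nat \<Rightarrow> real"
  assumes der: "\<And>i is x. sorted (i # is) \<Longrightarrow> length (i # is) \<le> s \<Longrightarrow> (\<And>l. \<bar>x $ l\<bar> \<le> \<rho>) \<Longrightarrow>
           ((\<lambda>t. D is (x + t *\<^sub>R axis i 1)) has_real_derivative D (i # is) x) (at 0)"
    and close: "\<And>\<alpha> x. mdeg \<alpha> = s \<Longrightarrow> (\<And>l. \<bar>x $ l\<bar> \<le> \<rho>) \<Longrightarrow> \<bar>D (canon \<alpha>) x - c \<alpha>\<bar> \<le> \<eta>"
    and xs: "\<And>b l. b < n \<Longrightarrow> \<bar>(\<epsilon> *\<^sub>R xs b) $ l\<bar> \<le> \<rho>"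
    and mom: "\<And>\<alpha>. mdeg \<alpha> < s \<Longrightarrow> (\<Sum>b<n. u b * mpow (xs b) \<alpha>) = 0"
    and \<epsilon>: "\<epsilon> > 0"
  shows "\<bar>(\<Sum>b<n. u b * D [] (\<epsilon> *\<^sub>R xs b)) -
      \<epsilon> ^ s * (\<Sum>\<alpha> | mdeg \<alpha> = s. (\<Sum>b<n. u b * mpow (xs b) \<alpha>) * c \<alpha> / mfact \<alpha>)\<bar>
    \<le> \<eta> * \<epsilon> ^ s * (\<Sum>b<n. \<bar>u b\<bar> * (\<Sum>\<alpha> | mdeg \<alpha> = s. \<bar>mpow (xs b) \<alpha>\<bar> / mfact \<alpha>))"
proof -
  define C where "C = (\<lambda>\<alpha>. if mdeg \<alpha> < s then D (dirs (sorted_list_of_set UNIV) \<alpha>) 0 else c \<alpha>)"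
  define T where "T = (\<lambda>b. \<Sum>\<alpha> | mdeg \<alpha> \<le> s. C \<alpha> * (mpow (\<epsilon> *\<^sub>R xs b) \<alpha> / mfact \<alpha>))"
  have supp: "supp_in (sorted_list_of_set UNIV) \<alpha>" for \<alpha> :: "'d \<Rightarrow> nat" by (simp add: supp_in_def)
  have *: "\<bar>D [] (\<epsilon> *\<^sub>R xs b) - T b\<bar> \<le> \<eta> * (\<Sum>\<alpha> | mdeg \<alpha> = s. \<bar>mpow (\<epsilon> *\<^sub>R xs b) \<alpha>\<bar> / mfact \<alpha>)"
    if "b < n" for b
    using taylor_coordinatewise[of "sorted_list_of_set UNIV" s \<rho> D c \<eta> "\<epsilon> *\<^sub>R xs b"] der close xs that
    by (simp add: supp canon_dirs[symmetric] C_def T_def)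
  have "(\<Sum>b<n. u b * T b) = (\<Sum>\<alpha> | mdeg \<alpha> \<le> s. C \<alpha> * \<epsilon> ^ mdeg \<alpha> / mfact \<alpha> * (\<Sum>b<n. u b * mpow (xs b) \<alpha>))"
    unfolding T_def sum_distrib_left mpow_scale by (subst sum.swap) (simp add: ac_simps)
  also have "\<dots> = (\<Sum>\<alpha> | mdeg \<alpha> = s. C \<alpha> * \<epsilon> ^ mdeg \<alpha> / mfact \<alpha> * (\<Sum>b<n. u b * mpow (xs b) \<alpha>))"
    using mom finite_mdeg_le by (intro sum.mono_neutral_right) auto
  also have "\<dots> = \<epsilon> ^ s * (\<Sum>\<alpha> | mdeg \<alpha> = s. (\<Sum>b<n. u b * mpow (xs b) \<alpha>) * c \<alpha> / mfact \<alpha>)"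
    by (simp add: C_def sum_distrib_left sum_divide_distrib ac_simps)
  finally have "\<bar>(\<Sum>b<n. u b * D [] (\<epsilon> *\<^sub>R xs b)) -
      \<epsilon> ^ s * (\<Sum>\<alpha> | mdeg \<alpha> = s. (\<Sum>b<n. u b * mpow (xs b) \<alpha>) * c \<alpha> / mfact \<alpha>)\<bar> =
      \<bar>\<Sum>b<n. u b * (D [] (\<epsilon> *\<^sub>R xs b) - T b)\<bar>"
    by (simp add: sum_subtractf right_diff_distrib)
  also have "\<dots> \<le> (\<Sum>b<n. \<bar>u b\<bar> * \<bar>D [] (\<epsilon> *\<^sub>R xs b) - T b\<bar>)"
    by (rule order_trans[OF sum_abs]) (simp add: abs_mult)
  also have "\<dots> \<le> (\<Sum>b<n. \<bar>u b\<bar> * (\<eta> * (\<Sum>\<alpha> | mdeg \<alpha> = s. \<bar>mpow (\<epsilon> *\<^sub>R xs b) \<alpha>\<bar> / mfact \<alpha>)))"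
    using * by (intro sum_mono mult_left_mono) auto
  also have "\<dots> = \<eta> * \<epsilon> ^ s * (\<Sum>b<n. \<bar>u b\<bar> * (\<Sum>\<alpha> | mdeg \<alpha> = s. \<bar>mpow (xs b) \<alpha>\<bar> / mfact \<alpha>))"
    using \<epsilon> by (simp add: sum_distrib_left mpow_scale abs_mult ac_simps)
  finally show ?thesis .
qed

text \<open>In \<^const>\<open>Kder\<close> the derivatives in the second variable are innermost; hence the expansion is
  first carried out in the second variable, for the function \<open>y \<mapsto> \<Sum>b<n. u b * K (\<epsilon> x\<^sub>b) y\<close>.\<close>

lemma kernel_moment_limit:
  fixes K :: "'d::{finite,linorder} pt \<Rightarrow> 'd pt \<Rightarrow> real" and u v :: "nat \<Rightarrow> real"
  assumes \<Omega>: "open \<Omega>" "0 \<in> \<Omega>" and K: "Ckk k \<Omega> K" and st: "s \<le> k" "t \<le> k"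
    and u: "\<And>\<alpha>. mdeg \<alpha> < s \<Longrightarrow> (\<Sum>b<n. u b * mpow (xs b) \<alpha>) = 0"
    and v: "\<And>\<alpha>. mdeg \<alpha> < t \<Longrightarrow> (\<Sum>b<n. v b * mpow (xs b) \<alpha>) = 0"
  shows "((\<lambda>\<epsilon>. (\<Sum>b<n. \<Sum>b'<n. u b * v b' * K (\<epsilon> *\<^sub>R xs b) (\<epsilon> *\<^sub>R xs b')) / \<epsilon> ^ (s + t)) \<longlongrightarrow>
    (\<Sum>\<beta> | mdeg \<beta> = t. \<Sum>\<alpha> | mdeg \<alpha> = s.
       (\<Sum>b<n. u b * mpow (xs b) \<alpha>) * (\<Sum>b<n. v b * mpow (xs b) \<beta>) *
       (Kder \<alpha> \<beta> K 0 0 / (mfact \<alpha> * mfact \<beta>)))) (at_right 0)" (is "(?f \<longlongrightarrow> ?l) _")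
proof -
  define Cu where "Cu = (\<Sum>b<n. \<bar>u b\<bar> * (\<Sum>\<alpha> | mdeg \<alpha> = s. \<bar>mpow (xs b) \<alpha>\<bar> / mfact \<alpha>))"
  define Cv where "Cv = (\<Sum>b<n. \<bar>v b\<bar> * (\<Sum>\<alpha> | mdeg \<alpha> = t. \<bar>mpow (xs b) \<alpha>\<bar> / mfact \<alpha>))"
  have C0: "Cu \<ge> 0" "Cv \<ge> 0"
    unfolding Cu_def Cv_def by (auto intro!: sum_nonneg mult_nonneg_nonneg divide_nonneg_pos mfact_pos)
  have fin: "finite {\<alpha>::'d \<Rightarrow> nat. mdeg \<alpha> = s}" for s
    by (rule finite_subset[OF _ finite_mdeg_le[of s]]) auto
  have ev: "eventually (\<lambda>\<epsilon>. \<bar>?f \<epsilon> - ?l\<bar> \<le> \<eta> * (Cu * Cv)) (at_right 0)" if \<eta>: "\<eta> > 0" for \<eta>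
  proof -
    have "eventually (\<lambda>z. fst z \<in> \<Omega> \<and> snd z \<in> \<Omega> \<and> (\<forall>\<alpha>\<in>{\<alpha>. mdeg \<alpha> = s}. \<forall>\<beta>\<in>{\<beta>. mdeg \<beta> = t}. 
        \<bar>Kder \<alpha> \<beta> K (fst z) (snd z) - Kder \<alpha> \<beta> K 0 0\<bar> \<le> \<eta>)) (nhds (0, 0))"
    proof (intro eventually_conj eventually_ball_finite fin ballI)
      fix \<alpha> \<beta> :: "'d \<Rightarrow> nat" assume "\<alpha> \<in> {\<alpha>. mdeg \<alpha> = s}" "\<beta> \<in> {\<beta>. mdeg \<beta> = t}"
      then have "continuous_on (\<Omega> \<times> \<Omega>) (\<lambda>z. Kder \<alpha> \<beta> K (fst z) (snd z))"
        using K st unfolding Ckk_def by auto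
      then have "isCont (\<lambda>z. Kder \<alpha> \<beta> K (fst z) (snd z)) (0, 0)"
        using \<Omega> by (auto simp: continuous_on_eq_continuous_at open_Times)
      then have "((\<lambda>z. Kder \<alpha> \<beta> K (fst z) (snd z)) \<longlongrightarrow> Kder \<alpha> \<beta> K 0 0) (nhds (0, 0))"
        by (simp add: isCont_def tendsto_nhds_iff)
      then show "eventually (\<lambda>z. \<bar>Kder \<alpha> \<beta> K (fst z) (snd z) - Kder \<alpha> \<beta> K 0 0\<bar> \<le> \<eta>) (nhds (0, 0))"
        using \<eta> by (auto simp: tendsto_iff dist_real_def elim: eventually_mono dest!: spec[of _ \<eta>])
    next
      show "eventually (\<lambda>z. fst z \<in> \<Omega>) (nhds (0, 0))" "eventually (\<lambda>z. snd z \<in> \<Omega>) (nhds (0, 0))"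
        using \<Omega> topological_tendstoD[OF tendsto_fst[OF tendsto_ident_at, of "(0, 0)" UNIV], of \<Omega>]
          topological_tendstoD[OF tendsto_snd[OF tendsto_ident_at, of "(0, 0)" UNIV], of \<Omega>]
        by (auto simp: eventually_at_filter elim!: eventually_mono)
    qed
    then obtain d where d: "d > 0" and dist: "\<And>x y. dist (x, y) (0, 0) < d \<Longrightarrow> x \<in> \<Omega> \<and> y \<in> \<Omega> \<and>
       (\<forall>\<alpha>\<in>{\<alpha>. mdeg \<alpha> = s}. \<forall>\<beta>\<in>{\<beta>. mdeg \<beta> = t}. \<bar>Kder \<alpha> \<beta> K x y - Kder \<alpha> \<beta> K 0 0\<bar> \<le> \<eta>)"
      unfolding eventually_nhds_metric by fastforce
    \<comment> \<open>The Taylor estimate works on cubes, continuity on balls: this half side length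
      bounds each norm by \<open>d / 4\<close>, hence the distance of a pair from the origin by
      \<open>d / 2\<close>.\<close>
    define \<rho> where "\<rho> = d / (4 * real CARD('d))"
    have \<rho>: "\<rho> > 0" using d by (simp add: \<rho>_def)
    have cube: "norm x \<le> d / 4" if "\<And>l. \<bar>x $ l\<bar> \<le> \<rho>" for x :: "'d pt"
    proof -
      have "norm x \<le> (\<Sum>l\<in>UNIV. \<bar>x $ l\<bar>)" by (rule norm_le_l1_cart)
      also have "\<dots> \<le> (\<Sum>l\<in>(UNIV::'d set). \<rho>)" using that by (intro sum_mono)
      finally show ?thesis by (simp add: \<rho>_def)
    qed
    have dd: "dist (x, y) (0, 0) < d" if "\<And>l. \<bar>x $ l\<bar> \<le> \<rho>" "\<And>l. \<bar>y $ l\<bar> \<le> \<rho>" for x y :: "'d pt"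
    proof -
      have "dist (x, y) (0, 0) \<le> norm x + norm y"
        by (simp add: dist_norm norm_Pair sqrt_add_le_add_sqrt flip: zero_prod_def)
          (smt (verit) norm_ge_zero real_sqrt_abs sqrt_add_le_add_sqrt zero_le_power2)
      then show ?thesis using cube[of x] cube[of y] that d by auto
    qed
    note D = dist[OF dd]
    have z: "\<bar>(0::'d pt) $ l\<bar> \<le> \<rho>" for l using \<rho> by simp
    have "eventually (\<lambda>\<epsilon>. \<forall>b\<in>{..<n}. \<forall>l\<in>UNIV. \<bar>(\<epsilon> *\<^sub>R xs b) $ l\<bar> \<le> \<rho>) (at_right 0)"
    proof (intro eventually_ball_finite ballI)
      fix b l
      have "((\<lambda>\<epsilon>. \<bar>(\<epsilon> *\<^sub>R xs b) $ l\<bar>) \<longlongrightarrow> \<bar>(0 *\<^sub>R xs b) $ l\<bar>) (at_right 0)" by (intro tendsto_intros)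
      then show "eventually (\<lambda>\<epsilon>. \<bar>(\<epsilon> *\<^sub>R xs b) $ l\<bar> \<le> \<rho>) (at_right 0)"
        using order_tendstoD(2)[of _ _ _ \<rho>] \<rho> by (fastforce elim: eventually_mono)
    qed auto
    with eventually_at_right_less[of 0] show ?thesis
    proof eventually_elim
      fix \<epsilon> :: real assume \<epsilon>: "0 < \<epsilon>" and "\<forall>b\<in>{..<n}. \<forall>l\<in>UNIV. \<bar>(\<epsilon> *\<^sub>R xs b) $ l\<bar> \<le> \<rho>"
      then have xs: "\<bar>(\<epsilon> *\<^sub>R xs b) $ l\<bar> \<le> \<rho>" if "b < n" for b l using that by auto
      have xs\<Omega>: "\<epsilon> *\<^sub>R xs b \<in> \<Omega>" if "b < n" for b using D[OF xs[OF that] z] by auto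
      \<comment> \<open>Top-order targets of the outer expansion: the leading term, in the first
        variable, of the \<open>\<beta>\<close>-derivative. Its error
        \<open>\<eta> * \<epsilon> ^ s * Cu\<close> then plays the part of \<open>\<eta>\<close> in
        the outer estimate, so the two powers of \<open>\<epsilon>\<close> multiply.\<close>
      define c where "c = (\<lambda>\<beta>. \<epsilon> ^ s * (\<Sum>\<alpha> | mdeg \<alpha> = s. (\<Sum>b<n. u b * mpow (xs b) \<alpha>) * Kder \<alpha> \<beta> K 0 0 / mfact \<alpha>))"
      have inner: "\<bar>(\<Sum>b<n. u b * iterY (canon \<beta>) K (\<epsilon> *\<^sub>R xs b) y) - c \<beta>\<bar> \<le> \<eta> * \<epsilon> ^ s * Cu"
        if \<beta>: "mdeg \<beta> = t" and y: "\<And>l. \<bar>y $ l\<bar> \<le> \<rho>" for \<beta> y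
      proof -
        have "\<bar>(\<Sum>b<n. u b * (\<lambda>is x. iterX is (iterY (canon \<beta>) K) x y) [] (\<epsilon> *\<^sub>R xs b)) -
            \<epsilon> ^ s * (\<Sum>\<alpha> | mdeg \<alpha> = s. (\<Sum>b<n. u b * mpow (xs b) \<alpha>) * Kder \<alpha> \<beta> K 0 0 / mfact \<alpha>)\<bar> \<le> \<eta> * \<epsilon> ^ s * Cu"
          unfolding Cu_def
        proof (rule taylor_moments)
          fix i :: 'd and "is" and x :: "'d pt"
          assume *: "sorted (i # is)" "length (i # is) \<le> s" "\<And>l. \<bar>x $ l\<bar> \<le> \<rho>"
          obtain \<alpha> where "canon \<alpha> = i # is" "mdeg \<alpha> = length (i # is)" using sorted_eq_canon[OF *(1)] .
          then have "exX \<Omega> (i # is) (iterY (canon \<beta>) K)"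
            using K st \<beta> *(2) unfolding Ckk_def Kder_exists_def by (metis order_trans order_refl)
          then show "((\<lambda>t. iterX is (iterY (canon \<beta>) K) (x + t *\<^sub>R axis i 1) y) has_real_derivative
             iterX (i # is) (iterY (canon \<beta>) K) x y) (at 0)"
            using D[OF *(3) y] by (intro exX_has_derivative) auto
        next
          fix \<alpha> :: "'d \<Rightarrow> nat" and x :: "'d pt" assume "mdeg \<alpha> = s" "\<And>l. \<bar>x $ l\<bar> \<le> \<rho>"
          then show "\<bar>iterX (canon \<alpha>) (iterY (canon \<beta>) K) x y - Kder \<alpha> \<beta> K 0 0\<bar> \<le> \<eta>"
            using D[of x y] y \<beta> by (auto simp: Kder_def)
        qed (use \<epsilon> xs u in auto)
        then show ?thesis by (simp add: c_def)
      qed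
      have "\<bar>(\<Sum>b<n. v b * (\<lambda>is y. \<Sum>b'<n. u b' * iterY is K (\<epsilon> *\<^sub>R xs b') y) [] (\<epsilon> *\<^sub>R xs b)) -
            \<epsilon> ^ t * (\<Sum>\<beta> | mdeg \<beta> = t. (\<Sum>b<n. v b * mpow (xs b) \<beta>) * c \<beta> / mfact \<beta>)\<bar> \<le> (\<eta> * \<epsilon> ^ s * Cu) * \<epsilon> ^ t * Cv"
        unfolding Cv_def
      proof (rule taylor_moments)
        fix i :: 'd and "is" and y :: "'d pt"
        assume *: "sorted (i # is)" "length (i # is) \<le> t" "\<And>l. \<bar>y $ l\<bar> \<le> \<rho>"
        obtain \<beta> where "canon \<beta> = i # is" "mdeg \<beta> = length (i # is)" using sorted_eq_canon[OF *(1)] .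
        then have "exY \<Omega> (i # is) K"
          using K st *(2) unfolding Ckk_def Kder_exists_def by (metis order_trans order_refl)
        then show "((\<lambda>h. \<Sum>b'<n. u b' * iterY is K (\<epsilon> *\<^sub>R xs b') (y + h *\<^sub>R axis i 1)) has_real_derivative
             (\<Sum>b'<n. u b' * iterY (i # is) K (\<epsilon> *\<^sub>R xs b') y)) (at 0)"
          using D[OF z *(3)] xs\<Omega> by (intro DERIV_sum DERIV_cmult exY_has_derivative) auto
      qed (use \<epsilon> xs v inner in auto)
      moreover have "(\<Sum>b<n. v b * (\<Sum>b'<n. u b' * K (\<epsilon> *\<^sub>R xs b') (\<epsilon> *\<^sub>R xs b))) =
          (\<Sum>b<n. \<Sum>b'<n. u b * v b' * K (\<epsilon> *\<^sub>R xs b) (\<epsilon> *\<^sub>R xs b'))"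
        unfolding sum_distrib_left by (subst sum.swap) (simp add: ac_simps)
      moreover have "\<epsilon> ^ t * (\<Sum>\<beta> | mdeg \<beta> = t. (\<Sum>b<n. v b * mpow (xs b) \<beta>) * c \<beta> / mfact \<beta>) = \<epsilon> ^ (s + t) * ?l"
      proof -
        define mu where "mu \<alpha> = (\<Sum>b<n. u b * mpow (xs b) \<alpha>)" for \<alpha>
        define mv where "mv \<alpha> = (\<Sum>b<n. v b * mpow (xs b) \<alpha>)" for \<alpha>
        show ?thesis
          unfolding c_def mu_def[symmetric] mv_def[symmetric] sum_distrib_left sum_divide_distrib
          by (intro sum.cong refl) (simp add: power_add)
      qed
      moreover have "(\<eta> * \<epsilon> ^ s * Cu) * \<epsilon> ^ t * Cv = (\<eta> * (Cu * Cv)) * \<epsilon> ^ (s + t)"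
        by (simp add: power_add ac_simps)
      moreover have "\<bar>X / E - l\<bar> \<le> q" if "\<bar>X - E * l\<bar> \<le> q * E" "E > 0" for X E l q :: real
      proof -
        have "\<bar>X - E * l\<bar> = \<bar>X / E - l\<bar> * E" using that(2) by (simp add: field_simps abs_mult flip: abs_mult_pos)
        then show ?thesis using that by simp
      qed
      ultimately show "\<bar>?f \<epsilon> - ?l\<bar> \<le> \<eta> * (Cu * Cv)"
        using \<epsilon> by simp
    qed
  qed
  show ?thesis
  proof (rule tendstoI)
    fix e :: real assume e: "e > 0"
    \<comment> \<open>The \<open>+ 1\<close> keeps the divisor positive and the final estimate
      strict, also when \<open>Cu * Cv = 0\<close>.\<close>
    have C1: "Cu * Cv + 1 > 0" using C0 by (simp add: add_nonneg_pos)
    then have "e / (Cu * Cv + 1) > 0" using e by simp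
    from ev[OF this] show "eventually (\<lambda>\<epsilon>. dist (?f \<epsilon>) ?l < e) (at_right 0)"
    proof eventually_elim
      fix \<epsilon> assume *: "\<bar>?f \<epsilon> - ?l\<bar> \<le> e / (Cu * Cv + 1) * (Cu * Cv)"
      have "e / (Cu * Cv + 1) * (Cu * Cv) < e" using C1 e by (simp add: field_simps)
      then show "dist (?f \<epsilon>) ?l < e" using * by (simp add: dist_real_def)
    qed
  qed
qed

notation Matrix.vec_index (infixl "$" 100)

section \<open>Kernel matrices in the flat limit\<close>

lemma finite_downset_nat:
  fixes S :: "nat set"
  assumes "finite S" "\<And>a b. b \<in> S \<Longrightarrow> a \<le> b \<Longrightarrow> a \<in> S"
  shows "S = {..<card S}"
proof (cases "S = {}")
  case False
  have "S = {..Max S}" using assms False by (auto intro: Max_in)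
  then have "card S = Suc (Max S)" by (metis card_atMost)
  then show ?thesis using \<open>S = {..Max S}\<close> by (simp add: lessThan_Suc_atMost)
qed simp

section \<open>Positions and degrees in a graded enumeration\<close>

context
  fixes e :: "nat \<Rightarrow> ('d::finite \<Rightarrow> nat)"
  assumes e: "graded_enum e"
begin

lemma graded_enum_bij: "bij e" and graded_enum_mono: "a \<le> b \<Longrightarrow> mdeg (e a) \<le> mdeg (e b)"
  using e by (auto simp: graded_enum_def)

lemma bij_betw_graded_enum: "bij_betw e {a. Q (mdeg (e a))} {\<alpha>. Q (mdeg \<alpha>)}"
proof (rule bij_betw_imageI)
  show "inj_on e {a. Q (mdeg (e a))}" using graded_enum_bij by (rule inj_on_subset[OF bij_is_inj]) simp
  show "e ` {a. Q (mdeg (e a))} = {\<alpha>. Q (mdeg \<alpha>)}"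
  proof (intro equalityI subsetI)
    fix \<alpha> :: "'d \<Rightarrow> nat" assume "\<alpha> \<in> {\<alpha>. Q (mdeg \<alpha>)}"
    moreover obtain a where "\<alpha> = e a" using bij_is_surj[OF graded_enum_bij] by (rule surjE)
    ultimately show "\<alpha> \<in> e ` {a. Q (mdeg (e a))}" by auto
  qed auto
qed

text \<open>Because the order is graded, the positions of degree at most \<open>s\<close> form a
  finite down-closed set of naturals, hence an initial segment; its length is counted on the side of
  the multi-indices.\<close>

lemma less_cardP_iff: "i < cardP TYPE('d) s \<longleftrightarrow> mdeg (e i) \<le> s"
proof -
  have bb: "bij_betw e {a. mdeg (e a) \<le> s} {\<alpha>. mdeg \<alpha> \<le> s}" by (rule bij_betw_graded_enum)
  then have "finite {a. mdeg (e a) \<le> s}" using finite_mdeg_le bij_betw_finite by blast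
  then have "{a. mdeg (e a) \<le> s} = {..<card {a. mdeg (e a) \<le> s}}"
    using graded_enum_mono order_trans by (intro finite_downset_nat) blast+
  also have "card {a. mdeg (e a) \<le> s} = cardP TYPE('d) s"
    using bij_betw_same_card[OF bb] by (simp add: cardP_def)
  finally show ?thesis by blast
qed

lemma offs_le_iff: "offs TYPE('d) s \<le> i \<longleftrightarrow> s \<le> mdeg (e i)"
  using less_cardP_iff[of i "s - 1"] by (cases s) (auto simp: offs_def not_less[symmetric])

lemma degree_block: "{a. mdeg (e a) = s} = {offs TYPE('d) s..<cardP TYPE('d) s}"
  using less_cardP_iff[of _ s] offs_le_iff[of s] by auto

lemma offs_le_cardP: "offs TYPE('d) s \<le> cardP TYPE('d) s"
proof (cases s)
  case (Suc t)
  have "{\<alpha>::'d \<Rightarrow> nat. mdeg \<alpha> \<le> t} \<subseteq> {\<alpha>. mdeg \<alpha> \<le> Suc t}" by auto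
  then show ?thesis unfolding Suc offs_def cardP_def by (simp add: card_mono finite_mdeg_le)
qed (simp add: offs_def)

lemma cardH_eq: "cardH TYPE('d) s = cardP TYPE('d) s - offs TYPE('d) s"
  using bij_betw_same_card[OF bij_betw_graded_enum[of "\<lambda>t. t = s"]] degree_block[of s]
  by (simp add: cardH_def)

lemma cardP_mono: "s \<le> t \<Longrightarrow> cardP TYPE('d) s \<le> cardP TYPE('d) t"
  unfolding cardP_def by (intro card_mono finite_mdeg_le) auto

end

lemma cardH_0: "cardH TYPE('d::finite) 0 = 1"
proof -
  have "{\<alpha>::'d \<Rightarrow> nat. mdeg \<alpha> = 0} = {\<lambda>_. 0}" by (auto simp: mdeg_def)
  then show ?thesis by (simp add: cardH_def)
qed

section \<open>Setting, moments of the QR columns and spectral data\<close>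

locale kernel_setup =
  fixes \<Omega> :: "('d::{finite,linorder} pt) set"
    and K :: "'d pt \<Rightarrow> 'd pt \<Rightarrow> real"
    and k n :: nat
    and xs :: "nat \<Rightarrow> 'd pt"
    and e :: "nat \<Rightarrow> ('d \<Rightarrow> nat)"
    and \<epsilon>0 :: real
    and lam :: "nat \<Rightarrow> real \<Rightarrow> real"
    and P :: "nat \<Rightarrow> real \<Rightarrow> real mat"
    and p :: "nat \<Rightarrow> real vec"
    and Qf R :: "real mat"
  assumes \<Omega>: "open \<Omega>" "0 \<in> \<Omega>"
    and k: "k \<ge> 1"
    and K: "Ckk (k + 1) \<Omega> K"
    and e: "graded_enum e"
    and n: "cardP TYPE('d) (k - 1) < n" "n \<le> cardP TYPE('d) k"
    and \<epsilon>0: "\<epsilon>0 > 0"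
    and psd: "\<forall>\<epsilon>\<in>{0..\<epsilon>0}. sym_mat (Kmat K xs n \<epsilon>) \<and> psd_mat (Kmat K xs n \<epsilon>)"
    and eig: "analytic_eig K xs n lam P"
    and p: "\<forall>i<n. limiting_eigvec n (P i) (p i)"
    and QR: "full_QR (Vle e xs n (k - 1)) Qf R"
begin

text \<open>\<open>r = Qf\<^sup>T V\<close> extends \<open>R\<close> to all degrees, \<open>M = Qf\<^sup>T K\<^sub>\<epsilon> Qf\<close>, and \<open>X\<close> consists of the inner products of
  the columns of \<open>Qf\<close> with the limiting eigenvectors.\<close>

abbreviation "g i \<equiv> mdeg (e i)"

definition "r i a = (\<Sum>b<n. Qf $$ (b, i) * mpow (xs b) (e a))"

text \<open>Indexed by positions without a bound, so that every \<open>Wr e K s\<close> is a corner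
  of one infinite array.\<close>

definition "W a b = Kder (e a) (e b) K 0 0 / (mfact (e a) * mfact (e b))"

text \<open>Only moments of a column's own degree survive the scaling: those of lower degree vanish,
  those of higher degree carry further powers of \<open>\<epsilon>\<close>.\<close>

definition "G i j = (\<Sum>b | g b = g j. \<Sum>a | g a = g i. r i a * W a b * r j b)"

definition "M \<epsilon> j l = (\<Sum>b<n. \<Sum>b'<n. Qf $$ (b, j) * Qf $$ (b', l) * K (\<epsilon> *\<^sub>R xs b) (\<epsilon> *\<^sub>R xs b'))"

definition "X j i = (\<Sum>a<n. Qf $$ (a, j) * p i $ a)"

lemma Qf: "Qf \<in> carrier_mat n n" "transpose_mat Qf * Qf = 1\<^sub>m n" "Qf * transpose_mat Qf = 1\<^sub>m n"
  using QR by (auto simp: full_QR_def Vle_def)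

lemma g_le: "i < n \<Longrightarrow> g i \<le> k"
  using n(2) less_cardP_iff[OF e, of i k] by simp

lemma r_index: "i < n \<Longrightarrow> a < cardP TYPE('d) s \<Longrightarrow> (transpose_mat Qf * Vle e xs n s) $$ (i, a) = r i a"
  using Qf by (simp add: r_def Vle_def scalar_prod_def atLeast0LessThan)

text \<open>\<open>Qf^T V\<close> is \<open>R\<close> on top of zero rows. Rows of \<open>R\<close>
  vanish left of the diagonal and the rows below \<open>R\<close> vanish entirely, so the last block
  is covered as well.\<close>

lemma r_upper:
  assumes i: "i < n" and a: "a < i" "a < cardP TYPE('d) (k - 1)"
  shows "r i a = 0"
proof -
  let ?c = "cardP TYPE('d) (k - 1)"
  let ?R = "R @\<^sub>r 0\<^sub>m (n - ?c) ?c"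
  have R: "R \<in> carrier_mat ?c ?c" "upper_triangular R" and V: "Vle e xs n (k - 1) = Qf * ?R"
    using QR by (auto simp: full_QR_def Vle_def)
  have R': "?R \<in> carrier_mat n ?c" using carrier_append_rows[OF R(1) zero_carrier_mat[of "n - ?c" ?c]] n(1) by simp
  have "transpose_mat Qf * Vle e xs n (k - 1) = (transpose_mat Qf * Qf) * ?R"
    unfolding V using Qf R' by (intro assoc_mult_mat[symmetric]) auto
  then have "r i a = ?R $$ (i, a)" using r_index[OF i a(2)] Qf(2) R' by simp
  also have "\<dots> = (if i < ?c then R $$ (i, a) else 0)"
    using i a R n(1) by (simp add: append_rows_def)
  finally show ?thesis using R a by (auto simp: upper_triangular_def)
qed

text \<open>Lower degree means an earlier position, by gradedness, and since no \<open>g i\<close>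
  exceeds \<open>k\<close> it also means a column of the factorised matrix, where
  \<open>r_upper\<close> applies. In this form triangularity supplies the moment hypotheses of the
  Taylor lemmas.\<close>

lemma r_zero: "i < n \<Longrightarrow> g a < g i \<Longrightarrow> r i a = 0"
proof -
  assume i: "i < n" and a: "g a < g i"
  then have "a < i" using graded_enum_mono[OF e, of i a] by (simp add: not_le[symmetric]) (metis linorder_not_less)
  moreover have "g a \<le> k - 1" using g_le[OF i] a by simp
  ultimately show "r i a = 0" using r_upper[OF i] less_cardP_iff[OF e] by simp
qed

lemma M_tendsto:
  assumes "i < n" "j < n"
  shows "((\<lambda>\<epsilon>. M \<epsilon> i j / \<epsilon> ^ (g i + g j)) \<longlongrightarrow> G i j) (at_right 0)"
proof -
  have mom: "(\<Sum>b<n. Qf $$ (b, i) * mpow (xs b) \<alpha>) = 0" if "i < n" "mdeg \<alpha> < g i" for i \<alpha>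
  proof -
    obtain a where "\<alpha> = e a" using bij_is_surj[OF graded_enum_bij[OF e]] by (rule surjE)
    then show ?thesis using r_zero[of i a] that by (simp add: r_def)
  qed
  have "((\<lambda>\<epsilon>. M \<epsilon> i j / \<epsilon> ^ (g i + g j)) \<longlongrightarrow> (\<Sum>\<beta> | mdeg \<beta> = g j. \<Sum>\<alpha> | mdeg \<alpha> = g i.
       (\<Sum>b<n. Qf $$ (b, i) * mpow (xs b) \<alpha>) * (\<Sum>b<n. Qf $$ (b, j) * mpow (xs b) \<beta>) *
       (Kder \<alpha> \<beta> K 0 0 / (mfact \<alpha> * mfact \<beta>)))) (at_right 0)"
    unfolding M_def using assms mom g_le[OF assms(1)] g_le[OF assms(2)]
    by (intro kernel_moment_limit[OF \<Omega> K]) auto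
  also have "(\<Sum>\<beta> | mdeg \<beta> = g j. \<Sum>\<alpha> | mdeg \<alpha> = g i.
       (\<Sum>b<n. Qf $$ (b, i) * mpow (xs b) \<alpha>) * (\<Sum>b<n. Qf $$ (b, j) * mpow (xs b) \<beta>) *
       (Kder \<alpha> \<beta> K 0 0 / (mfact \<alpha> * mfact \<beta>))) = G i j"
    unfolding G_def r_def W_def
    by (subst sum.reindex_bij_betw[OF bij_betw_graded_enum[OF e, of "\<lambda>t. t = g j"], symmetric],
        rule sum.cong[OF refl],
        subst sum.reindex_bij_betw[OF bij_betw_graded_enum[OF e, of "\<lambda>t. t = g i"], symmetric],
        rule sum.cong[OF refl]) (simp add: ac_simps)
  finally show ?thesis .
qed

text \<open>The body of \<^const>\<open>analytic_eig\<close> for a given radius.\<close>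

definition "eigdec \<delta> \<longleftrightarrow> 0 < \<delta> \<and> (\<forall>i<n. analytic_near0 (lam i)) \<and>
     (\<forall>i<n. \<forall>a<n. \<forall>b<n. analytic_near0 (\<lambda>\<epsilon>. P i \<epsilon> $$ (a, b))) \<and>
     (\<forall>\<epsilon>. \<bar>\<epsilon>\<bar> < \<delta> \<longrightarrow>
        (\<forall>i<n. P i \<epsilon> \<in> carrier_mat n n \<and> P i \<epsilon> * P i \<epsilon> = P i \<epsilon> \<and>
               transpose_mat (P i \<epsilon>) = P i \<epsilon> \<and> vec_space.rank n (P i \<epsilon>) = 1) \<and>
        (\<forall>i<n. \<forall>j<n. i \<noteq> j \<longrightarrow> P i \<epsilon> * P j \<epsilon> = 0\<^sub>m n n) \<and>
        (\<forall>a<n. \<forall>b<n. Kmat K xs n \<epsilon> $$ (a, b) = (\<Sum>i<n. lam i \<epsilon> * P i \<epsilon> $$ (a, b)))) \<and>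
     (\<forall>\<epsilon>. 0 < \<epsilon> \<and> \<epsilon> < \<delta> \<longrightarrow> (\<forall>i j. i \<le> j \<and> j < n \<longrightarrow> lam j \<epsilon> \<le> lam i \<epsilon>))"

lemma eigdec_ex: "\<exists>\<delta>. eigdec \<delta>"
  unfolding eigdec_def using eig unfolding analytic_eig_def .

lemma eigdecD:
  assumes D: "eigdec \<delta>"
  shows "\<delta> > 0" "i < n \<Longrightarrow> analytic_near0 (lam i)"
    "i < n \<Longrightarrow> a < n \<Longrightarrow> b < n \<Longrightarrow> analytic_near0 (\<lambda>\<epsilon>. P i \<epsilon> $$ (a, b))"
    "\<bar>\<epsilon>\<bar> < \<delta> \<Longrightarrow> i < n \<Longrightarrow> P i \<epsilon> \<in> carrier_mat n n"
    "\<bar>\<epsilon>\<bar> < \<delta> \<Longrightarrow> i < n \<Longrightarrow> P i \<epsilon> * P i \<epsilon> = P i \<epsilon>"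
    "\<bar>\<epsilon>\<bar> < \<delta> \<Longrightarrow> i < n \<Longrightarrow> transpose_mat (P i \<epsilon>) = P i \<epsilon>"
    "\<bar>\<epsilon>\<bar> < \<delta> \<Longrightarrow> i < n \<Longrightarrow> P i \<epsilon> \<noteq> 0\<^sub>m n n"
    "\<bar>\<epsilon>\<bar> < \<delta> \<Longrightarrow> i < n \<Longrightarrow> j < n \<Longrightarrow> i \<noteq> j \<Longrightarrow> P i \<epsilon> * P j \<epsilon> = 0\<^sub>m n n"
    "\<bar>\<epsilon>\<bar> < \<delta> \<Longrightarrow> a < n \<Longrightarrow> b < n \<Longrightarrow> Kmat K xs n \<epsilon> $$ (a, b) = (\<Sum>i<n. lam i \<epsilon> * P i \<epsilon> $$ (a, b))"
    "0 < \<epsilon> \<Longrightarrow> \<epsilon> < \<delta> \<Longrightarrow> i \<le> j \<Longrightarrow> j < n \<Longrightarrow> lam j \<epsilon> \<le> lam i \<epsilon>"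
proof -
  note D' = D[unfolded eigdec_def]
  note c = D'[THEN conjunct2, THEN conjunct2, THEN conjunct2, THEN conjunct1, THEN spec, THEN mp]
  show "\<delta> > 0" by (rule D'[THEN conjunct1])
  show "analytic_near0 (lam i)" if "i < n"
    by (rule D'[THEN conjunct2, THEN conjunct1, THEN spec, THEN mp, OF that])
  show "analytic_near0 (\<lambda>\<epsilon>. P i \<epsilon> $$ (a, b))" if "i < n" "a < n" "b < n"
    by (rule D'[THEN conjunct2, THEN conjunct2, THEN conjunct1, rule_format, OF that])
  show "P i \<epsilon> \<in> carrier_mat n n" "P i \<epsilon> * P i \<epsilon> = P i \<epsilon>" "transpose_mat (P i \<epsilon>) = P i \<epsilon>" "P i \<epsilon> \<noteq> 0\<^sub>m n n"
    if "\<bar>\<epsilon>\<bar> < \<delta>" "i < n"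
  proof -
    have *: "P i \<epsilon> \<in> carrier_mat n n \<and> P i \<epsilon> * P i \<epsilon> = P i \<epsilon> \<and>
               transpose_mat (P i \<epsilon>) = P i \<epsilon> \<and> vec_space.rank n (P i \<epsilon>) = 1"
      by (rule c[OF that(1), THEN conjunct1, THEN spec, THEN mp, OF that(2)])
    then show "P i \<epsilon> \<in> carrier_mat n n" "P i \<epsilon> * P i \<epsilon> = P i \<epsilon>" "transpose_mat (P i \<epsilon>) = P i \<epsilon>"
      by simp_all
    have "vec_space.rank n (P i \<epsilon>) = 1" using * by simp
    then show "P i \<epsilon> \<noteq> 0\<^sub>m n n" using vec_space.rank_0I[of n n, where ?'a = real] by auto
  qed
  show "P i \<epsilon> * P j \<epsilon> = 0\<^sub>m n n" if "\<bar>\<epsilon>\<bar> < \<delta>" "i < n" "j < n" "i \<noteq> j"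
    by (rule c[OF that(1), THEN conjunct2, THEN conjunct1, rule_format, OF that(2-)])
  show "Kmat K xs n \<epsilon> $$ (a, b) = (\<Sum>i<n. lam i \<epsilon> * P i \<epsilon> $$ (a, b))" if "\<bar>\<epsilon>\<bar> < \<delta>" "a < n" "b < n"
    by (rule c[OF that(1), THEN conjunct2, THEN conjunct2, rule_format, OF that(2-)])
  show "lam j \<epsilon> \<le> lam i \<epsilon>" if "0 < \<epsilon>" "\<epsilon> < \<delta>" "i \<le> j" "j < n"
    by (rule D'[THEN conjunct2, THEN conjunct2, THEN conjunct2, THEN conjunct2, THEN spec, THEN mp, OF conjI, OF that(1,2),
      THEN spec, THEN spec, THEN mp, OF conjI, OF that(3,4)])
qed

text \<open>\<open>Z\<close> comes from choosing an eigenbasis for each \<open>\<epsilon>\<close>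
  separately, so its entries need not vary continuously. The squared entries are
  \<open>Q_j^T P_i Q_j\<close>, and these converge because the projectors are analytic.\<close>

lemma spectral_data:
  shows "\<exists>Z. flat_limit n g lam Z M G \<and>
    (\<forall>i<n. \<forall>j<n. ((\<lambda>\<epsilon>. (Z \<epsilon> j i)\<^sup>2) \<longlongrightarrow> (X j i)\<^sup>2) (at_right 0))"
proof -
  obtain \<delta> where D: "eigdec \<delta>" using eigdec_ex ..
  note \<delta> = eigdecD(1)[OF D]
  define eb where "eb \<epsilon> U \<longleftrightarrow> U \<in> carrier_mat n n \<and> transpose_mat U * U = 1\<^sub>m n \<and> U * transpose_mat U = 1\<^sub>m n \<and>
    (\<forall>i<n. \<forall>a<n. \<forall>b<n. P i \<epsilon> $$ (a, b) = U $$ (a, i) * U $$ (b, i))" for \<epsilon> U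
  have "\<exists>U. eb \<epsilon> U" if "\<bar>\<epsilon>\<bar> < \<delta>" for \<epsilon>
    unfolding eb_def Bex_def[symmetric]
    by (rule orthogonal_projectors_eigenbasis) (rule eigdecD(4-8)[OF D that], assumption+)+
  then have "\<forall>\<epsilon>. \<exists>U. \<bar>\<epsilon>\<bar> < \<delta> \<longrightarrow> eb \<epsilon> U" by blast
  then obtain U where "\<forall>\<epsilon>. \<bar>\<epsilon>\<bar> < \<delta> \<longrightarrow> eb \<epsilon> (U \<epsilon>)" by (rule choice[THEN exE])
  then have U: "\<And>\<epsilon>. \<bar>\<epsilon>\<bar> < \<delta> \<Longrightarrow> U \<epsilon> \<in> carrier_mat n n"
      "\<And>\<epsilon>. \<bar>\<epsilon>\<bar> < \<delta> \<Longrightarrow> transpose_mat (U \<epsilon>) * U \<epsilon> = 1\<^sub>m n"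
      "\<And>\<epsilon>. \<bar>\<epsilon>\<bar> < \<delta> \<Longrightarrow> U \<epsilon> * transpose_mat (U \<epsilon>) = 1\<^sub>m n"
    and PU: "\<And>\<epsilon> i a b. \<bar>\<epsilon>\<bar> < \<delta> \<Longrightarrow> i < n \<Longrightarrow> a < n \<Longrightarrow> b < n \<Longrightarrow> P i \<epsilon> $$ (a, b) = U \<epsilon> $$ (a, i) * U \<epsilon> $$ (b, i)"
    unfolding eb_def by auto
  define Z where "Z \<epsilon> j i = (\<Sum>a<n. Qf $$ (a, j) * U \<epsilon> $$ (a, i))" for \<epsilon> j i
  define Zm where "Zm \<epsilon> = transpose_mat Qf * U \<epsilon>" for \<epsilon>
  have Zm: "Zm \<epsilon> \<in> carrier_mat n n" "transpose_mat (Zm \<epsilon>) * Zm \<epsilon> = 1\<^sub>m n" "Zm \<epsilon> * transpose_mat (Zm \<epsilon>) = 1\<^sub>m n"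
    if "\<bar>\<epsilon>\<bar> < \<delta>" for \<epsilon>
  proof -
    show c: "Zm \<epsilon> \<in> carrier_mat n n" using U[OF that] Qf by (simp add: Zm_def)
    have t: "transpose_mat (Zm \<epsilon>) = transpose_mat (U \<epsilon>) * Qf"
      unfolding Zm_def using U[OF that] Qf by (subst transpose_mult[of _ n n]) auto
    have "Zm \<epsilon> * transpose_mat (Zm \<epsilon>) = transpose_mat Qf * (U \<epsilon> * (transpose_mat (U \<epsilon>) * Qf))"
      unfolding t unfolding Zm_def using U[OF that] Qf by (intro assoc_mult_mat[of _ n n _ n _ n]) auto
    also have "U \<epsilon> * (transpose_mat (U \<epsilon>) * Qf) = (U \<epsilon> * transpose_mat (U \<epsilon>)) * Qf"
      using U[OF that] Qf by (intro assoc_mult_mat[of _ n n _ n _ n, symmetric]) auto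
    finally show 1: "Zm \<epsilon> * transpose_mat (Zm \<epsilon>) = 1\<^sub>m n" using U[OF that] Qf by simp
    show "transpose_mat (Zm \<epsilon>) * Zm \<epsilon> = 1\<^sub>m n" using mat_mult_left_right_inverse[OF c _ 1] c by simp
  qed
  have ZZm: "Zm \<epsilon> $$ (j, i) = Z \<epsilon> j i" if "\<bar>\<epsilon>\<bar> < \<delta>" "j < n" "i < n" for \<epsilon> j i
    using U(1)[OF that(1)] Qf(1) that by (simp add: Zm_def Z_def scalar_prod_def atLeast0LessThan)
  have KU: "K (\<epsilon> *\<^sub>R xs a) (\<epsilon> *\<^sub>R xs b) = (\<Sum>i<n. lam i \<epsilon> * (U \<epsilon> $$ (a, i) * U \<epsilon> $$ (b, i)))"
    if "\<bar>\<epsilon>\<bar> < \<delta>" "a < n" "b < n" for \<epsilon> a b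
  proof -
    have "K (\<epsilon> *\<^sub>R xs a) (\<epsilon> *\<^sub>R xs b) = Kmat K xs n \<epsilon> $$ (a, b)" using that by (simp add: Kmat_def)
    also have "\<dots> = (\<Sum>i<n. lam i \<epsilon> * P i \<epsilon> $$ (a, b))" by (rule eigdecD(9)[OF D that])
    finally show ?thesis using PU that by simp
  qed
  \<comment> \<open>Column \<open>i\<close> of \<open>U\<close> is a unit eigenvector for
    \<open>lam i\<close>, so the quadratic form of the kernel matrix takes the value
    \<open>lam i\<close> on it.\<close>
  have nonneg: "0 \<le> lam i \<epsilon>" if "\<bar>\<epsilon>\<bar> < \<delta>" "0 \<le> \<epsilon>" "\<epsilon> \<le> \<epsilon>0" "i < n" for \<epsilon> i
  proof -
    let ?v = "col (U \<epsilon>) i"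
    have v: "?v \<in> carrier_vec n" using U(1)[OF that(1)] that(4) by simp
    have "Kmat K xs n \<epsilon> *\<^sub>v ?v = lam i \<epsilon> \<cdot>\<^sub>v ?v"
    proof (rule eq_vecI)
      fix a assume "a < dim_vec (lam i \<epsilon> \<cdot>\<^sub>v ?v)"
      then have a: "a < n" using U(1)[OF that(1)] by simp
      have "(Kmat K xs n \<epsilon> *\<^sub>v ?v) $ a = (\<Sum>b<n. K (\<epsilon> *\<^sub>R xs a) (\<epsilon> *\<^sub>R xs b) * U \<epsilon> $$ (b, i))"
        using a U(1)[OF that(1)] that(4) by (simp add: Kmat_def scalar_prod_def atLeast0LessThan)
      also have "\<dots> = (\<Sum>b<n. \<Sum>l<n. lam l \<epsilon> * U \<epsilon> $$ (a, l) * (U \<epsilon> $$ (b, l) * U \<epsilon> $$ (b, i)))"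
        using KU[OF that(1) a] by (intro sum.cong) (auto simp: sum_distrib_left ac_simps)
      also have "\<dots> = (\<Sum>l<n. lam l \<epsilon> * U \<epsilon> $$ (a, l) * (\<Sum>b<n. U \<epsilon> $$ (b, l) * U \<epsilon> $$ (b, i)))"
        by (subst sum.swap) (simp add: sum_distrib_left)
      also have "\<dots> = (\<Sum>l<n. if l = i then lam i \<epsilon> * U \<epsilon> $$ (a, i) else 0)"
        using orthogonal_matD(1)[OF U(1,2)[OF that(1)] _ that(4)] by (intro sum.cong) auto
      also have "\<dots> = (lam i \<epsilon> \<cdot>\<^sub>v ?v) $ a" using that(4) a U(1)[OF that(1)] by simp
      finally show "(Kmat K xs n \<epsilon> *\<^sub>v ?v) $ a = (lam i \<epsilon> \<cdot>\<^sub>v ?v) $ a" .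
    qed (use U(1)[OF that(1)] in \<open>simp add: Kmat_def\<close>)
    moreover have "scalar_prod ?v ?v = 1"
      using orthogonal_matD(1)[OF U(1,2)[OF that(1)] that(4,4)] U(1)[OF that(1)] that(4)
      by (simp add: scalar_prod_def atLeast0LessThan)
    moreover have "0 \<le> scalar_prod ?v (Kmat K xs n \<epsilon> *\<^sub>v ?v)"
      using psd that v unfolding psd_mat_def by (auto simp: Kmat_def)
    ultimately show ?thesis using v by simp
  qed
  have ev: "eventually (\<lambda>\<epsilon>. 0 < \<epsilon> \<and> \<epsilon> < \<delta> \<and> \<epsilon> < \<epsilon>0) (at_right 0)"
    using \<delta> \<epsilon>0 by (intro eventually_at_rightI[of 0 "min \<delta> \<epsilon>0"]) auto
  have "flat_limit n g lam Z M G"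
  proof
    show "g i \<le> g j" if "i \<le> j" for i j by (rule graded_enum_mono[OF e that])
    show "eventually (\<lambda>\<epsilon>. \<forall>i<n. (\<Sum>j<n. Z \<epsilon> j i * Z \<epsilon> j i) = 1) (at_right 0)"
      using ev
    proof eventually_elim
      case (elim \<epsilon>)
      then have \<epsilon>: "\<bar>\<epsilon>\<bar> < \<delta>" by simp
      show ?case using orthogonal_matD(1)[OF Zm(1,2)[OF \<epsilon>]] by (simp add: ZZm[OF \<epsilon>])
    qed
    show "eventually (\<lambda>\<epsilon>. \<forall>j<n. \<forall>l<n. (\<Sum>i<n. Z \<epsilon> j i * Z \<epsilon> l i) = (if j = l then 1 else 0)) (at_right 0)"
      using ev
    proof eventually_elim
      case (elim \<epsilon>)
      then have \<epsilon>: "\<bar>\<epsilon>\<bar> < \<delta>" by simp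
      show ?case using orthogonal_matD(2)[OF Zm(1,3)[OF \<epsilon>]] by (simp add: ZZm[OF \<epsilon>])
    qed
    show "eventually (\<lambda>\<epsilon>. \<forall>j<n. \<forall>l<n. M \<epsilon> j l = (\<Sum>i<n. lam i \<epsilon> * Z \<epsilon> j i * Z \<epsilon> l i)) (at_right 0)"
      using ev
    proof eventually_elim
      case (elim \<epsilon>)
      then have \<epsilon>: "\<bar>\<epsilon>\<bar> < \<delta>" by simp
      have "M \<epsilon> j l = (\<Sum>i<n. lam i \<epsilon> * Z \<epsilon> j i * Z \<epsilon> l i)" if "j < n" "l < n" for j l
      proof -
        have "M \<epsilon> j l = (\<Sum>b<n. \<Sum>b'<n. \<Sum>i<n. lam i \<epsilon> * (Qf $$ (b, j) * U \<epsilon> $$ (b, i)) * (Qf $$ (b', l) * U \<epsilon> $$ (b', i)))"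
          unfolding M_def by (intro sum.cong refl) (simp add: KU[OF \<epsilon>] sum_distrib_left ac_simps)
        also have "\<dots> = (\<Sum>b<n. \<Sum>i<n. \<Sum>b'<n. lam i \<epsilon> * (Qf $$ (b, j) * U \<epsilon> $$ (b, i)) * (Qf $$ (b', l) * U \<epsilon> $$ (b', i)))"
          by (intro sum.cong refl sum.swap)
        also have "\<dots> = (\<Sum>i<n. \<Sum>b<n. \<Sum>b'<n. lam i \<epsilon> * (Qf $$ (b, j) * U \<epsilon> $$ (b, i)) * (Qf $$ (b', l) * U \<epsilon> $$ (b', i)))"
          by (rule sum.swap)
        also have "\<dots> = (\<Sum>i<n. lam i \<epsilon> * Z \<epsilon> j i * Z \<epsilon> l i)"
          unfolding Z_def by (intro sum.cong refl) (simp add: sum_distrib_left sum_distrib_right ac_simps)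
        finally show ?thesis .
      qed
      then show ?case by blast
    qed
    show "eventually (\<lambda>\<epsilon>. \<forall>i<n. 0 \<le> lam i \<epsilon>) (at_right 0)"
      using ev by eventually_elim (use nonneg in auto)
    show "eventually (\<lambda>\<epsilon>. \<forall>i j. i \<le> j \<and> j < n \<longrightarrow> lam j \<epsilon> \<le> lam i \<epsilon>) (at_right 0)"
      using ev by eventually_elim (use eigdecD(10)[OF D] in blast)
  qed (rule M_tendsto)
  moreover have "((\<lambda>\<epsilon>. (Z \<epsilon> j i)\<^sup>2) \<longlongrightarrow> (X j i)\<^sup>2) (at_right 0)" if ij: "i < n" "j < n" for i j
  proof -
    have 1: "((\<lambda>\<epsilon>. \<Sum>a<n. \<Sum>b<n. Qf $$ (a, j) * Qf $$ (b, j) * P i \<epsilon> $$ (a, b)) \<longlongrightarrow>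
      (\<Sum>a<n. \<Sum>b<n. Qf $$ (a, j) * Qf $$ (b, j) * P i 0 $$ (a, b))) (at_right 0)"
      using eigdecD(3)[OF D] ij(1) by (intro tendsto_intros analytic_near0_tendsto) auto
    have 3: "(\<Sum>a<n. \<Sum>b<n. Qf $$ (a, j) * Qf $$ (b, j) * P i 0 $$ (a, b)) = (X j i)\<^sup>2"
    proof -
      have "P i 0 = mat n n (\<lambda>(a, b). p i $ a * p i $ b)" using p ij by (simp add: limiting_eigvec_def)
      then show ?thesis by (simp add: X_def power2_eq_square sum_product ac_simps)
    qed
    have 2: "eventually (\<lambda>\<epsilon>. (\<Sum>a<n. \<Sum>b<n. Qf $$ (a, j) * Qf $$ (b, j) * P i \<epsilon> $$ (a, b)) = (Z \<epsilon> j i)\<^sup>2) (at_right 0)"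
      using ev
    proof eventually_elim
      case (elim \<epsilon>)
      then show ?case using PU[of \<epsilon> i] ij by (simp add: Z_def power2_eq_square sum_product ac_simps)
    qed
    show ?thesis using Lim_transform_eventually[OF 1 2] unfolding 3 .
  qed
  ultimately show ?thesis by blast
qed

text \<open>Not inherited from \<open>Z\<close>, of which only squared entries are known to
  converge. The projector relations also hold at \<open>\<epsilon> = 0\<close>, and each
  \<open>p i\<close> is a unit vector fixed by its limit projector.\<close>

lemma X_orthogonal:
  shows "i < n \<Longrightarrow> l < n \<Longrightarrow> (\<Sum>j<n. X j i * X j l) = (if i = l then 1 else 0)"
    and "j < n \<Longrightarrow> l < n \<Longrightarrow> (\<Sum>i<n. X j i * X l i) = (if j = l then 1 else 0)"
proof -
  obtain \<delta> where D: "eigdec \<delta>" using eigdec_ex ..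
  have 0: "\<bar>0\<bar> < \<delta>" using eigdecD(1)[OF D] by simp
  have p': "p i \<in> carrier_vec n" "scalar_prod (p i) (p i) = 1" "P i 0 = mat n n (\<lambda>(a, b). p i $ a * p i $ b)"
    if "i < n" for i using p that by (auto simp: limiting_eigvec_def)
  have "P i 0 *\<^sub>v p i = p i" if i: "i < n" for i
  proof (rule eq_vecI)
    fix a assume "a < dim_vec (p i)"
    then have a: "a < n" using p'(1)[OF i] by simp
    have "(P i 0 *\<^sub>v p i) $ a = (\<Sum>b<n. p i $ a * (p i $ b * p i $ b))"
      using a p'(1)[OF i] by (simp add: p'(3)[OF i] scalar_prod_def atLeast0LessThan ac_simps)
    also have "\<dots> = p i $ a * scalar_prod (p i) (p i)"
      using p'(1)[OF i] by (simp add: scalar_prod_def sum_distrib_left atLeast0LessThan)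
    finally show "(P i 0 *\<^sub>v p i) $ a = p i $ a" using p'(2)[OF i] by simp
  qed (use p'[OF i] carrier_vecD[OF p'(1)[OF i]] in simp)
  then have orth: "transpose_mat (mat n n (\<lambda>(a, i). p i $ a)) * mat n n (\<lambda>(a, i). p i $ a) = 1\<^sub>m n"
     "mat n n (\<lambda>(a, i). p i $ a) * transpose_mat (mat n n (\<lambda>(a, i). p i $ a)) = 1\<^sub>m n"
    using projector_range_vectors_orthogonal[of n "\<lambda>i. P i 0" p, OF eigdecD(4,6,8)[OF D 0]] p' by auto
  define U where "U = mat n n (\<lambda>(a, i). p i $ a)"
  have U: "U \<in> carrier_mat n n" "transpose_mat U * U = 1\<^sub>m n" "U * transpose_mat U = 1\<^sub>m n"
    using orth by (auto simp: U_def)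
  define Xm where "Xm = transpose_mat Qf * U"
  have c: "Xm \<in> carrier_mat n n" using U Qf by (simp add: Xm_def)
  have t: "transpose_mat Xm = transpose_mat U * Qf"
    unfolding Xm_def using U Qf by (subst transpose_mult[of _ n n]) auto
  have "Xm * transpose_mat Xm = transpose_mat Qf * (U * (transpose_mat U * Qf))"
    unfolding t unfolding Xm_def using U Qf by (intro assoc_mult_mat[of _ n n _ n _ n]) auto
  also have "U * (transpose_mat U * Qf) = (U * transpose_mat U) * Qf"
    using U Qf by (intro assoc_mult_mat[of _ n n _ n _ n, symmetric]) auto
  finally have 1: "Xm * transpose_mat Xm = 1\<^sub>m n" using U Qf by simp
  have 2: "transpose_mat Xm * Xm = 1\<^sub>m n" using mat_mult_left_right_inverse[OF c _ 1] c by simp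
  have Xm: "Xm $$ (j, i) = X j i" if "j < n" "i < n" for j i
    using Qf(1) that by (simp add: Xm_def U_def X_def scalar_prod_def atLeast0LessThan)
  show "(\<Sum>j<n. X j i * X j l) = (if i = l then 1 else 0)" if "i < n" "l < n"
    using orthogonal_matD(1)[OF c 2 that] Xm that by simp
  show "(\<Sum>i<n. X j i * X l i) = (if j = l then 1 else 0)" if "j < n" "l < n"
    using orthogonal_matD(2)[OF c 1 that] Xm that by simp
qed

end

section \<open>Splitting determinants and products by degree\<close>

lemma triple_product_index:
  fixes X Y Z :: "real mat"
  assumes "X \<in> carrier_mat nr a" "Y \<in> carrier_mat a b" "Z \<in> carrier_mat nc b" "i < nr" "j < nc"
  shows "(X * Y * transpose_mat Z) $$ (i, j) = (\<Sum>q<b. \<Sum>p<a. X $$ (i, p) * Y $$ (p, q) * Z $$ (j, q))"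
  using assms by (simp add: scalar_prod_def atLeast0LessThan sum_distrib_left mult.assoc) (rule sum.swap)

text \<open>Positions come ordered by degree: \<open>m\<close> below \<open>s\<close>,
  \<open>q\<close> of degree \<open>s\<close>, the rest above. On the rest the matrix is
  \<open>x\<close> times the identity and decouples, which produces the power of \<open>x\<close>;
  on the first \<open>m\<close> positions \<open>x\<close> is absent.\<close>

lemma det_block_form:
  fixes A B C F :: "real mat" and g :: "nat \<Rightarrow> nat"
  assumes A: "A \<in> carrier_mat m m" and B: "B \<in> carrier_mat m q" and C: "C \<in> carrier_mat q m" and F: "F \<in> carrier_mat q q"
    and mq: "m + q \<le> n" and g1: "\<And>i. i < n \<Longrightarrow> g i < s \<longleftrightarrow> i < m" and g2: "\<And>i. i < n \<Longrightarrow> g i \<le> s \<longleftrightarrow> i < m + q"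
    and eA: "\<And>i j. i < m \<Longrightarrow> j < m \<Longrightarrow> A $$ (i, j) = G i j"
    and eB: "\<And>i j. i < m \<Longrightarrow> j < q \<Longrightarrow> B $$ (i, j) = G i (m + j)"
    and eC: "\<And>i j. i < q \<Longrightarrow> j < m \<Longrightarrow> C $$ (i, j) = G (m + i) j"
    and eF: "\<And>i j. i < q \<Longrightarrow> j < q \<Longrightarrow> F $$ (i, j) = G (m + i) (m + j)"
  shows "det (mat n n (\<lambda>(i, j). (if i = j \<and> s \<le> g i then x else 0) - (if g i \<le> s \<and> g j \<le> s then G i j else 0))) =
    det (four_block_mat (- A) (- B) (- C) (x \<cdot>\<^sub>m 1\<^sub>m q - F)) * x ^ (n - m - q)" (is "det ?N = _")
proof -
  define c where "c = n - m - q"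
  have n: "n = m + q + c" using mq by (simp add: c_def)
  define I where "I = four_block_mat (- A) (- B) (- C) (x \<cdot>\<^sub>m 1\<^sub>m q - F)"
  have xF: "x \<cdot>\<^sub>m 1\<^sub>m q - F \<in> carrier_mat q q" using F by (rule minus_carrier_mat)
  have I: "I \<in> carrier_mat (m + q) (m + q)" unfolding I_def using A xF by (intro four_block_carrier_mat) auto
  have Ie: "I $$ (i, j) = (if i = j \<and> m \<le> i then x else 0) - G i j" if ij: "i < m + q" "j < m + q" for i j
    using ij A B C F eA[of i j] eB[of i "j - m"] eC[of "i - m" j] eF[of "i - m" "j - m"] unfolding I_def
    by (cases "i < m"; cases "j < m") (auto simp: not_less)
  have "?N = four_block_mat I (0\<^sub>m (m + q) c) (0\<^sub>m c (m + q)) (x \<cdot>\<^sub>m 1\<^sub>m c)"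
  proof (rule eq_matI)
    fix i j assume "i < dim_row (four_block_mat I (0\<^sub>m (m + q) c) (0\<^sub>m c (m + q)) (x \<cdot>\<^sub>m 1\<^sub>m c))"
      "j < dim_col (four_block_mat I (0\<^sub>m (m + q) c) (0\<^sub>m c (m + q)) (x \<cdot>\<^sub>m 1\<^sub>m c))"
    then have ij: "i < m + q + c" "j < m + q + c" using I by auto
    have gi: "s \<le> g i \<longleftrightarrow> m \<le> i" using g1[of i] ij n by auto
    show "?N $$ (i, j) = four_block_mat I (0\<^sub>m (m + q) c) (0\<^sub>m c (m + q)) (x \<cdot>\<^sub>m 1\<^sub>m c) $$ (i, j)"
      using ij n I gi g2[of i] g2[of j] Ie[of i j]
      by (cases "i < m + q"; cases "j < m + q") auto
  qed (use I n in auto)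
  then have "det ?N = det I * det (x \<cdot>\<^sub>m 1\<^sub>m c)"
    using I by (simp add: det_four_block_mat_upper_right_zero[of _ "m + q" _ c])
  then show ?thesis by (simp add: I_def c_def)
qed

text \<open>The eigenvalue side of the same splitting, with the same power of \<open>x\<close>,
  which therefore cancels for nonzero \<open>x\<close>.\<close>

lemma prod_block_form:
  fixes lt :: "nat \<Rightarrow> real" and g :: "nat \<Rightarrow> nat"
  assumes mq: "m + q \<le> n" and g1: "\<And>i. i < n \<Longrightarrow> g i < s \<longleftrightarrow> i < m" and g2: "\<And>i. i < n \<Longrightarrow> g i \<le> s \<longleftrightarrow> i < m + q"
  shows "(\<Prod>i<n. if g i < s then - lt i else if g i = s then x - lt i else x) =
    (\<Prod>i<m. - lt i) * (\<Prod>j<q. x - lt (m + j)) * x ^ (n - m - q)" (is "prod ?f _ = _")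
proof -
  have "prod ?f ({..<m} \<union> ({m..<m + q} \<union> {m + q..<n})) = prod ?f {..<m} * prod ?f ({m..<m + q} \<union> {m + q..<n})"
    by (rule prod.union_disjoint) auto
  moreover have "prod ?f ({m..<m + q} \<union> {m + q..<n}) = prod ?f {m..<m + q} * prod ?f {m + q..<n}"
    by (rule prod.union_disjoint) auto
  moreover have "{..<n} = {..<m} \<union> ({m..<m + q} \<union> {m + q..<n})" using mq by auto
  ultimately have "prod ?f {..<n} = prod ?f {..<m} * (prod ?f {m..<m + q} * prod ?f {m + q..<n})" by (simp only:)
  also have "prod ?f {..<m} = (\<Prod>i<m. - lt i)"
    using g1 mq by (intro prod.cong) auto
  also have "prod ?f {m..<m + q} = (\<Prod>i\<in>{m..<m + q}. x - lt i)"
  proof (intro prod.cong refl)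
    fix i assume "i \<in> {m..<m + q}"
    then have "\<not> g i < s" "g i \<le> s" using g1[of i] g2[of i] mq by auto
    then show "?f i = x - lt i" by simp
  qed
  also have "\<dots> = (\<Prod>j<q. x - lt (m + j))"
    by (rule prod.reindex_bij_witness[where i = "\<lambda>j. m + j" and j = "\<lambda>i. i - m"]) auto
  also have "prod ?f {m + q..<n} = (\<Prod>i\<in>{m + q..<n}. x)"
  proof (intro prod.cong refl)
    fix i assume "i \<in> {m + q..<n}"
    then have "\<not> g i \<le> s" using g2[of i] by auto
    then show "?f i = x" by simp
  qed
  also have "\<dots> = x ^ (n - m - q)" by simp
  finally show ?thesis by (simp add: mult.assoc)
qed

lemma col_space_mult_subset:
  fixes B C :: "real mat"
  assumes B: "B \<in> carrier_mat n b" and C: "C \<in> carrier_mat b c"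
  shows "vec_space.col_space n (B * C) \<subseteq> vec_space.col_space n B"
proof
  interpret vec_space "TYPE(real)" n .
  fix y assume y: "y \<in> col_space (B * C)"
  have BC: "B * C \<in> carrier_mat n c" using B C by simp
  from y obtain x where x: "x \<in> carrier_vec c" "y = (B * C) *\<^sub>v x"
    unfolding col_space_eq[OF BC] using BC by auto
  then have "y = B *\<^sub>v (C *\<^sub>v x)" using B C by simp
  then show "y \<in> col_space B" unfolding col_space_eq[OF B] using B C x by auto
qed

section \<open>Degree blocks of the limit matrix\<close>

context kernel_setup
begin

definition "N s = (if s < k then cardH TYPE('d) s else cardH TYPE('d) k - (cardP TYPE('d) k - n))"

lemma offs_plus_N:
  assumes "s \<le> k"
  shows "offs TYPE('d) s + N s = (if s < k then cardP TYPE('d) s else n)"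
proof (cases "s < k")
  case True
  then show ?thesis using offs_le_cardP[OF e, of s] by (simp add: N_def cardH_eq[OF e])
next
  case False
  then have "s = k" "offs TYPE('d) s = cardP TYPE('d) (k - 1)" using assms k by (auto simp: offs_def)
  then show ?thesis using n by (simp add: N_def cardH_eq[OF e])
qed

lemma block_facts:
  assumes "s \<le> k"
  shows "offs TYPE('d) s + N s \<le> n" "i < n \<Longrightarrow> g i < s \<longleftrightarrow> i < offs TYPE('d) s"
    "i < n \<Longrightarrow> g i \<le> s \<longleftrightarrow> i < offs TYPE('d) s + N s" "N s \<le> cardH TYPE('d) s"
    "i < n \<Longrightarrow> g i = s \<longleftrightarrow> i \<in> {offs TYPE('d) s..<offs TYPE('d) s + N s}"
proof -
  show 1: "offs TYPE('d) s + N s \<le> n"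
  proof (cases "s < k")
    case True
    then have "cardP TYPE('d) s \<le> cardP TYPE('d) (k - 1)" by (intro cardP_mono[OF e]) simp
    then show ?thesis using offs_plus_N[OF assms] True n by simp
  qed (use offs_plus_N[OF assms] in simp)
  show 2: "g i < s \<longleftrightarrow> i < offs TYPE('d) s" using offs_le_iff[OF e, of s i] by auto
  show 3: "g i \<le> s \<longleftrightarrow> i < offs TYPE('d) s + N s" if "i < n"
    using offs_plus_N[OF assms] less_cardP_iff[OF e, of i s] g_le[OF that] that assms by auto
  show "N s \<le> cardH TYPE('d) s" using assms by (auto simp: N_def)
  show "g i = s \<longleftrightarrow> i \<in> {offs TYPE('d) s..<offs TYPE('d) s + N s}" if "i < n" using 2 3[OF that] by auto
qed

lemma sum_degree_less:
  assumes "i < offs TYPE('d) s"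
  shows "(\<Sum>a | g a = g i. f a) = (\<Sum>a<offs TYPE('d) s. if g a = g i then f a else 0)"
proof -
  have "(\<Sum>a | g a = g i. f a) = (\<Sum>a | g a = g i. if g a = g i then f a else 0)" by (intro sum.cong) auto
  also have "\<dots> = (\<Sum>a<offs TYPE('d) s. if g a = g i then f a else 0)"
  proof (rule sum.mono_neutral_left)
    show "{a. g a = g i} \<subseteq> {..<offs TYPE('d) s}"
    proof
      fix a assume "a \<in> {a. g a = g i}"
      then have "\<not> offs TYPE('d) s \<le> a" using offs_le_iff[OF e, of s a] offs_le_iff[OF e, of s i] assms by simp
      then show "a \<in> {..<offs TYPE('d) s}" by simp
    qed
  qed auto
  finally show ?thesis .
qed

lemma sum_degree_eq: "(\<Sum>a | g a = s. f a) = (\<Sum>a<cardH TYPE('d) s. f (offs TYPE('d) s + a))"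
  unfolding degree_block[OF e] cardH_eq[OF e]
  by (rule sum.reindex_bij_witness[where i = "\<lambda>a. offs TYPE('d) s + a" and j = "\<lambda>a. a - offs TYPE('d) s"]) auto

text \<open>The block diagonal part of the triangular factor; entries between different degrees are
  lost in the limit. It keeps the diagonal, hence the determinant.\<close>

definition "Dm s = mat (offs TYPE('d) s) (offs TYPE('d) s) (\<lambda>(i, a). if g a = g i then r i a else 0)"
text \<open>This is \<open>Q_s^T V_s\<close>, not square only when the last block is
  truncated.\<close>

definition "Em s = mat (N s) (cardH TYPE('d) s) (\<lambda>(j, a). r (offs TYPE('d) s + j) (offs TYPE('d) s + a))"
definition "Wur s = mat (offs TYPE('d) s) (cardH TYPE('d) s) (\<lambda>(a, b). W a (offs TYPE('d) s + b))"
definition "Wll s = mat (cardH TYPE('d) s) (offs TYPE('d) s) (\<lambda>(a, b). W (offs TYPE('d) s + a) b)"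
definition "Wlr s = mat (cardH TYPE('d) s) (cardH TYPE('d) s) (\<lambda>(a, b). W (offs TYPE('d) s + a) (offs TYPE('d) s + b))"

lemma block_carrier:
  "Dm s \<in> carrier_mat (offs TYPE('d) s) (offs TYPE('d) s)"
  "Em s \<in> carrier_mat (N s) (cardH TYPE('d) s)"
  "Wur s \<in> carrier_mat (offs TYPE('d) s) (cardH TYPE('d) s)"
  "Wll s \<in> carrier_mat (cardH TYPE('d) s) (offs TYPE('d) s)"
  "Wlr s \<in> carrier_mat (cardH TYPE('d) s) (cardH TYPE('d) s)"
  by (auto simp: Dm_def Em_def Wur_def Wll_def Wlr_def)

lemma Wr_carrier: "s \<ge> 1 \<Longrightarrow> Wr e K (s - 1) \<in> carrier_mat (offs TYPE('d) s) (offs TYPE('d) s)"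
  by (simp add: Wr_def offs_def)

lemma Wr_index: "a < cardP TYPE('d) s \<Longrightarrow> b < cardP TYPE('d) s \<Longrightarrow> Wr e K s $$ (a, b) = W a b"
  by (simp add: Wr_def W_def)

lemma Wr_four_block:
  assumes "s \<ge> 1"
  shows "Wr e K s = four_block_mat (Wr e K (s - 1)) (Wur s) (Wll s) (Wlr s)"
proof -
  have c: "cardP TYPE('d) s = offs TYPE('d) s + cardH TYPE('d) s" using offs_le_cardP[OF e, of s] by (simp add: cardH_eq[OF e])
  have o: "offs TYPE('d) s = cardP TYPE('d) (s - 1)" using assms by (simp add: offs_def)
  have W1: "Wr e K (s - 1) $$ (i, j) = W i j" if "i < offs TYPE('d) s" "j < offs TYPE('d) s" for i j
    using that unfolding o by (rule Wr_index)
  have Ws: "Wr e K s $$ (i, j) = W i j"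
    if "i < offs TYPE('d) s + cardH TYPE('d) s" "j < offs TYPE('d) s + cardH TYPE('d) s" for i j
    using that Wr_index[of i s j] by (simp add: c)
  have dims: "dim_row (Wr e K s) = offs TYPE('d) s + cardH TYPE('d) s"
    "dim_col (Wr e K s) = offs TYPE('d) s + cardH TYPE('d) s" by (simp_all add: c Wr_def)
  note cr = block_carrier(3-5)[of s] Wr_carrier[OF assms]
  show ?thesis
    using cr W1 Ws
    by (intro eq_matI) (auto simp: Wur_def Wll_def Wlr_def dims simp del: One_nat_def)
qed

lemma Wtil_eq:
  assumes "s \<ge> 1"
  shows "Wtil e K s = Wlr s - Wll s * minv (Wr e K (s - 1)) * Wur s"
proof -
  have c: "cardP TYPE('d) s = offs TYPE('d) s + cardH TYPE('d) s" using offs_le_cardP[OF e, of s] by (simp add: cardH_eq[OF e])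
  have o: "cardP TYPE('d) (s - 1) = offs TYPE('d) s" using assms by (simp add: offs_def)
  have dims: "dim_row (Wr e K s) = offs TYPE('d) s + cardH TYPE('d) s"
    "dim_col (Wr e K s) = offs TYPE('d) s + cardH TYPE('d) s" by (simp_all add: c Wr_def)
  have "mat (cardH TYPE('d) s) (cardH TYPE('d) s) (\<lambda>(i, j). Wr e K s $$ (i + offs TYPE('d) s, j + offs TYPE('d) s)) = Wlr s"
    "mat (cardH TYPE('d) s) (offs TYPE('d) s) (\<lambda>(i, j). Wr e K s $$ (i + offs TYPE('d) s, j)) = Wll s"
    "mat (offs TYPE('d) s) (cardH TYPE('d) s) (\<lambda>(i, j). Wr e K s $$ (i, j + offs TYPE('d) s)) = Wur s"
    by (auto intro!: eq_matI simp: Wur_def Wll_def Wlr_def Wr_index c add.commute)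
  then show ?thesis
    unfolding Wtil_def split_block_def Let_def o by (simp add: dims del: One_nat_def)
qed

text \<open>Taken together: the part of \<open>G\<close> of degree at most \<open>s\<close> is
  \<open>Wr e K s\<close> multiplied from the left by the block diagonal matrix of
  \<open>Dm s\<close> and \<open>Em s\<close> and from the right by its transpose. This is the shape
  that the Schur complement argument asks for.\<close>

lemma limit_block_entries:
  assumes s: "1 \<le> s" "s \<le> k"
  defines "m \<equiv> offs TYPE('d) s"
  shows "i < m \<Longrightarrow> j < m \<Longrightarrow> (Dm s * Wr e K (s - 1) * transpose_mat (Dm s)) $$ (i, j) = G i j"
    and "i < m \<Longrightarrow> j < N s \<Longrightarrow> (Dm s * Wur s * transpose_mat (Em s)) $$ (i, j) = G i (m + j)"
    and "i < N s \<Longrightarrow> j < m \<Longrightarrow> (Em s * Wll s * transpose_mat (Dm s)) $$ (i, j) = G (m + i) j"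
    and "i < N s \<Longrightarrow> j < N s \<Longrightarrow> (Em s * Wlr s * transpose_mat (Em s)) $$ (i, j) = G (m + i) (m + j)"
proof -
  have o: "cardP TYPE('d) (s - 1) = m" using s by (simp add: m_def offs_def)
  have ge: "g (m + i) = s" if "i < N s" for i
    using block_facts(1)[OF s(2)] block_facts(5)[OF s(2), of "m + i"] that by (auto simp: m_def)
  have W1: "Wr e K (s - 1) $$ (a, b) = W a b" if "a < m" "b < m" for a b
    using that unfolding o[symmetric] by (rule Wr_index)
  note bc = block_carrier[of s, folded m_def] Wr_carrier[OF s(1), folded m_def]
  show "(Dm s * Wr e K (s - 1) * transpose_mat (Dm s)) $$ (i, j) = G i j" if ij: "i < m" "j < m"
    unfolding triple_product_index[OF bc(1) bc(6) bc(1) ij] G_def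
      sum_degree_less[OF ij(1)[unfolded m_def], folded m_def] sum_degree_less[OF ij(2)[unfolded m_def], folded m_def]
    using ij by (intro sum.cong refl) (auto simp: Dm_def m_def[symmetric] W1 simp del: One_nat_def intro!: sum.cong)
  show "(Dm s * Wur s * transpose_mat (Em s)) $$ (i, j) = G i (m + j)" if ij: "i < m" "j < N s"
    unfolding triple_product_index[OF bc(1) bc(3) bc(2) ij] G_def ge[OF ij(2)] sum_degree_eq[where s = s]
      sum_degree_less[OF ij(1)[unfolded m_def], folded m_def] m_def[symmetric]
    using ij by (intro sum.cong refl) (auto simp: Dm_def Em_def Wur_def m_def[symmetric] intro!: sum.cong)
  show "(Em s * Wll s * transpose_mat (Dm s)) $$ (i, j) = G (m + i) j" if ij: "i < N s" "j < m"
    unfolding triple_product_index[OF bc(2) bc(4) bc(1) ij] G_def ge[OF ij(1)] sum_degree_eq[where s = s]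
      sum_degree_less[OF ij(2)[unfolded m_def], folded m_def] m_def[symmetric]
    using ij by (intro sum.cong refl) (auto simp: Dm_def Em_def Wll_def m_def[symmetric] intro!: sum.cong)
  show "(Em s * Wlr s * transpose_mat (Em s)) $$ (i, j) = G (m + i) (m + j)" if ij: "i < N s" "j < N s"
    unfolding triple_product_index[OF bc(2) bc(5) bc(2) ij] G_def ge[OF ij(1)] ge[OF ij(2)] sum_degree_eq[where s = s] m_def[symmetric]
    using ij by (intro sum.cong refl) (auto simp: Em_def Wlr_def m_def[symmetric] intro!: sum.cong)
qed

section \<open>Thin QR factorizations and Gram determinants\<close>

definition "Q1 m = mat n m (\<lambda>(b, i). Qf $$ (b, i))"
definition "R1 m = mat m m (\<lambda>(i, a). r i a)"

text \<open>A single factorization at degree \<open>k - 1\<close> serves every lower degree: when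
  \<open>V\<close> is expanded in the orthonormal columns of \<open>Qf\<close>, the coefficients
  past position \<open>?m\<close> vanish by triangularity.\<close>

lemma Vle_factor:
  assumes t: "t \<le> k - 1"
  shows "Vle e xs n t = Q1 (cardP TYPE('d) t) * R1 (cardP TYPE('d) t)"
proof (rule eq_matI)
  let ?m = "cardP TYPE('d) t"
  have m: "?m \<le> cardP TYPE('d) (k - 1)" "?m < n" using cardP_mono[OF e t] n by auto
  fix b a assume "b < dim_row (Q1 ?m * R1 ?m)" "a < dim_col (Q1 ?m * R1 ?m)"
  then have ba: "b < n" "a < ?m" by (auto simp: Q1_def R1_def)
  have "(Q1 ?m * R1 ?m) $$ (b, a) = (\<Sum>i<?m. Qf $$ (b, i) * r i a)"
    using ba by (simp add: Q1_def R1_def scalar_prod_def atLeast0LessThan)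
  also have "\<dots> = (\<Sum>i<n. Qf $$ (b, i) * r i a)"
    using m ba by (intro sum.mono_neutral_left) (auto simp: r_upper)
  also have "\<dots> = (\<Sum>b'<n. (\<Sum>i<n. Qf $$ (b, i) * Qf $$ (b', i)) * mpow (xs b') (e a))"
    unfolding r_def sum_distrib_left sum_distrib_right by (subst sum.swap) (simp add: ac_simps)
  also have "\<dots> = (\<Sum>b'<n. if b' = b then mpow (xs b') (e a) else 0)"
    using ba orthogonal_matD(2)[OF Qf(1,3)] by (intro sum.cong) auto
  also have "\<dots> = Vle e xs n t $$ (b, a)" using ba by (simp add: Vle_def)
  finally show "Vle e xs n t $$ (b, a) = (Q1 ?m * R1 ?m) $$ (b, a)" by simp
qed (auto simp: Vle_def Q1_def R1_def)

lemma R1_carrier: "R1 m \<in> carrier_mat m m" and Q1_carrier: "Q1 m \<in> carrier_mat n m"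
  by (auto simp: R1_def Q1_def)

lemma det_R1:
  assumes t: "t \<le> k - 1"
  shows "det (R1 (cardP TYPE('d) t)) = (\<Prod>i<cardP TYPE('d) t. r i i)"
  using cardP_mono[OF e t] n
  by (subst det_upper[OF R1_carrier]) (auto simp: R1_def r_upper)

text \<open>A zero on the diagonal makes the triangular corner singular, and a vector in its kernel
  is killed by \<open>V\<close> as well, against full column rank.\<close>

lemma diag_nonzero:
  assumes t: "t \<le> k - 1" and rk: "vec_space.rank n (Vle e xs n t) = dim_col (Vle e xs n t)"
    and i: "i < cardP TYPE('d) t"
  shows "r i i \<noteq> 0"
proof
  let ?m = "cardP TYPE('d) t"
  assume "r i i = 0"
  then have "det (R1 ?m) = 0" using i by (auto simp: det_R1[OF t])
  then obtain v where v: "v \<in> carrier_vec ?m" "v \<noteq> 0\<^sub>v ?m" "R1 ?m *\<^sub>v v = 0\<^sub>v ?m"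
    using det_0_iff_vec_prod_zero_field[OF R1_carrier] by blast
  have "Vle e xs n t *\<^sub>v v = Q1 ?m *\<^sub>v (R1 ?m *\<^sub>v v)"
    unfolding Vle_factor[OF t] by (rule assoc_mult_mat_vec[OF Q1_carrier R1_carrier v(1)])
  also have "\<dots> = 0\<^sub>v n" unfolding v(3) by (rule eq_vecI) (auto simp: Q1_def scalar_prod_def)
  finally have "Vle e xs n t *\<^sub>v v = 0\<^sub>v n" .
  moreover have "Vle e xs n t \<in> carrier_mat n ?m" by (simp add: Vle_def)
  ultimately show False using full_column_rank_inj[of "Vle e xs n t" n ?m v] rk v by simp
qed

text \<open>The orthonormal columns \<open>Q1\<close> drop out of the Gram matrix, leaving
  \<open>R1^T R1\<close>.\<close>

lemma det_Gram:
  assumes t: "t \<le> k - 1"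
  shows "det (transpose_mat (Vle e xs n t) * Vle e xs n t) = (\<Prod>i<cardP TYPE('d) t. r i i)\<^sup>2"
proof -
  let ?m = "cardP TYPE('d) t"
  have m: "?m \<le> n" using cardP_mono[OF e t] n by simp
  note Q = Q1_carrier[of ?m] and R = R1_carrier[of ?m]
  have QQ: "transpose_mat (Q1 ?m) * Q1 ?m = 1\<^sub>m ?m"
    using m orthogonal_matD(1)[OF Qf(1,2)]
    by (intro eq_matI) (auto simp: Q1_def scalar_prod_def atLeast0LessThan)
  have "transpose_mat (Vle e xs n t) * Vle e xs n t =
      transpose_mat (R1 ?m) * transpose_mat (Q1 ?m) * (Q1 ?m * R1 ?m)"
    unfolding Vle_factor[OF t] transpose_mult[OF Q R] ..
  also have "\<dots> = transpose_mat (R1 ?m) * (transpose_mat (Q1 ?m) * (Q1 ?m * R1 ?m))"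
    using Q R by (intro assoc_mult_mat) auto
  also have "transpose_mat (Q1 ?m) * (Q1 ?m * R1 ?m) = (transpose_mat (Q1 ?m) * Q1 ?m) * R1 ?m"
    using Q R by (intro assoc_mult_mat[symmetric]) auto
  also have "\<dots> = R1 ?m" using R by (simp add: QQ)
  finally show ?thesis
    using R by (simp add: det_mult[of _ ?m] det_transpose[OF R] det_R1[OF t] power2_eq_square)
qed

lemma det_Dm:
  assumes s: "1 \<le> s" "s \<le> k"
  shows "det (Dm s) = (\<Prod>i<offs TYPE('d) s. r i i)"
proof -
  have o: "offs TYPE('d) s = cardP TYPE('d) (s - 1)" using s by (simp add: offs_def)
  have "offs TYPE('d) s \<le> cardP TYPE('d) (k - 1)" unfolding o using s by (intro cardP_mono[OF e]) simp
  then show ?thesis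
    using n by (subst det_upper[OF block_carrier(1)]) (auto simp: Dm_def r_upper)
qed

section \<open>Leading coefficients of the eigenvalues\<close>

lemma lt_exists:
  assumes "flat_limit n g lam Z M G"
  shows "\<exists>lt. \<forall>i<n. (\<lambda>\<epsilon>. lam i \<epsilon> - \<epsilon> ^ (2 * g i) * lt i) \<in> O[at_right 0](\<lambda>\<epsilon>. \<epsilon> ^ (2 * g i + 1))"
proof -
  obtain \<delta> where D: "eigdec \<delta>" using eigdec_ex ..
  have "\<forall>i. \<exists>c. i < n \<longrightarrow> (\<lambda>\<epsilon>. lam i \<epsilon> - \<epsilon> ^ (2 * g i) * c) \<in> O[at_right 0](\<lambda>\<epsilon>. \<epsilon> ^ (2 * g i + 1))"
    using analytic_near0_leading_term[OF eigdecD(2)[OF D] flat_limit.lam_bigo[OF assms]] by blast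
  then show ?thesis by (rule choice[THEN exE]) blast
qed

text \<open>Compare traces at \<open>\<epsilon> = 0\<close>: the kernel matrix has all entries
  \<open>K 0 0\<close> there, every projector has trace 1, and only the eigenvalue of order 0
  survives, which is single because degree 0 has one multi-index.\<close>

lemma lt_0:
  assumes lt: "\<And>i. i < n \<Longrightarrow> ((\<lambda>\<epsilon>. lam i \<epsilon> / \<epsilon> ^ (2 * g i)) \<longlongrightarrow> lt i) (at_right 0)"
  shows "lt 0 = real n * K 0 0"
proof -
  obtain \<delta> where D: "eigdec \<delta>" using eigdec_ex ..
  have 0: "\<bar>0\<bar> < \<delta>" using eigdecD(1)[OF D] by simp
  have n0: "0 < n" using n(1) by simp
  have lam0: "lam i 0 = (if i = 0 then lt 0 else 0)" if i: "i < n" for i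
  proof -
    have "((\<lambda>\<epsilon>. lam i \<epsilon> / \<epsilon> ^ (2 * g i) * \<epsilon> ^ (2 * g i)) \<longlongrightarrow> lt i * 0 ^ (2 * g i)) (at_right 0)"
      by (intro tendsto_intros lt i)
    moreover have "eventually (\<lambda>\<epsilon>. lam i \<epsilon> / \<epsilon> ^ (2 * g i) * \<epsilon> ^ (2 * g i) = lam i \<epsilon>) (at_right 0)"
      using eventually_at_right_less[of 0] by eventually_elim simp
    ultimately have "(lam i \<longlongrightarrow> lt i * 0 ^ (2 * g i)) (at_right 0)" by (rule Lim_transform_eventually)
    then have "lam i 0 = lt i * 0 ^ (2 * g i)"
      by (rule tendsto_unique[OF trivial_limit_at_right_real analytic_near0_tendsto[OF eigdecD(2)[OF D i]]])
    moreover have "g i = 0 \<longleftrightarrow> i = 0"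
    proof -
      have "cardP TYPE('d) 0 = 1" using cardH_eq[OF e, of 0] cardH_0[where 'd = 'd] by (simp add: offs_def)
      then show ?thesis using less_cardP_iff[OF e, of i 0] by simp
    qed
    ultimately show ?thesis by auto
  qed
  have pp: "(\<Sum>a<n. P i 0 $$ (a, a)) = 1" if "i < n" for i
  proof -
    have "p i \<in> carrier_vec n" "scalar_prod (p i) (p i) = 1" "P i 0 = mat n n (\<lambda>(a, b). p i $ a * p i $ b)"
      using p that by (auto simp: limiting_eigvec_def)
    then show ?thesis by (simp add: scalar_prod_def atLeast0LessThan)
  qed
  have "real n * K 0 0 = (\<Sum>a<n. Kmat K xs n 0 $$ (a, a))" by (simp add: Kmat_def)
  also have "\<dots> = (\<Sum>a<n. \<Sum>i<n. lam i 0 * P i 0 $$ (a, a))"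
    using eigdecD(9)[OF D 0] by (intro sum.cong) auto
  also have "\<dots> = (\<Sum>i<n. lam i 0 * (\<Sum>a<n. P i 0 $$ (a, a)))"
    by (subst sum.swap) (simp add: sum_distrib_left)
  also have "\<dots> = (\<Sum>i<n. if i = 0 then lt 0 else 0)"
    using pp lam0 by (intro sum.cong) auto
  also have "\<dots> = lt 0" using n0 by simp
  finally show ?thesis by simp
qed

text \<open>The limit determinant is written twice, through \<open>G\<close> and through the leading
  coefficients; the powers of \<open>x\<close> from higher blocks cancel. The characteristic
  polynomial is the monic part of the identity. The constant equates the product of the lower
  coefficients, up to sign, with the determinant of a nonsingular corner, hence none of them is
  0.\<close>

lemma block_char_poly:
  assumes lt: "\<And>i. i < n \<Longrightarrow> ((\<lambda>\<epsilon>. lam i \<epsilon> / \<epsilon> ^ (2 * g i)) \<longlongrightarrow> lt i) (at_right 0)"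
    and flat: "flat_limit n g lam Z M G"
    and s: "1 \<le> s" "s \<le> k" and W: "det (Wr e K (s - 1)) \<noteq> 0"
    and rk: "vec_space.rank n (Vle e xs n (s - 1)) = dim_col (Vle e xs n (s - 1))"
  shows "char_poly (Em s * Wtil e K s * transpose_mat (Em s)) = (\<Prod>j<N s. [:- lt (offs TYPE('d) s + j), 1:])"
    and "\<And>i. i < offs TYPE('d) s \<Longrightarrow> lt i \<noteq> 0"
proof -
  define m where "m = offs TYPE('d) s"
  note bc = block_carrier[of s, folded m_def] and Wc = Wr_carrier[OF s(1), folded m_def]
  have o: "m = cardP TYPE('d) (s - 1)" using s by (simp add: m_def offs_def)
  have "r i i \<noteq> 0" if "i < m" for i
    using diag_nonzero[of "s - 1" i] s rk that unfolding o by simp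
  then have dD: "det (Dm s) \<noteq> 0" unfolding det_Dm[OF s] m_def[symmetric] by simp
  let ?A = "Dm s * Wr e K (s - 1) * transpose_mat (Dm s)" and ?B = "Dm s * Wur s * transpose_mat (Em s)"
    and ?C = "Em s * Wll s * transpose_mat (Dm s)" and ?F = "Em s * Wlr s * transpose_mat (Em s)"
  note mm = mult_carrier_mat[OF mult_carrier_mat]
  have T: "transpose_mat (Dm s) \<in> carrier_mat m m" "transpose_mat (Em s) \<in> carrier_mat (cardH TYPE('d) s) (N s)"
    using bc by auto
  have car: "?A \<in> carrier_mat m m" "?B \<in> carrier_mat m (N s)" "?C \<in> carrier_mat (N s) m" "?F \<in> carrier_mat (N s) (N s)"
    by (rule mm[OF bc(1) Wc T(1)], rule mm[OF bc(1) bc(3) T(2)], rule mm[OF bc(2) bc(4) T(1)], rule mm[OF bc(2) bc(5) T(2)])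
  note bf = block_facts[OF s(2), folded m_def]
  note ent = limit_block_entries[OF s, folded m_def]
  have "det (four_block_mat (- ?A) (- ?B) (- ?C) (x \<cdot>\<^sub>m 1\<^sub>m (N s) - ?F)) = (\<Prod>i<m. - lt i) * (\<Prod>j<N s. x - lt (m + j))"
    if x: "x \<noteq> 0" for x
  proof -
    note e1 = det_block_form[of ?A m ?B "N s" ?C ?F n g s G x, OF car bf(1) bf(2) bf(3) ent]
    note e2 = flat_limit.limit_det[OF flat lt, of s x]
    note e3 = prod_block_form[of m "N s" n g s lt x, OF bf(1) bf(2) bf(3)]
    have "det (four_block_mat (- ?A) (- ?B) (- ?C) (x \<cdot>\<^sub>m 1\<^sub>m (N s) - ?F)) * x ^ (n - m - N s) =
      (\<Prod>i<m. - lt i) * (\<Prod>j<N s. x - lt (m + j)) * x ^ (n - m - N s)"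
      by (rule trans[OF e1[symmetric] trans[OF e2 e3]])
    then show ?thesis using x by simp
  qed
  note main = char_poly_of_block_det[OF bc(1) Wc bc(3) bc(4) bc(5) bc(2) dD W this]
  show "char_poly (Em s * Wtil e K s * transpose_mat (Em s)) = (\<Prod>j<N s. [:- lt (offs TYPE('d) s + j), 1:])"
    using main(1) unfolding Wtil_eq[OF s(1)] m_def .
  have "det ?A = det (Dm s) * det (Wr e K (s - 1)) * det (transpose_mat (Dm s))"
    using det_mult[OF mult_carrier_mat[OF bc(1) Wc] T(1)] det_mult[OF bc(1) Wc] by simp
  then have "det ?A \<noteq> 0" using dD W det_transpose[OF bc(1)] by simp
  then have "det (- ?A) \<noteq> 0" using det_0_negate[OF car(1)] by simp
  then have "(\<Prod>i<m. - lt i) \<noteq> 0" using main(2) by simp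
  then show "\<And>i. i < offs TYPE('d) s \<Longrightarrow> lt i \<noteq> 0" by (simp add: m_def)
qed

lemma Em_eq:
  assumes s: "s \<le> k"
  shows "transpose_mat (col_block Qf (offs TYPE('d) s) (N s)) * Vh e xs n s = Em s"
  using block_facts(1)[OF s] Qf(1)
  by (intro eq_matI) (auto simp: col_block_def Vh_def Em_def r_def scalar_prod_def atLeast0LessThan)

lemma Wtil_carrier:
  assumes "1 \<le> s"
  shows "Wtil e K s \<in> carrier_mat (cardH TYPE('d) s) (cardH TYPE('d) s)"
  unfolding Wtil_eq[OF assms]
  using block_carrier[of s] by (auto simp: Wll_def Wur_def Wlr_def)

lemma block_product_eq:
  assumes s: "1 \<le> s" "s \<le> k"
  defines "Q \<equiv> col_block Qf (offs TYPE('d) s) (N s)"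
  shows "transpose_mat Q * Vh e xs n s * Wtil e K s * transpose_mat (Vh e xs n s) * Q =
    Em s * Wtil e K s * transpose_mat (Em s)"
proof -
  let ?V = "Vh e xs n s" and ?h = "cardH TYPE('d) s"
  have Q: "Q \<in> carrier_mat n (N s)" and V: "?V \<in> carrier_mat n ?h"
    using Qf(1) by (auto simp: Q_def col_block_def Vh_def)
  note bc = block_carrier[of s]
  note Wt = Wtil_carrier[OF s(1)]
  have "transpose_mat (Em s) = transpose_mat ?V * Q"
    using Q V unfolding Em_eq[OF s(2), symmetric, folded Q_def]
    by (subst transpose_mult[of _ _ n]) auto
  then have "Em s * Wtil e K s * transpose_mat (Em s) = Em s * Wtil e K s * transpose_mat ?V * Q"
    using assoc_mult_mat[OF mult_carrier_mat[OF bc(2) Wt] _ Q, of "transpose_mat ?V"] V by simp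
  then show ?thesis unfolding Em_eq[OF s(2), folded Q_def] by simp
qed

text \<open>Evaluate the characteristic polynomial at 0. For \<open>s < k\<close> the matrix
  \<open>Em s\<close> is square and triangular, so its squared determinant is the quotient of the
  two Gram determinants; the determinant of \<open>Wtil\<close> is the quotient of the two Wronskian
  determinants, by the Schur complement.\<close>

lemma prod_lt:
  assumes s: "1 \<le> s" "s < k" and W: "det (Wr e K (s - 1)) \<noteq> 0"
    and rk: "vec_space.rank n (Vle e xs n (s - 1)) = dim_col (Vle e xs n (s - 1))"
    and cp: "char_poly (Em s * Wtil e K s * transpose_mat (Em s)) = (\<Prod>j<N s. [:- l j, 1:])"
  shows "(\<Prod>j<cardH TYPE('d) s. l j) =
    det (transpose_mat (Vle e xs n s) * Vle e xs n s) * det (Wr e K s) /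
    (det (transpose_mat (Vle e xs n (s - 1)) * Vle e xs n (s - 1)) * det (Wr e K (s - 1)))"
proof -
  define m h where "m = offs TYPE('d) s" and "h = cardH TYPE('d) s"
  have Ns: "N s = h" using s by (simp add: N_def h_def)
  have o: "m = cardP TYPE('d) (s - 1)" using s by (simp add: m_def offs_def)
  have c: "cardP TYPE('d) s = m + h" using offs_le_cardP[OF e, of s] by (simp add: cardH_eq[OF e] m_def h_def)
  have sk: "s \<le> k - 1" using s by simp
  have mh: "m + h \<le> cardP TYPE('d) (k - 1)" using cardP_mono[OF e sk] c by simp
  note bc = block_carrier[of s, folded m_def h_def, unfolded Ns]
  note Wt = Wtil_carrier[OF s(1), folded h_def] and Wc = Wr_carrier[OF s(1), folded m_def]
  have rn: "r i i \<noteq> 0" if "i < m" for i using diag_nonzero[of "s - 1" i] sk rk that unfolding o by simp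
  have dE: "det (Em s) = (\<Prod>j<h. r (m + j) (m + j))"
    using mh n(1) by (subst det_upper[OF bc(2)]) (auto simp: Em_def Ns m_def[symmetric] h_def[symmetric] r_upper)
  let ?S = "Em s * Wtil e K s * transpose_mat (Em s)"
  have T: "transpose_mat (Em s) \<in> carrier_mat h h" using bc(2) by simp
  have S: "?S \<in> carrier_mat h h" by (rule mult_carrier_mat[OF mult_carrier_mat[OF bc(2) Wt] T])
  have dS: "det ?S = (\<Prod>j<h. r (m + j) (m + j))\<^sup>2 * det (Wtil e K s)"
    using det_mult[OF mult_carrier_mat[OF bc(2) Wt] T] det_mult[OF bc(2) Wt] det_transpose[OF bc(2)]
    by (simp add: dE power2_eq_square)
  have "poly (char_poly ?S) 0 = det (- ?S)"
  proof -
    have "- char_matrix ?S 0 = - ?S" using S by (intro eq_matI) (auto simp: char_matrix_def)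
    then show ?thesis by (simp only: char_poly_matrix[OF S])
  qed
  also have "- ?S = (- 1) \<cdot>\<^sub>m ?S" using S by (intro eq_matI) auto
  also have "det \<dots> = (- 1) ^ h * det ?S" using S by (simp only: det_smult carrier_matD)
  finally have "(\<Prod>j<h. - l j) = (- 1) ^ h * det ?S" unfolding cp Ns by (simp add: poly_prod)
  moreover have "(\<Prod>j<h. - l j) = (- 1) ^ h * (\<Prod>j<h. l j)"
    using prod.distrib[of "\<lambda>_. - 1" l "{..<h}"] by simp
  ultimately have L: "(\<Prod>j<h. l j) = det ?S" by simp
  have dW: "det (Wr e K s) = det (Wr e K (s - 1)) * det (Wtil e K s)"
    unfolding Wr_four_block[OF s(1)] Wtil_eq[OF s(1)]
    using det_schur_complement[OF Wc bc(3) bc(4) bc(5) minv_inverse(1,2)[OF Wc W]] .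
  have g1: "det (transpose_mat (Vle e xs n (s - 1)) * Vle e xs n (s - 1)) = (\<Prod>i<m. r i i)\<^sup>2"
    using det_Gram[of "s - 1"] sk unfolding o by simp
  have "(\<Prod>i<m + h. r i i) = (\<Prod>i<m. r i i) * (\<Prod>j<h. r (m + j) (m + j))"
    by (induction h) (auto simp: mult.assoc)
  then have g2: "det (transpose_mat (Vle e xs n s) * Vle e xs n s) = (\<Prod>i<m. r i i)\<^sup>2 * (\<Prod>j<h. r (m + j) (m + j))\<^sup>2"
    using det_Gram[OF sk] by (simp add: c power_mult_distrib)
  have "(\<Prod>i<m. r i i) \<noteq> 0" using rn by simp
  then show ?thesis unfolding g1 g2 dW h_def[symmetric] L dS using W by simp
qed

text \<open>The decay of \<open>Z\<close> gives the zeros where the eigenvector has lower degree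
  than the column of \<open>Qf\<close>. On the mirror entries it says nothing; there the mass count
  for orthogonal matrices, applied at the cut \<open>offs TYPE('d) s\<close>, takes over.\<close>

lemma X_zero:
  assumes flat: "flat_limit n g lam Z M G"
    and ZX: "\<And>i j. i < n \<Longrightarrow> j < n \<Longrightarrow> ((\<lambda>\<epsilon>. (Z \<epsilon> j i)\<^sup>2) \<longlongrightarrow> (X j i)\<^sup>2) (at_right 0)"
    and lt: "\<And>i. i < n \<Longrightarrow> ((\<lambda>\<epsilon>. lam i \<epsilon> / \<epsilon> ^ (2 * g i)) \<longlongrightarrow> lt i) (at_right 0)"
    and s: "s \<le> k" and nz: "\<And>i. i < offs TYPE('d) s \<Longrightarrow> lt i \<noteq> 0"
    and i: "i < n" and j: "j < n" and ij: "(i < offs TYPE('d) s \<and> g i < g j) \<or> (j < offs TYPE('d) s \<and> offs TYPE('d) s \<le> i)"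
  shows "X j i = 0"
proof -
  define m where "m = offs TYPE('d) s"
  have mn: "m \<le> n" using block_facts(1)[OF s] by (simp add: m_def)
  have up: "X j i = 0" if "i < m" "g i < g j" "j < n" for i j
  proof -
    have "i < n" using that mn by simp
    have "((\<lambda>\<epsilon>. (Z \<epsilon> j i)\<^sup>2) \<longlongrightarrow> 0) (at_right 0)"
      using nz[of i] that(1) by (intro flat_limit.Z_tendsto_0[OF flat \<open>i < n\<close> that(3,2) lt[OF \<open>i < n\<close>]]) (simp add: m_def)
    then have "(X j i)\<^sup>2 = 0"
      by (rule tendsto_unique[OF trivial_limit_at_right_real ZX[OF \<open>i < n\<close> that(3)]])
    then show ?thesis by simp
  qed
  from ij show ?thesis
  proof
    assume "i < offs TYPE('d) s \<and> g i < g j"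
    then show ?thesis using up[of i j] j by (simp add: m_def)
  next
    assume *: "j < offs TYPE('d) s \<and> offs TYPE('d) s \<le> i"
    show ?thesis
    proof (rule orthogonal_upper_block_imp_diagonal[of n X m])
      fix i j assume "i < m" "m \<le> j" "j < n"
      then have "g i < s" "s \<le> g j"
        using offs_le_iff[OF e, of s i] offs_le_iff[OF e, of s j] by (auto simp: m_def)
      then show "X j i = 0" using up[OF \<open>i < m\<close> _ \<open>j < n\<close>] by simp
    qed (use * X_orthogonal mn i in \<open>auto simp: m_def\<close>)
  qed
qed

text \<open>If \<open>X\<close> does not connect the block with its complement, expanding
  \<open>p\<close> in the columns of \<open>Qf\<close>, and these in turn in the \<open>p\<close>,
  stays inside the block. The two expansions use \<open>Xs\<close> and its transpose, and each gives
  one inclusion.\<close>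

lemma vspan_block:
  assumes mq: "m + q \<le> n"
    and X0: "\<And>i j. i < n \<Longrightarrow> j < n \<Longrightarrow> (i \<in> {m..<m + q}) \<noteq> (j \<in> {m..<m + q}) \<Longrightarrow> X j i = 0"
  shows "vspan n (p ` {m..<m + q}) = vec_space.col_space n (col_block Qf m q)"
proof -
  define Pm where "Pm = mat n q (\<lambda>(a, i). p (m + i) $ a)"
  define Xs where "Xs = mat q q (\<lambda>(j, i). X (m + j) (m + i))"
  have Pm: "Pm \<in> carrier_mat n q" and Xs: "Xs \<in> carrier_mat q q" by (auto simp: Pm_def Xs_def)
  have Qs: "col_block Qf m q \<in> carrier_mat n q" using Qf(1) by (auto simp: col_block_def)
  have pv: "p i \<in> carrier_vec n" if "i < n" for i using p that by (auto simp: limiting_eigvec_def)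
  have cols: "set (cols Pm) = p ` {m..<m + q}"
  proof -
    have "col Pm i = p (m + i)" if "i < q" for i
      using pv[of "m + i"] that mq by (intro eq_vecI) (auto simp: Pm_def)
    then have "set (cols Pm) = (\<lambda>i. p (m + i)) ` {0..<q}" using Pm by (auto simp: cols_def)
    also have "\<dots> = p ` {m..<m + q}"
    proof -
      have "{m..<m + q} = (+) m ` {0..<q}" by (simp add: add.commute)
      then show ?thesis by (simp only: image_image)
    qed
    finally show ?thesis .
  qed
  have restrict: "(\<Sum>j<n. f j) = (\<Sum>j<q. f (m + j))" if "\<And>j. j < n \<Longrightarrow> j \<notin> {m..<m + q} \<Longrightarrow> f j = 0" for f :: "nat \<Rightarrow> real"
  proof -
    have "(\<Sum>j<n. f j) = (\<Sum>j\<in>{m..<m + q}. f j)"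
      using that mq by (intro sum.mono_neutral_right) auto
    also have "\<dots> = (\<Sum>j<q. f (m + j))"
      by (rule sum.reindex_bij_witness[where i = "\<lambda>j. m + j" and j = "\<lambda>i. i - m"]) auto
    finally show ?thesis .
  qed
  have pQ: "p i $ a = (\<Sum>j<n. Qf $$ (a, j) * X j i)" if "i < n" "a < n" for i a
  proof -
    have "(\<Sum>j<n. Qf $$ (a, j) * X j i) = (\<Sum>b<n. (\<Sum>j<n. Qf $$ (a, j) * Qf $$ (b, j)) * p i $ b)"
      unfolding X_def sum_distrib_left sum_distrib_right by (subst sum.swap) (simp add: ac_simps)
    also have "\<dots> = (\<Sum>b<n. if b = a then p i $ b else 0)"
      using orthogonal_matD(2)[OF Qf(1,3) that(2)] by (intro sum.cong) auto
    finally show ?thesis using that by simp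
  qed
  have Qp: "Qf $$ (a, j) = (\<Sum>i<n. p i $ a * X j i)" if "j < n" "a < n" for j a
  proof -
    have "(\<Sum>i<n. p i $ a * X j i) = (\<Sum>i<n. \<Sum>l<n. Qf $$ (a, l) * X l i * X j i)"
      using that(2) by (intro sum.cong) (auto simp: pQ sum_distrib_right)
    also have "\<dots> = (\<Sum>l<n. Qf $$ (a, l) * (\<Sum>i<n. X l i * X j i))"
      by (subst sum.swap) (simp add: sum_distrib_left mult.assoc)
    also have "\<dots> = (\<Sum>l<n. if l = j then Qf $$ (a, l) else 0)"
      using X_orthogonal(2)[OF _ that(1)] by (intro sum.cong) auto
    finally show ?thesis using that by simp
  qed
  have 1: "Pm = col_block Qf m q * Xs"
  proof (rule eq_matI)
    fix a i assume "a < dim_row (col_block Qf m q * Xs)" "i < dim_col (col_block Qf m q * Xs)"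
    then have ai: "a < n" "i < q" using Qs Xs by auto
    then have "Pm $$ (a, i) = (\<Sum>j<n. Qf $$ (a, j) * X j (m + i))" using mq by (simp add: Pm_def pQ)
    also have "\<dots> = (\<Sum>j<q. Qf $$ (a, m + j) * X (m + j) (m + i))"
      using X0[of "m + i"] ai mq by (intro restrict) auto
    finally show "Pm $$ (a, i) = (col_block Qf m q * Xs) $$ (a, i)"
      using ai Qf(1) by (simp add: col_block_def Xs_def scalar_prod_def atLeast0LessThan)
  qed (use Pm Qs Xs in auto)
  have 2: "col_block Qf m q = Pm * transpose_mat Xs"
  proof (rule eq_matI)
    fix a j assume "a < dim_row (Pm * transpose_mat Xs)" "j < dim_col (Pm * transpose_mat Xs)"
    then have aj: "a < n" "j < q" using Pm Xs by auto
    then have "col_block Qf m q $$ (a, j) = (\<Sum>i<n. p i $ a * X (m + j) i)"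
      using mq Qf(1) by (simp add: col_block_def Qp)
    also have "\<dots> = (\<Sum>i<q. p (m + i) $ a * X (m + j) (m + i))"
      using X0[of _ "m + j"] aj mq by (intro restrict) auto
    finally show "col_block Qf m q $$ (a, j) = (Pm * transpose_mat Xs) $$ (a, j)"
      using aj by (simp add: Pm_def Xs_def scalar_prod_def atLeast0LessThan)
  qed (use Pm Qs Xs in auto)
  have "vspan n (p ` {m..<m + q}) = vec_space.col_space n Pm"
    unfolding vspan_def vec_space.col_space_def cols ..
  also have "\<dots> = vec_space.col_space n (col_block Qf m q)"
  proof
    show "vec_space.col_space n Pm \<subseteq> vec_space.col_space n (col_block Qf m q)"
      using col_space_mult_subset[OF Qs Xs] unfolding 1[symmetric] .
    have "transpose_mat Xs \<in> carrier_mat q q" using Xs by simp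
    from col_space_mult_subset[OF Pm this]
    show "vec_space.col_space n (col_block Qf m q) \<subseteq> vec_space.col_space n Pm" unfolding 2[symmetric] .
  qed
  finally show ?thesis .
qed

end

theorem theorem6p2:
  fixes \<Omega> :: "('d::{finite,linorder} pt) set"
    and K :: "'d pt \<Rightarrow> 'd pt \<Rightarrow> real"
    and k n :: nat
    and xs :: "nat \<Rightarrow> 'd pt"
    and e :: "nat \<Rightarrow> ('d \<Rightarrow> nat)"
    and \<epsilon>0 :: real
    and lam :: "nat \<Rightarrow> real \<Rightarrow> real"
    and P :: "nat \<Rightarrow> real \<Rightarrow> real mat"
    and p :: "nat \<Rightarrow> real vec"
    and Qf R :: "real mat"
  assumes "open \<Omega>" and "0 \<in> \<Omega>"
    and "k \<ge> 1"
    and "Ckk (k + 1) \<Omega> K"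
    and "graded_enum e"
    and "cardP TYPE('d) (k - 1) < n" and "n \<le> cardP TYPE('d) k"
    and "\<epsilon>0 > 0"
    and "\<forall>\<epsilon>\<in>{0..\<epsilon>0}. sym_mat (Kmat K xs n \<epsilon>) \<and> psd_mat (Kmat K xs n \<epsilon>)"
    and "\<forall>a<n. \<forall>b<n. analytic_near0 (\<lambda>\<epsilon>. Kmat K xs n \<epsilon> $$ (a, b))"
    and "analytic_eig K xs n lam P"
    and "\<forall>i<n. limiting_eigvec n (P i) (p i)"
    and "full_QR (Vle e xs n (k - 1)) Qf R"
  shows "let l = cardP TYPE('d) k - n;
             N = (\<lambda>s. if s < k then cardH TYPE('d) s else cardH TYPE('d) k - l);
             pos = (\<lambda>s j. offs TYPE('d) s + (j - 1));
             Q = (\<lambda>s. col_block Qf (offs TYPE('d) s) (N s));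
             V = Vle e xs n;
             W = Wr e K
         in \<exists>lt :: nat \<Rightarrow> nat \<Rightarrow> real.
           (\<forall>s\<le>k. \<forall>j\<in>{1..N s}.
              (\<lambda>\<epsilon>. lam (pos s j) \<epsilon> - \<epsilon> ^ (2 * s) * lt s j) \<in> O[at_right 0](\<lambda>\<epsilon>. \<epsilon> ^ (2 * s + 1))) \<and>
           lt 0 1 = real n * K 0 0 \<and>
           (\<forall>s. 1 \<le> s \<and> s < k \<and> det (W (s - 1)) \<noteq> 0 \<and>
                 vec_space.rank n (V (s - 1)) = dim_col (V (s - 1)) \<longrightarrow>
              (\<Prod>j=1..cardH TYPE('d) s. lt s j) =
                det (transpose_mat (V s) * V s) * det (W s) /
                (det (transpose_mat (V (s - 1)) * V (s - 1)) * det (W (s - 1)))) \<and>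
           (\<forall>s. 1 \<le> s \<and> s \<le> k \<and> det (W (s - 1)) \<noteq> 0 \<and>
                 vec_space.rank n (V (s - 1)) = dim_col (V (s - 1)) \<longrightarrow>
              char_poly (transpose_mat (Q s) * Vh e xs n s * Wtil e K s *
                         transpose_mat (Vh e xs n s) * Q s) =
                (\<Prod>j=1..N s. [:- lt s j, 1:])) \<and>
           (\<forall>s. s < k \<and> det (W s) \<noteq> 0 \<and> vec_space.rank n (V s) = dim_col (V s) \<longrightarrow>
              vspan n (p ` pos s ` {1..cardH TYPE('d) s}) = vec_space.col_space n (Q s)) \<and>
           (det (W (k - 1)) \<noteq> 0 \<and> vec_space.rank n (V (k - 1)) = dim_col (V (k - 1)) \<longrightarrow>
              vspan n (p ` pos k ` {1..N k}) = vec_space.col_space n (Q k))"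
proof -
  interpret kernel_setup \<Omega> K k n xs e \<epsilon>0 lam P p Qf R
    using assms by unfold_locales auto
  obtain Z where flat: "flat_limit n (\<lambda>i. mdeg (e i)) lam Z M G"
    and ZX: "\<And>i j. i < n \<Longrightarrow> j < n \<Longrightarrow> ((\<lambda>\<epsilon>. (Z \<epsilon> j i)\<^sup>2) \<longlongrightarrow> (X j i)\<^sup>2) (at_right 0)"
    using spectral_data by blast
  obtain lt where ltO: "\<forall>i<n. (\<lambda>\<epsilon>. lam i \<epsilon> - \<epsilon> ^ (2 * mdeg (e i)) * lt i) \<in> O[at_right 0](\<lambda>\<epsilon>. \<epsilon> ^ (2 * mdeg (e i) + 1))"
    using lt_exists[OF flat] by (rule exE)
  have lt: "((\<lambda>\<epsilon>. lam i \<epsilon> / \<epsilon> ^ (2 * mdeg (e i))) \<longlongrightarrow> lt i) (at_right 0)" if "i < n" for i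
    using ltO that by (intro leading_term_tendsto) auto
  let ?o = "offs TYPE('d)"
  have pos_img: "(\<lambda>j. ?o s + (j - 1)) ` {1..c} = {?o s..<?o s + c}" for s c
  proof -
    have "i \<in> (\<lambda>j. ?o s + (j - 1)) ` {1..c}" if "i \<in> {?o s..<?o s + c}" for i
      using that by (intro image_eqI[of _ _ "i - ?o s + 1"]) auto
    then show ?thesis by auto
  qed
  have prod_shift: "(\<Prod>j=1..c. f (?o s + (j - 1))) = (\<Prod>j<c. f (?o s + j))" for c s and f :: "nat \<Rightarrow> 'b::comm_monoid_mult"
    by (rule prod.reindex_bij_witness[where i = "\<lambda>j. j + 1" and j = "\<lambda>j. j - 1"]) auto
  \<comment> \<open>Each group is numbered from 1 and positions from 0; hence the
    \<open>j - 1\<close>.\<close>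
  define Lt where "Lt s j = lt (?o s + (j - 1))" for s j
  \<comment> \<open>The \<open>min\<close> treats both parts of item 3: for \<open>s < k\<close> the
    coefficients up to the end of block \<open>s\<close> must be nonzero, for \<open>s = k\<close>
    only those before block \<open>k\<close>, whose own coefficients may vanish.\<close>
  have span: "vspan n (p ` {?o s..<?o s + N s}) = vec_space.col_space n (col_block Qf (?o s) (N s))"
    if sk: "s \<le> k" and nz: "\<And>i. i < min (?o s + N s) (?o k) \<Longrightarrow> lt i \<noteq> 0" for s
  proof (rule vspan_block[OF block_facts(1)[OF sk]])
    fix i j assume i: "i < n" and j: "j < n" and ne: "(i \<in> {?o s..<?o s + N s}) \<noteq> (j \<in> {?o s..<?o s + N s})"
    have o_mono: "?o s' \<le> ?o t" if "s' \<le> t" for s' t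
      using that offs_le_iff[OF e, of s' "?o t"] offs_le_iff[OF e, of t "?o t"] by simp
    have sN: "?o s + N s = (if s < k then ?o (Suc s) else n)" using offs_plus_N[OF sk] by (simp add: offs_def)
    have X0: "X j i = 0" if "t = s \<or> t = Suc s \<and> s < k" and
      "i < ?o t \<and> mdeg (e i) < mdeg (e j) \<or> j < ?o t \<and> ?o t \<le> i" for t
    proof -
      have tk: "t \<le> k" using that(1) sk by auto
      have "?o t \<le> ?o s + N s" using that(1) sN by auto
      then have "lt i \<noteq> 0" if "i < ?o t" for i using nz[of i] o_mono[OF tk] that by simp
      from X_zero[OF flat ZX lt tk this i j that(2)] show ?thesis by simp
    qed
    have bf: "mdeg (e l) < s \<longleftrightarrow> l < ?o s" "mdeg (e l) \<le> s \<longleftrightarrow> l < ?o s + N s" if "l < n" for l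
      using block_facts(2,3)[OF sk that] by simp_all
    \<comment> \<open>If exactly one of \<open>i\<close> and \<open>j\<close> lies in the block, one
      of its two ends separates them. For \<open>s = k\<close> the upper end is \<open>n\<close> and
      separates nothing.\<close>
    consider "i < ?o s" "?o s \<le> j" | "j < ?o s" "?o s \<le> i"
      | "i < ?o s + N s" "?o s + N s \<le> j" | "j < ?o s + N s" "?o s + N s \<le> i"
      using ne by fastforce
    then show "X j i = 0"
    proof cases
      case 1
      then have "mdeg (e i) < mdeg (e j)" using bf(1)[OF i] bf(1)[OF j] by simp
      then show ?thesis using 1 by (intro X0[of s]) auto
    next
      case 2
      then show ?thesis by (intro X0[of s]) auto
    next
      case 3
      then have "s < k" "mdeg (e i) < mdeg (e j)" using bf(2)[OF i] bf(2)[OF j] j sN by (auto split: if_splits)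
      then show ?thesis using 3 sN by (intro X0[of "Suc s"]) auto
    next
      case 4
      then have "s < k" using i sN by (auto split: if_splits)
      then show ?thesis using 4 sN by (intro X0[of "Suc s"]) auto
    qed
  qed
  show ?thesis
    unfolding Let_def N_def[symmetric]
  proof (intro exI[of _ Lt] conjI allI impI ballI)
    fix s j assume s: "s \<le> k" and j: "j \<in> {1..N s}"
    define i where "i = ?o s + (j - 1)"
    have "i < ?o s + N s" using j by (auto simp: i_def)
    then have i: "i < n" "mdeg (e i) = s" using block_facts(1)[OF s] block_facts(5)[OF s, of i] by (auto simp: i_def)
    show "(\<lambda>\<epsilon>. lam (?o s + (j - 1)) \<epsilon> - \<epsilon> ^ (2 * s) * Lt s j) \<in> O[at_right 0](\<lambda>\<epsilon>. \<epsilon> ^ (2 * s + 1))"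
      using ltO i unfolding Lt_def i_def[symmetric] by blast
  next
    show "Lt 0 1 = real n * K 0 0" using lt_0[OF lt] by (simp add: Lt_def offs_def)
  next
    fix s assume *: "1 \<le> s \<and> s < k \<and> det (Wr e K (s - 1)) \<noteq> 0 \<and>
      vec_space.rank n (Vle e xs n (s - 1)) = dim_col (Vle e xs n (s - 1))"
    have "(\<Prod>j<cardH TYPE('d) s. lt (?o s + j)) =
      det (transpose_mat (Vle e xs n s) * Vle e xs n s) * det (Wr e K s) /
      (det (transpose_mat (Vle e xs n (s - 1)) * Vle e xs n (s - 1)) * det (Wr e K (s - 1)))"
      using * by (intro prod_lt block_char_poly(1)[OF lt flat]) auto
    then show "(\<Prod>j=1..cardH TYPE('d) s. Lt s j) =
      det (transpose_mat (Vle e xs n s) * Vle e xs n s) * det (Wr e K s) /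
      (det (transpose_mat (Vle e xs n (s - 1)) * Vle e xs n (s - 1)) * det (Wr e K (s - 1)))"
      unfolding Lt_def prod_shift .
  next
    fix s assume *: "1 \<le> s \<and> s \<le> k \<and> det (Wr e K (s - 1)) \<noteq> 0 \<and>
      vec_space.rank n (Vle e xs n (s - 1)) = dim_col (Vle e xs n (s - 1))"
    then have "char_poly (Em s * Wtil e K s * transpose_mat (Em s)) = (\<Prod>j<N s. [:- lt (?o s + j), 1:])"
      by (intro block_char_poly(1)[OF lt flat]) auto
    then show "char_poly (transpose_mat (col_block Qf (?o s) (N s)) * Vh e xs n s * Wtil e K s *
        transpose_mat (Vh e xs n s) * col_block Qf (?o s) (N s)) = (\<Prod>j=1..N s. [:- Lt s j, 1:])"
      using * unfolding Lt_def prod_shift[of "\<lambda>i. [:- lt i, 1:]"] by (simp only: block_product_eq)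
  next
    fix s assume *: "s < k \<and> det (Wr e K s) \<noteq> 0 \<and> vec_space.rank n (Vle e xs n s) = dim_col (Vle e xs n s)"
    have "lt i \<noteq> 0" if "i < ?o (Suc s)" for i
      using block_char_poly(2)[OF lt flat, of "Suc s"] * that by auto
    moreover have "?o (Suc s) = ?o s + N s" using offs_plus_N[of s] * by (simp add: offs_def)
    ultimately have "vspan n (p ` {?o s..<?o s + N s}) = vec_space.col_space n (col_block Qf (?o s) (N s))"
      using * by (intro span) auto
    moreover have "N s = cardH TYPE('d) s" using * by (simp add: N_def)
    ultimately show "vspan n (p ` (\<lambda>j. ?o s + (j - 1)) ` {1..cardH TYPE('d) s}) =
      vec_space.col_space n (col_block Qf (?o s) (N s))"
      unfolding pos_img by simp
  next
    assume *: "det (Wr e K (k - 1)) \<noteq> 0 \<and> vec_space.rank n (Vle e xs n (k - 1)) = dim_col (Vle e xs n (k - 1))"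
    have "lt i \<noteq> 0" if "i < ?o k" for i
      using block_char_poly(2)[OF lt flat, of k] * that k by auto
    then show "vspan n (p ` (\<lambda>j. ?o k + (j - 1)) ` {1..N k}) =
      vec_space.col_space n (col_block Qf (?o k) (N k))"
      unfolding pos_img by (intro span) auto
  qed
qed

end
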